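(* Let $R$ be a ring. Then the homotopy category $\mathbf{K}(\mathrm{Prj}\,\mathbf{C}(R))$ is well generated.
   Context: Rings are associative with identity; modules are left modules. $\mathbf{C}(R)$ is the abelian category of complexes of $R$-modules and chain maps. $\mathrm{Prj}\,\mathbf{C}(R)$ is the class of projective objects of $\mathbf{C}(R)$ (equivalently, exact complexes all of whose cycle modules are projective), and $\mathbf{K}(\mathrm{Prj}\,\mathbf{C}(R))$ is the homotopy category of complexes in $\mathrm{Prj}\,\mathbf{C}(R)$; it is a triangulated category with coproducts. Let $\mathcal{T}$ be a triangulated category with arbitrary small coproducts. For a regular cardinal $\alpha$, an object $C$ of $\mathcal{T}$ is $\alpha$-small if every map $C\to\coprod_{i\in I}T_i$ factors through $\coprod_{i\in J}T_i$ for some $J\subseteq I$ with $\mathrm{card}\,J<\alpha$. $\mathcal{T}$ is well generated (in the sense of Neeman; in Krause's equivalent formulation) if there are a regular cardinal $\alpha$ and a set $\mathcal{S}$ of objects of $\mathcal{T}$, closed under shifts, such that: (1) an object $T$ with $\mathrm{Hom}_{\mathcal{T}}(S,T)=0$ for all $S\in\mathcal{S}$ is zero; (2) for every set of maps $X_i\to Y_i$ ($i\in I$) in $\mathcal{T}$, if $\mathrm{Hom}_{\mathcal{T}}(S,X_i)\to\mathrm{Hom}_{\mathcal{T}}(S,Y_i)$ is surjective for all $i\in I$ and $S\in\mathcal{S}$, then $\mathrm{Hom}_{\mathcal{T}}(S,\coprod X_i)\to\mathrm{Hom}_{\mathcal{T}}(S,\coprod Y_i)$ is surjective for all $S\in\mathcal{S}$;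 (3) every $S\in\mathcal{S}$ is $\alpha$-small. *)

theory Defs
  imports "HOL-Algebra.Module" "HOL-Algebra.AbelCoset"
begin

unbundle cardinal_syntax

section \<open>Size\<close>

text \<open>
  A type \<open>'u\<close> plays the role of the set-theoretic universe: a set is small if it has fewer
  elements than \<open>'u\<close>. Of the closure properties of a Grothendieck universe, only those recorded in
  \<open>universe_for\<close> are demanded: \<open>|'u|\<close> is regular (small unions of small sets are small), and the
  power sets of the natural numbers and of the ring are small. Every universe containing the ring
  satisfies them (it is a regular strong limit), and, unlike strong inaccessibility, they can be
  realised in HOL over every ring; see \<open>universe_for_exists\<close> below.
\<close>

definition small :: "'u itself \<Rightarrow> 'a set \<Rightarrow> bool" where
  "small _ A \<longleftrightarrow> |A| <o |UNIV :: 'u set|"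

definition universe_for :: "'u itself \<Rightarrow> ('r, 'x) ring_scheme \<Rightarrow> bool" where
  "universe_for u R \<longleftrightarrow>
     regularCard |UNIV :: 'u set| \<and> small u (Pow (UNIV :: nat set)) \<and> small u (Pow (carrier R))"


section \<open>Preadditive categories\<close>

text \<open>
  \<open>Hom C X Y\<close> is an abelian group in the additive notation of HOL-Algebra, so only the fields
  \<open>carrier\<close>, \<open>add\<close> and \<open>zero\<close> of the ring record are meaningful. Hom groups of different pairs of
  objects need not be disjoint, hence composition carries its three objects:
  \<open>cmp C X Y Z g f\<close> is \<open>g \<circ> f\<close> for \<open>f : X \<rightarrow> Y\<close> and \<open>g : Y \<rightarrow> Z\<close>.
\<close>

record ('o, 'm) category =
  objs :: "'o set"
  Hom :: "'o \<Rightarrow> 'o \<Rightarrow> 'm ring"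
  cmp :: "'o \<Rightarrow> 'o \<Rightarrow> 'o \<Rightarrow> 'm \<Rightarrow> 'm \<Rightarrow> 'm"
  idm :: "'o \<Rightarrow> 'm"

abbreviation mor :: "('o, 'm, 'z) category_scheme \<Rightarrow> 'o \<Rightarrow> 'o \<Rightarrow> 'm set" where
  "mor C X Y \<equiv> carrier (Hom C X Y)"

definition ab_group :: "'m set \<Rightarrow> ('m \<Rightarrow> 'm \<Rightarrow> 'm) \<Rightarrow> 'm \<Rightarrow> 'm ring" where
  "ab_group A p z = \<lparr>carrier = A, monoid.mult = undefined, one = undefined, zero = z, add = p\<rparr>"

definition zero_object :: "('o, 'm, 'z) category_scheme \<Rightarrow> 'o \<Rightarrow> bool" where
  "zero_object C T \<longleftrightarrow> T \<in> objs C \<and>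
     (\<forall>X\<in>objs C. (\<exists>!f. f \<in> mor C X T) \<and> (\<exists>!f. f \<in> mor C T X))"

definition epi :: "('o, 'm, 'z) category_scheme \<Rightarrow> 'o \<Rightarrow> 'o \<Rightarrow> 'm \<Rightarrow> bool" where
  "epi C X Y e \<longleftrightarrow> e \<in> mor C X Y \<and>
     (\<forall>Z\<in>objs C. \<forall>g\<in>mor C Y Z. \<forall>h\<in>mor C Y Z. cmp C X Y Z g e = cmp C X Y Z h e \<longrightarrow> g = h)"

definition projective :: "('o, 'm, 'z) category_scheme \<Rightarrow> 'o \<Rightarrow> bool" where
  "projective C P \<longleftrightarrow> P \<in> objs C \<and>
     (\<forall>X\<in>objs C. \<forall>Y\<in>objs C. \<forall>e. epi C X Y e \<longrightarrow>
        (\<forall>f\<in>mor C P Y. \<exists>g\<in>mor C P X. cmp C P X Y e g = f))"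

text \<open>The full subcategory of projective objects.\<close>

definition Prj :: "('o, 'm) category \<Rightarrow> ('o, 'm) category" where
  "Prj C = C\<lparr>objs := {P. projective C P}\<rparr>"

definition is_coproduct ::
  "('o, 'm, 'z) category_scheme \<Rightarrow> 'i set \<Rightarrow> ('i \<Rightarrow> 'o) \<Rightarrow> 'o \<Rightarrow> ('i \<Rightarrow> 'm) \<Rightarrow> bool" where
  "is_coproduct C I X Z \<iota> \<longleftrightarrow> Z \<in> objs C \<and> (\<forall>i\<in>I. \<iota> i \<in> mor C (X i) Z) \<and>
     (\<forall>W\<in>objs C. \<forall>g. (\<forall>i\<in>I. g i \<in> mor C (X i) W) \<longrightarrow>
        (\<exists>!h. h \<in> mor C Z W \<and> (\<forall>i\<in>I. cmp C (X i) Z W h (\<iota> i) = g i)))"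

text \<open>Small index sets are taken inside \<open>'u\<close>; up to bijection these are all the small sets.\<close>

definition has_small_coproducts :: "'u itself \<Rightarrow> ('o, 'm, 'z) category_scheme \<Rightarrow> bool" where
  "has_small_coproducts u C \<longleftrightarrow>
     (\<forall>(I :: 'u set) X. small u I \<and> X ` I \<subseteq> objs C \<longrightarrow> (\<exists>Z \<iota>. is_coproduct C I X Z \<iota>))"


section \<open>Modules\<close>

text \<open>The locale \<open>module\<close> of HOL-Algebra is restricted to commutative rings.\<close>

locale left_module = R?: ring + M?: abelian_group M for M (structure) +
  assumes smult_closed [simp, intro]:
      "\<lbrakk>a \<in> carrier R; x \<in> carrier M\<rbrakk> \<Longrightarrow> a \<odot>\<^bsub>M\<^esub> x \<in> carrier M"
    and smult_l_distr:
      "\<lbrakk>a \<in> carrier R; b \<in> carrier R; x \<in> carrier M\<rbrakk> \<Longrightarrow>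
        (a \<oplus>\<^bsub>R\<^esub> b) \<odot>\<^bsub>M\<^esub> x = a \<odot>\<^bsub>M\<^esub> x \<oplus>\<^bsub>M\<^esub> b \<odot>\<^bsub>M\<^esub> x"
    and smult_r_distr:
      "\<lbrakk>a \<in> carrier R; x \<in> carrier M; y \<in> carrier M\<rbrakk> \<Longrightarrow>
        a \<odot>\<^bsub>M\<^esub> (x \<oplus>\<^bsub>M\<^esub> y) = a \<odot>\<^bsub>M\<^esub> x \<oplus>\<^bsub>M\<^esub> a \<odot>\<^bsub>M\<^esub> y"
    and smult_assoc:
      "\<lbrakk>a \<in> carrier R; b \<in> carrier R; x \<in> carrier M\<rbrakk> \<Longrightarrow>
        (a \<otimes>\<^bsub>R\<^esub> b) \<odot>\<^bsub>M\<^esub> x = a \<odot>\<^bsub>M\<^esub> (b \<odot>\<^bsub>M\<^esub> x)"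
    and smult_one [simp]: "x \<in> carrier M \<Longrightarrow> \<one>\<^bsub>R\<^esub> \<odot>\<^bsub>M\<^esub> x = x"

text \<open>Linear maps are extensional functions (\<open>undefined\<close> off the carrier of the source).\<close>

definition linear_maps ::
  "('r, 'x) ring_scheme \<Rightarrow> ('r, 'u) module \<Rightarrow> ('r, 'u) module \<Rightarrow> ('u \<Rightarrow> 'u) set" where
  "linear_maps R M N = {f \<in> carrier M \<rightarrow>\<^sub>E carrier N.
     (\<forall>x\<in>carrier M. \<forall>y\<in>carrier M. f (x \<oplus>\<^bsub>M\<^esub> y) = f x \<oplus>\<^bsub>N\<^esub> f y) \<and>
     (\<forall>a\<in>carrier R. \<forall>x\<in>carrier M. f (a \<odot>\<^bsub>M\<^esub> x) = a \<odot>\<^bsub>N\<^esub> f x)}"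

definition ModCat :: "('r, 'x) ring_scheme \<Rightarrow> (('r, 'u) module, 'u \<Rightarrow> 'u) category" where
  "ModCat R =
    \<lparr>objs = {M. left_module R M \<and> small TYPE('u) (carrier M)},
     Hom = (\<lambda>M N. ab_group (linear_maps R M N)
              (\<lambda>f g. \<lambda>x\<in>carrier M. f x \<oplus>\<^bsub>N\<^esub> g x) (\<lambda>x\<in>carrier M. \<zero>\<^bsub>N\<^esub>)),
     cmp = (\<lambda>L M N g f. compose (carrier L) g f),
     idm = (\<lambda>M. \<lambda>x\<in>carrier M. x)\<rparr>"


section \<open>Complexes\<close>

text \<open>
  A complex is a pair \<open>(X, d)\<close> with \<open>d n : X n \<rightarrow> X (n - 1)\<close>. The category \<open>A\<close> is an arbitrary
  preadditive category, since complexes of complexes are needed below.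
\<close>

type_synonym ('o, 'm) complex = "(int \<Rightarrow> 'o) \<times> (int \<Rightarrow> 'm)"

definition complexes :: "('o, 'm) category \<Rightarrow> ('o, 'm) complex set" where
  "complexes A = {(X, d). \<forall>n. X n \<in> objs A \<and> d n \<in> mor A (X n) (X (n - 1)) \<and>
     cmp A (X n) (X (n - 1)) (X (n - 2)) (d (n - 1)) (d n) = \<zero>\<^bsub>Hom A (X n) (X (n - 2))\<^esub>}"

definition chain_maps ::
  "('o, 'm) category \<Rightarrow> ('o, 'm) complex \<Rightarrow> ('o, 'm) complex \<Rightarrow> (int \<Rightarrow> 'm) set" where
  "chain_maps A = (\<lambda>(X, dX) (Y, dY). {f. \<forall>n. f n \<in> mor A (X n) (Y n) \<and>
     cmp A (X n) (Y n) (Y (n - 1)) (dY n) (f n)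
       = cmp A (X n) (X (n - 1)) (Y (n - 1)) (f (n - 1)) (dX n)})"

definition Ch :: "('o, 'm) category \<Rightarrow> (('o, 'm) complex, int \<Rightarrow> 'm) category" where
  "Ch A =
    \<lparr>objs = complexes A,
     Hom = (\<lambda>X Y. ab_group (chain_maps A X Y)
              (\<lambda>f g n. f n \<oplus>\<^bsub>Hom A (fst X n) (fst Y n)\<^esub> g n)
              (\<lambda>n. \<zero>\<^bsub>Hom A (fst X n) (fst Y n)\<^esub>)),
     cmp = (\<lambda>X Y Z g f n. cmp A (fst X n) (fst Y n) (fst Z n) (g n) (f n)),
     idm = (\<lambda>X n. idm A (fst X n))\<rparr>"


section \<open>The homotopy category\<close>

definition null_homotopic ::
  "('o, 'm) category \<Rightarrow> ('o, 'm) complex \<Rightarrow> ('o, 'm) complex \<Rightarrow> (int \<Rightarrow> 'm) set" where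
  "null_homotopic A = (\<lambda>(X, dX) (Y, dY). {f \<in> chain_maps A (X, dX) (Y, dY).
     \<exists>s. \<forall>n. s n \<in> mor A (X n) (Y (n + 1)) \<and>
       f n = cmp A (X n) (Y (n + 1)) (Y n) (dY (n + 1)) (s n)
               \<oplus>\<^bsub>Hom A (X n) (Y n)\<^esub> cmp A (X n) (X (n - 1)) (Y n) (s (n - 1)) (dX n)})"

definition homotopy_class ::
  "('o, 'm) category \<Rightarrow> ('o, 'm) complex \<Rightarrow> ('o, 'm) complex \<Rightarrow> (int \<Rightarrow> 'm) \<Rightarrow> (int \<Rightarrow> 'm) set" where
  "homotopy_class A X Y f = null_homotopic A X Y +>\<^bsub>Hom (Ch A) X Y\<^esub> f"

record ('o, 'm) shift_category = "('o, 'm) category" +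
  shift :: "'o \<Rightarrow> 'o"

text \<open>
  Morphisms of the homotopy category are homotopy classes of chain maps, i.e. cosets of the
  null-homotopic ones; in \<open>cmp\<close> all the classes in the union coincide.
  The shift is \<open>(\<Sigma>X)\<^sub>n = X\<^sub>n\<^sub>-\<^sub>1\<close> with differential \<open>- d\<close>.
\<close>

definition K :: "('o, 'm) category \<Rightarrow> (('o, 'm) complex, (int \<Rightarrow> 'm) set) shift_category" where
  "K A =
    \<lparr>objs = complexes A,
     Hom = (\<lambda>X Y. ab_group (a_rcosets\<^bsub>Hom (Ch A) X Y\<^esub> (null_homotopic A X Y))
              (set_add (Hom (Ch A) X Y)) (null_homotopic A X Y)),
     cmp = (\<lambda>X Y Z G F. \<Union>g\<in>G. \<Union>f\<in>F. homotopy_class A X Z (cmp (Ch A) X Y Z g f)),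
     idm = (\<lambda>X. homotopy_class A X X (idm (Ch A) X)),
     shift = (\<lambda>(X, d). (\<lambda>n. X (n - 1),
                        \<lambda>n. \<ominus>\<^bsub>Hom A (X (n - 1)) (X (n - 2))\<^esub> d (n - 1)))\<rparr>"


section \<open>Well generated categories\<close>

text \<open>
  The conditions below involve only the additive structure, the coproducts and the shift of
  objects of a triangulated category, so the distinguished triangles are not part of the data.
\<close>

definition cardinal_small ::
  "'u itself \<Rightarrow> ('o, 'm, 'z) category_scheme \<Rightarrow> 'a rel \<Rightarrow> 'o \<Rightarrow> bool" where
  "cardinal_small u T \<alpha> C \<longleftrightarrow>
     (\<forall>(I :: 'u set) X Z \<iota>. small u I \<and> X ` I \<subseteq> objs T \<and> is_coproduct T I X Z \<iota> \<longrightarrow>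
        (\<forall>f\<in>mor T C Z. \<exists>J W \<kappa>. J \<subseteq> I \<and> |J| <o \<alpha> \<and> is_coproduct T J X W \<kappa> \<and>
           (\<exists>c\<in>mor T W Z. (\<forall>j\<in>J. cmp T (X j) W Z c (\<kappa> j) = \<iota> j) \<and>
              (\<exists>g\<in>mor T C W. f = cmp T C W Z c g))))"

definition Hom_surjective ::
  "('o, 'm, 'z) category_scheme \<Rightarrow> 'o \<Rightarrow> 'o \<Rightarrow> 'o \<Rightarrow> 'm \<Rightarrow> bool" where
  "Hom_surjective T S X Y f \<longleftrightarrow> (\<lambda>g. cmp T S X Y f g) ` mor T S X = mor T S Y"

definition well_generated :: "'u itself \<Rightarrow> ('o, 'm) shift_category \<Rightarrow> bool" where
  "well_generated u T \<longleftrightarrow> has_small_coproducts u T \<and>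
     (\<exists>(\<alpha> :: 'u rel) \<S>.
        Cinfinite \<alpha> \<and> regularCard \<alpha> \<and> \<alpha> <o |UNIV :: 'u set| \<and>
        \<S> \<subseteq> objs T \<and> small u \<S> \<and> shift T ` \<S> = \<S> \<and>
        (\<forall>X\<in>objs T. (\<forall>S\<in>\<S>. mor T S X = {\<zero>\<^bsub>Hom T S X\<^esub>}) \<longrightarrow> zero_object T X) \<and>
        (\<forall>(I :: 'u set) X Y f ZX ZY \<iota> \<kappa> h.
           small u I \<and> X ` I \<subseteq> objs T \<and> Y ` I \<subseteq> objs T \<and> (\<forall>i\<in>I. f i \<in> mor T (X i) (Y i)) \<and>
           is_coproduct T I X ZX \<iota> \<and> is_coproduct T I Y ZY \<kappa> \<and> h \<in> mor T ZX ZY \<and>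
           (\<forall>i\<in>I. cmp T (X i) ZX ZY h (\<iota> i) = cmp T (X i) (Y i) ZY (\<kappa> i) (f i)) \<and>
           (\<forall>i\<in>I. \<forall>S\<in>\<S>. Hom_surjective T S (X i) (Y i) (f i))
           \<longrightarrow> (\<forall>S\<in>\<S>. Hom_surjective T S ZX ZY h)) \<and>
        (\<forall>S\<in>\<S>. cardinal_small u T \<alpha> S))"


section \<open>Existence of universes\<close>

typedef 'r univ = "Field (cardSuc |UNIV :: ('r + nat) set set| )"
proof -
  have "Cinfinite |UNIV :: ('r + nat) set set|"
    unfolding cinfinite_def by (simp add: Finite_Set.finite_set Field_card_of card_of_card_order_on)
  then have "infinite (Field (cardSuc |UNIV :: ('r + nat) set set| ))"
    using Cinfinite_cardSuc unfolding cinfinite_def by blast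
  then show ?thesis by (metis finite.emptyI ex_in_conv)
qed

lemma universe_for_exists:
  fixes R :: "('r, 'x) ring_scheme"
  shows "universe_for TYPE('r univ) R"
proof -
  let ?k = "|UNIV :: ('r + nat) set set|"
  have inf: "Cinfinite ?k"
    unfolding cinfinite_def by (simp add: Finite_Set.finite_set Field_card_of card_of_card_order_on)
  have "bij_betw Rep_univ (UNIV :: 'r univ set) (Field (cardSuc ?k))"
    using type_definition.Rep_range[OF type_definition_univ]
    by (auto simp: bij_betw_def inj_on_def Rep_univ_inject)
  then have "|UNIV :: 'r univ set| =o |Field (cardSuc ?k)|"
    by (rule card_of_ordIsoI)
  then have iso: "|UNIV :: 'r univ set| =o cardSuc ?k"
    using card_of_Field_ordIso[OF cardSuc_Card_order[OF card_of_Card_order]]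
    by (rule ordIso_transitive)
  have reg: "regularCard |UNIV :: 'r univ set|"
    using regularCard_ordIso[OF ordIso_symmetric[OF iso] Cinfinite_cardSuc[OF inf]
        regularCard_cardSuc[OF inf]] .
  have lt: "?k <o |UNIV :: 'r univ set|"
    using cardSuc_greater[OF card_of_Card_order] ordIso_symmetric[OF iso]
    by (rule ordLess_ordIso_trans)
  have small: "|A| <o |UNIV :: 'r univ set|"
    if "inj_on f A" for A :: "'a set" and f :: "'a \<Rightarrow> ('r + nat) set"
  proof -
    have "|A| \<le>o |UNIV :: ('r + nat) set set|"
      using that card_of_ordLeq[of A UNIV] by blast
    then show ?thesis using lt by (rule ordLeq_ordLess_trans)
  qed
  have nat: "small TYPE('r univ) (Pow (UNIV :: nat set))"
    unfolding small_def
    by (rule small[of "\<lambda>X. Inr ` X"]) (simp add: inj_on_def inj_image_eq_iff)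
  have ring: "small TYPE('r univ) (Pow (carrier R))"
    unfolding small_def
    by (rule small[of "\<lambda>X. Inl ` X"]) (simp add: inj_on_def inj_image_eq_iff)
  show ?thesis
    unfolding universe_for_def using reg nat ring by simp
qed

end

theory Submission
  imports Defs "HOL-Library.Countable_Set"
begin

text \<open>
  Projective complexes are retracts of coproducts of disks \<open>R = R\<close>. The argument works over every
  preadditive category with coproducts in which each object is a retract of a free one, i.e. of a
  coproduct of objects from a fixed set \<open>G\<close>, and in which maps from members of \<open>G\<close> into coproducts
  have countable support. The generators are the complexes whose terms are coproducts of countable
  families in \<open>G\<close>, and \<open>\<alpha>\<close> is the first uncountable cardinal. A complex \<open>X\<close> with retractions \<open>p\<^sub>n\<close> of
  free objects \<open>F\<^sub>n\<close> onto \<open>X\<^sub>n\<close>, with sections \<open>i\<^sub>n\<close>, is a retract of the complex of free objects with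
  differential \<open>i d p\<close>, and in a complex of free objects each countable part of the basis
  lies in a countable part spanning a degreewise split subcomplex.

  Therefore a complex of free objects is a transfinite extension of generators, and the argument of
  Eklof's lemma contracts every map from it to a complex \<open>T\<close> that receives only null-homotopic maps
  from generators; so \<open>T\<close>, being a retract of such a complex, is contractible. Similarly, a map from a
  generator to a coproduct of complexes \<open>Y\<^sub>i\<close> factors through a coproduct of maps \<open>S\<^sub>i \<rightarrow> Y\<^sub>i\<close> from
  generators, of which only countably many are nonzero. This gives the remaining two conditions.
\<close>

section \<open>Coproducts in preadditive categories\<close>

text \<open>The uncountable cardinal comes from the differential. The boundary of one basis summand
  meets only countably many others (finitely many for disks), but making a part of the basis stable
  under boundaries takes infinitely many rounds, so a single summand may already force a countably
  infinite subcomplex. Countably many rounds suffice, and the result is still countable. The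
  abstract category \<open>A\<close> comes without kernels and cokernels. Subcomplexes and quotients
  are therefore described by parts of a basis: the quotient of a closed part E by a closed part D
  has basis E - D, and all inclusions and retractions are degreewise split maps between coproducts.
  Maps into a coproduct are compared through its projections; that these are jointly monic is a
  hypothesis, because it can fail in a preadditive category with coproducts. Retracts enter only
  through free covers, so that no decomposition theorem for projective objects is invoked.\<close>

locale categ =
  fixes C :: "('o, 'm, 'z) category_scheme"
  assumes cmp_closed [simp]:
      "\<lbrakk>f \<in> mor C X Y; g \<in> mor C Y Z; X \<in> objs C; Y \<in> objs C; Z \<in> objs C\<rbrakk> \<Longrightarrow> cmp C X Y Z g f \<in> mor C X Z"
    and idm_closed [simp]: "X \<in> objs C \<Longrightarrow> idm C X \<in> mor C X X"
    and cmp_assoc: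
      "\<lbrakk>f \<in> mor C W X; g \<in> mor C X Y; h \<in> mor C Y Z; W \<in> objs C; X \<in> objs C; Y \<in> objs C; Z \<in> objs C\<rbrakk> \<Longrightarrow>
        cmp C W X Z (cmp C X Y Z h g) f = cmp C W Y Z h (cmp C W X Y g f)"
    and cmp_idm_left [simp]: "\<lbrakk>f \<in> mor C X Y; X \<in> objs C; Y \<in> objs C\<rbrakk> \<Longrightarrow> cmp C X Y Y (idm C Y) f = f"
    and cmp_idm_right [simp]: "\<lbrakk>f \<in> mor C X Y; X \<in> objs C; Y \<in> objs C\<rbrakk> \<Longrightarrow> cmp C X X Y f (idm C X) = f"

text \<open>Once composites are associated to the right, a commuting square no longer occurs as a
  subterm. Precomposing both of its sides with an arbitrary \<open>k\<close> gives a form that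
  rewriting can find.\<close>

lemma (in categ) cmp_eq_extend:
  assumes "cmp C X Y Z a b = cmp C X Y' Z c d" "k \<in> mor C W X" "b \<in> mor C X Y" "a \<in> mor C Y Z"
    "d \<in> mor C X Y'" "c \<in> mor C Y' Z" "W \<in> objs C" "X \<in> objs C" "Y \<in> objs C" "Y' \<in> objs C" "Z \<in> objs C"
  shows "cmp C W Y Z a (cmp C W X Y b k) = cmp C W Y' Z c (cmp C W X Y' d k)"
  using assms by (simp flip: cmp_assoc)

lemma is_coproductD:
  assumes "is_coproduct C I X Z \<iota>"
  shows coproduct_obj: "Z \<in> objs C" and coproduct_inj: "i \<in> I \<Longrightarrow> \<iota> i \<in> mor C (X i) Z"
  using assms by (auto simp: is_coproduct_def)

lemma coproduct_ex1:
  assumes "is_coproduct C I X Z \<iota>" "W \<in> objs C" "\<And>i. i \<in> I \<Longrightarrow> g i \<in> mor C (X i) W"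
  shows "\<exists>!h. h \<in> mor C Z W \<and> (\<forall>i\<in>I. cmp C (X i) Z W h (\<iota> i) = g i)"
  using assms unfolding is_coproduct_def by (elim conjE) (drule bspec, assumption, blast)

lemma coproduct_ex:
  assumes "is_coproduct C I X Z \<iota>" "W \<in> objs C" "\<And>i. i \<in> I \<Longrightarrow> g i \<in> mor C (X i) W"
  obtains h where "h \<in> mor C Z W" "\<And>i. i \<in> I \<Longrightarrow> cmp C (X i) Z W h (\<iota> i) = g i"
  using assms unfolding is_coproduct_def by blast

lemma (in categ) coproduct_ext:
  assumes "is_coproduct C I X Z \<iota>" "W \<in> objs C" "X ` I \<subseteq> objs C" "h \<in> mor C Z W" "h' \<in> mor C Z W"
    "\<And>i. i \<in> I \<Longrightarrow> cmp C (X i) Z W h (\<iota> i) = cmp C (X i) Z W h' (\<iota> i)"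
  shows "h = h'"
proof -
  have Z: "Z \<in> objs C" and i: "\<And>i. i \<in> I \<Longrightarrow> \<iota> i \<in> mor C (X i) Z"
    using is_coproductD[OF assms(1)] by auto
  have "\<forall>i\<in>I. cmp C (X i) Z W h' (\<iota> i) \<in> mor C (X i) W"
  proof
    fix i assume "i \<in> I"
    then show "cmp C (X i) Z W h' (\<iota> i) \<in> mor C (X i) W"
      using assms(2,3,5) by (intro cmp_closed[OF i _ _ Z]) auto
  qed
  then have "\<exists>!k. k \<in> mor C Z W \<and> (\<forall>i\<in>I. cmp C (X i) Z W k (\<iota> i) = cmp C (X i) Z W h' (\<iota> i))"
    by (intro coproduct_ex1[OF assms(1,2)]) simp
  then show ?thesis by (rule ex1E) (use assms(4-6) in blast)
qed

lemma is_coproductI: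
  assumes "Z \<in> objs C" "\<And>i. i \<in> I \<Longrightarrow> \<iota> i \<in> mor C (X i) Z"
    "\<And>W g. \<lbrakk>W \<in> objs C; \<And>i. i \<in> I \<Longrightarrow> g i \<in> mor C (X i) W\<rbrakk> \<Longrightarrow>
       \<exists>h. h \<in> mor C Z W \<and> (\<forall>i\<in>I. cmp C (X i) Z W h (\<iota> i) = g i)"
    "\<And>W h h'. \<lbrakk>W \<in> objs C; h \<in> mor C Z W; h' \<in> mor C Z W;
       \<And>i. i \<in> I \<Longrightarrow> cmp C (X i) Z W h (\<iota> i) = cmp C (X i) Z W h' (\<iota> i)\<rbrakk> \<Longrightarrow> h = h'"
  shows "is_coproduct C I X Z \<iota>"
  unfolding is_coproduct_def
proof (intro conjI ballI allI impI)
  fix W g assume W: "W \<in> objs C" and g: "\<forall>i\<in>I. g i \<in> mor C (X i) W"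
  obtain h where h: "h \<in> mor C Z W" "\<forall>i\<in>I. cmp C (X i) Z W h (\<iota> i) = g i"
    using assms(3)[OF W bspec[OF g]] by blast
  show "\<exists>!h. h \<in> mor C Z W \<and> (\<forall>i\<in>I. cmp C (X i) Z W h (\<iota> i) = g i)"
  proof (rule ex1I[of _ h])
    fix h' assume "h' \<in> mor C Z W \<and> (\<forall>i\<in>I. cmp C (X i) Z W h' (\<iota> i) = g i)"
    with h show "h' = h" by (auto intro: assms(4)[OF W, of h' h])
  qed (use h in auto)
qed (use assms(1,2) in auto)

text \<open>Only one of the two inverse laws is recorded; the other is obtained by exchanging the
  two coproducts.\<close>

lemma (in categ) coproduct_iso:
  assumes Z: "is_coproduct C I X Z \<iota>" and Z': "is_coproduct C I X Z' \<iota>'" and X: "X ` I \<subseteq> objs C"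
  obtains h k where "h \<in> mor C Z Z'" "k \<in> mor C Z' Z" "cmp C Z Z' Z k h = idm C Z"
    "\<And>i. i \<in> I \<Longrightarrow> cmp C (X i) Z Z' h (\<iota> i) = \<iota>' i" "\<And>i. i \<in> I \<Longrightarrow> cmp C (X i) Z' Z k (\<iota>' i) = \<iota> i"
proof -
  note z = is_coproductD[OF Z] is_coproductD[OF Z']
  obtain h where h: "h \<in> mor C Z Z'" "\<And>i. i \<in> I \<Longrightarrow> cmp C (X i) Z Z' h (\<iota> i) = \<iota>' i"
    using coproduct_ex[OF Z, of Z' \<iota>'] z by blast
  obtain k where k: "k \<in> mor C Z' Z" "\<And>i. i \<in> I \<Longrightarrow> cmp C (X i) Z' Z k (\<iota>' i) = \<iota> i"
    using coproduct_ex[OF Z', of Z \<iota>] z by blast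
  have "cmp C Z Z' Z k h = idm C Z"
  proof (rule coproduct_ext[OF Z _ X])
    fix i assume i: "i \<in> I"
    then have "X i \<in> objs C" using X by auto
    with i show "cmp C (X i) Z Z (cmp C Z Z' Z k h) (\<iota> i) = cmp C (X i) Z Z (idm C Z) (\<iota> i)"
      using h k z by (simp add: cmp_assoc)
  qed (use h k z in auto)
  then show ?thesis using that h k by blast
qed

text \<open>The legs are renamed while the vertex stays the same. This moves a family over any
  countable index set to one over a subset of a fixed set, for which a coproduct has been
  chosen.\<close>

lemma (in categ) coproduct_reindex:
  assumes Z: "is_coproduct C J X Z \<iota>" and b: "bij_betw \<phi> I J" and X: "X ` J \<subseteq> objs C"
    and Y: "\<And>i. i \<in> I \<Longrightarrow> Y i = X (\<phi> i)" "\<And>i. i \<in> I \<Longrightarrow> \<kappa> i = \<iota> (\<phi> i)"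
  shows "is_coproduct C I Y Z \<kappa>"
proof (rule is_coproductI)
  note z = is_coproductD[OF Z]
  show "Z \<in> objs C" using z by simp
  have mem: "\<phi> i \<in> J" if "i \<in> I" for i using b that by (auto simp: bij_betw_def)
  show "\<kappa> i \<in> mor C (Y i) Z" if "i \<in> I" for i using z Y mem that by auto
  fix W assume W: "W \<in> objs C"
  {
    fix g assume g: "\<And>i. i \<in> I \<Longrightarrow> g i \<in> mor C (Y i) W"
    let ?\<psi> = "inv_into I \<phi>"
    have psi: "?\<psi> j \<in> I" "\<phi> (?\<psi> j) = j" if "j \<in> J" for j
      using b that by (auto simp: bij_betw_def f_inv_into_f inv_into_into)
    have psi2: "?\<psi> (\<phi> i) = i" if "i \<in> I" for i
      using b that by (auto simp: bij_betw_def)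
    have "g (?\<psi> j) \<in> mor C (X j) W" if "j \<in> J" for j using g[OF psi(1)[OF that]] Y psi that by auto
    then obtain h where "h \<in> mor C Z W" "\<And>j. j \<in> J \<Longrightarrow> cmp C (X j) Z W h (\<iota> j) = g (?\<psi> j)"
      using coproduct_ex[OF Z W, of "\<lambda>j. g (?\<psi> j)"] by blast
    then show "\<exists>h. h \<in> mor C Z W \<and> (\<forall>i\<in>I. cmp C (Y i) Z W h (\<kappa> i) = g i)"
      using mem Y psi2 by (intro exI[of _ h]) auto
  next
    fix h h' assume h: "h \<in> mor C Z W" "h' \<in> mor C Z W"
      "\<And>i. i \<in> I \<Longrightarrow> cmp C (Y i) Z W h (\<kappa> i) = cmp C (Y i) Z W h' (\<kappa> i)"
    show "h = h'"
    proof (rule coproduct_ext[OF Z W X h(1,2)])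
      fix j assume "j \<in> J"
      then obtain i where "i \<in> I" "j = \<phi> i" using b by (auto simp: bij_betw_def)
      then show "cmp C (X j) Z W h (\<iota> j) = cmp C (X j) Z W h' (\<iota> j)" using h(3)[of i] Y by auto
    qed
  }
qed

section \<open>Additive structure on morphism sets\<close>

locale preadditive = categ C for C :: "('o, 'm, 'z) category_scheme" +
  assumes Hom_group: "\<lbrakk>X \<in> objs C; Y \<in> objs C\<rbrakk> \<Longrightarrow> abelian_group (Hom C X Y)"
    and cmp_add_left:
      "\<lbrakk>f \<in> mor C X Y; g \<in> mor C Y Z; g' \<in> mor C Y Z; X \<in> objs C; Y \<in> objs C; Z \<in> objs C\<rbrakk> \<Longrightarrow>
        cmp C X Y Z (g \<oplus>\<^bsub>Hom C Y Z\<^esub> g') f = cmp C X Y Z g f \<oplus>\<^bsub>Hom C X Z\<^esub> cmp C X Y Z g' f"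
    and cmp_add_right:
      "\<lbrakk>f \<in> mor C X Y; f' \<in> mor C X Y; g \<in> mor C Y Z; X \<in> objs C; Y \<in> objs C; Z \<in> objs C\<rbrakk> \<Longrightarrow>
        cmp C X Y Z g (f \<oplus>\<^bsub>Hom C X Y\<^esub> f') = cmp C X Y Z g f \<oplus>\<^bsub>Hom C X Z\<^esub> cmp C X Y Z g f'"
begin

lemma zero_mor [simp]: "\<lbrakk>X \<in> objs C; Y \<in> objs C\<rbrakk> \<Longrightarrow> \<zero>\<^bsub>Hom C X Y\<^esub> \<in> mor C X Y"
  using Hom_group[of X Y] by (simp add: abelian_group.axioms(1) abelian_monoid.zero_closed)

lemma add_mor [simp]:
  "\<lbrakk>f \<in> mor C X Y; g \<in> mor C X Y; X \<in> objs C; Y \<in> objs C\<rbrakk> \<Longrightarrow> f \<oplus>\<^bsub>Hom C X Y\<^esub> g \<in> mor C X Y"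
  using Hom_group[of X Y] by (simp add: abelian_group.axioms(1) abelian_monoid.a_closed)

lemma uminus_mor [simp]:
  "\<lbrakk>f \<in> mor C X Y; X \<in> objs C; Y \<in> objs C\<rbrakk> \<Longrightarrow> \<ominus>\<^bsub>Hom C X Y\<^esub> f \<in> mor C X Y"
  using Hom_group[of X Y] by (simp add: abelian_group.a_inv_closed)

lemma minus_mor [simp]:
  "\<lbrakk>f \<in> mor C X Y; g \<in> mor C X Y; X \<in> objs C; Y \<in> objs C\<rbrakk> \<Longrightarrow> f \<ominus>\<^bsub>Hom C X Y\<^esub> g \<in> mor C X Y"
  by (simp add: a_minus_def)

lemma add_zero_left [simp]:
  "\<lbrakk>f \<in> mor C X Y; X \<in> objs C; Y \<in> objs C\<rbrakk> \<Longrightarrow> \<zero>\<^bsub>Hom C X Y\<^esub> \<oplus>\<^bsub>Hom C X Y\<^esub> f = f"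
  using Hom_group[of X Y] by (simp add: abelian_group.axioms(1) abelian_monoid.l_zero)

lemma add_zero_right [simp]:
  "\<lbrakk>f \<in> mor C X Y; X \<in> objs C; Y \<in> objs C\<rbrakk> \<Longrightarrow> f \<oplus>\<^bsub>Hom C X Y\<^esub> \<zero>\<^bsub>Hom C X Y\<^esub> = f"
  using Hom_group[of X Y] by (simp add: abelian_group.axioms(1) abelian_monoid.r_zero)

lemma zero_cmp [simp]:
  assumes "f \<in> mor C X Y" "X \<in> objs C" "Y \<in> objs C" "Z \<in> objs C"
  shows "cmp C X Y Z \<zero>\<^bsub>Hom C Y Z\<^esub> f = \<zero>\<^bsub>Hom C X Z\<^esub>"
proof -
  interpret H: abelian_group "Hom C X Z" using Hom_group assms by auto
  let ?x = "cmp C X Y Z \<zero>\<^bsub>Hom C Y Z\<^esub> f"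
  have "?x \<oplus>\<^bsub>Hom C X Z\<^esub> ?x = ?x" using cmp_add_left[OF assms(1), of "\<zero>\<^bsub>Hom C Y Z\<^esub>" Z "\<zero>\<^bsub>Hom C Y Z\<^esub>"] assms
      by simp
  then show ?thesis using assms by simp
qed

lemma cmp_zero [simp]:
  assumes "g \<in> mor C Y Z" "X \<in> objs C" "Y \<in> objs C" "Z \<in> objs C"
  shows "cmp C X Y Z g \<zero>\<^bsub>Hom C X Y\<^esub> = \<zero>\<^bsub>Hom C X Z\<^esub>"
proof -
  interpret H: abelian_group "Hom C X Z" using Hom_group assms by auto
  let ?x = "cmp C X Y Z g \<zero>\<^bsub>Hom C X Y\<^esub>"
  have "?x \<oplus>\<^bsub>Hom C X Z\<^esub> ?x = ?x" using cmp_add_right[of "\<zero>\<^bsub>Hom C X Y\<^esub>" X Y "\<zero>\<^bsub>Hom C X Y\<^esub>" g Z] assms by simp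
  then show ?thesis using assms by simp
qed

lemma uminus_cmp [simp]:
  assumes "f \<in> mor C X Y" "g \<in> mor C Y Z" "X \<in> objs C" "Y \<in> objs C" "Z \<in> objs C"
  shows "cmp C X Y Z (\<ominus>\<^bsub>Hom C Y Z\<^esub> g) f = \<ominus>\<^bsub>Hom C X Z\<^esub> cmp C X Y Z g f"
proof -
  interpret H: abelian_group "Hom C X Z" using Hom_group assms by auto
  interpret G: abelian_group "Hom C Y Z" using Hom_group assms by auto
  have "cmp C X Y Z (\<ominus>\<^bsub>Hom C Y Z\<^esub> g) f \<oplus>\<^bsub>Hom C X Z\<^esub> cmp C X Y Z g f = \<zero>\<^bsub>Hom C X Z\<^esub>"
    using assms cmp_add_left[OF assms(1), of "\<ominus>\<^bsub>Hom C Y Z\<^esub> g" Z g] by (simp add: G.l_neg)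
  then show ?thesis using assms by (metis H.minus_equality cmp_closed uminus_mor)
qed

lemma cmp_uminus [simp]:
  assumes "f \<in> mor C X Y" "g \<in> mor C Y Z" "X \<in> objs C" "Y \<in> objs C" "Z \<in> objs C"
  shows "cmp C X Y Z g (\<ominus>\<^bsub>Hom C X Y\<^esub> f) = \<ominus>\<^bsub>Hom C X Z\<^esub> cmp C X Y Z g f"
proof -
  interpret H: abelian_group "Hom C X Z" using Hom_group assms by auto
  interpret G: abelian_group "Hom C X Y" using Hom_group assms by auto
  have "cmp C X Y Z g (\<ominus>\<^bsub>Hom C X Y\<^esub> f) \<oplus>\<^bsub>Hom C X Z\<^esub> cmp C X Y Z g f = \<zero>\<^bsub>Hom C X Z\<^esub>"
    using assms cmp_add_right[of "\<ominus>\<^bsub>Hom C X Y\<^esub> f" X Y f g Z] by (simp add: G.l_neg)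
  then show ?thesis using assms by (metis H.minus_equality cmp_closed uminus_mor)
qed

lemma minus_cmp:
  "\<lbrakk>f \<in> mor C X Y; g \<in> mor C Y Z; g' \<in> mor C Y Z; X \<in> objs C; Y \<in> objs C; Z \<in> objs C\<rbrakk> \<Longrightarrow>
    cmp C X Y Z (g \<ominus>\<^bsub>Hom C Y Z\<^esub> g') f = cmp C X Y Z g f \<ominus>\<^bsub>Hom C X Z\<^esub> cmp C X Y Z g' f"
  by (simp add: a_minus_def cmp_add_left)

lemma cmp_minus:
  "\<lbrakk>f \<in> mor C X Y; f' \<in> mor C X Y; g \<in> mor C Y Z; X \<in> objs C; Y \<in> objs C; Z \<in> objs C\<rbrakk> \<Longrightarrow>
    cmp C X Y Z g (f \<ominus>\<^bsub>Hom C X Y\<^esub> f') = cmp C X Y Z g f \<ominus>\<^bsub>Hom C X Z\<^esub> cmp C X Y Z g f'"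
  by (simp add: a_minus_def cmp_add_right)

lemma minus_eq_zero_iff:
  "\<lbrakk>f \<in> mor C X Y; g \<in> mor C X Y; X \<in> objs C; Y \<in> objs C\<rbrakk> \<Longrightarrow> f \<ominus>\<^bsub>Hom C X Y\<^esub> g = \<zero>\<^bsub>Hom C X Y\<^esub> \<longleftrightarrow> f = g"
proof -
  assume A: "f \<in> mor C X Y" "g \<in> mor C X Y" "X \<in> objs C" "Y \<in> objs C"
  then interpret H: abelian_group "Hom C X Y" using Hom_group by auto
  show ?thesis using A unfolding a_minus_def by (metis H.minus_equality H.minus_minus H.r_neg
      H.a_inv_closed)
qed

end

section \<open>Projections of a coproduct onto its summands\<close>

text \<open>The map is the identity on one summand and zero on the others, hence unique by the
  universal property, so a definite description suffices. It is meaningful for \<open>i\<close> in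
  \<open>I\<close>.\<close>

definition coproj ::
  "('o, 'm, 'z) category_scheme \<Rightarrow> 'i set \<Rightarrow> ('i \<Rightarrow> 'o) \<Rightarrow> 'o \<Rightarrow> ('i \<Rightarrow> 'm) \<Rightarrow> 'i \<Rightarrow> 'm" where
  "coproj C I X Z \<iota> i = (THE h. h \<in> mor C Z (X i) \<and>
     (\<forall>j\<in>I. cmp C (X j) Z (X i) h (\<iota> j) = (if j = i then idm C (X i) else \<zero>\<^bsub>Hom C (X j) (X i)\<^esub>)))"

text \<open>For modules this says that a direct sum embeds into the product; it does not follow from
  the universal property. Maps are tested against zero, and taking differences turns this into a
  test for equality.\<close>

definition jointly_monic ::
  "('o, 'm, 'z) category_scheme \<Rightarrow> 'i set \<Rightarrow> ('i \<Rightarrow> 'o) \<Rightarrow> 'o \<Rightarrow> ('i \<Rightarrow> 'm) \<Rightarrow> bool" where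
  "jointly_monic C I X Z \<iota> \<longleftrightarrow> (\<forall>A\<in>objs C. \<forall>f\<in>mor C A Z.
     (\<forall>i\<in>I. cmp C A Z (X i) (coproj C I X Z \<iota> i) f = \<zero>\<^bsub>Hom C A (X i)\<^esub>) \<longrightarrow> f = \<zero>\<^bsub>Hom C A Z\<^esub>)"

text \<open>A weak form of smallness of the objects in \<open>G\<close>: the nonzero components of a
  map are countable in number, while no factorisation through a smaller coproduct is
  demanded.\<close>

definition countable_supports ::
  "('o, 'm, 'z) category_scheme \<Rightarrow> 'o set \<Rightarrow> 'i set \<Rightarrow> ('i \<Rightarrow> 'o) \<Rightarrow> 'o \<Rightarrow> ('i \<Rightarrow> 'm) \<Rightarrow> bool" where
  "countable_supports C G I X Z \<iota> \<longleftrightarrow> (\<forall>g\<in>G. \<forall>f\<in>mor C g Z.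
     countable {i\<in>I. cmp C g Z (X i) (coproj C I X Z \<iota> i) f \<noteq> \<zero>\<^bsub>Hom C g (X i)\<^esub>})"

context preadditive begin

lemma coproj_char:
  assumes Z: "is_coproduct C I X Z \<iota>" and X: "X ` I \<subseteq> objs C" and i: "i \<in> I"
  shows coproj_mor: "coproj C I X Z \<iota> i \<in> mor C Z (X i)"
    and coproj_inj: "j \<in> I \<Longrightarrow> cmp C (X j) Z (X i) (coproj C I X Z \<iota> i) (\<iota> j) =
       (if j = i then idm C (X i) else \<zero>\<^bsub>Hom C (X j) (X i)\<^esub>)"
    and coproj_unique: "\<lbrakk>h \<in> mor C Z (X i); \<And>j. j \<in> I \<Longrightarrow>
       cmp C (X j) Z (X i) h (\<iota> j) = (if j = i then idm C (X i) else \<zero>\<^bsub>Hom C (X j) (X i)\<^esub>)\<rbrakk> \<Longrightarrow>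
       coproj C I X Z \<iota> i = h"
proof -
  let ?g = "\<lambda>j. if j = i then idm C (X i) else \<zero>\<^bsub>Hom C (X j) (X i)\<^esub>"
  have "\<forall>j\<in>I. ?g j \<in> mor C (X j) (X i)" using X i by (auto simp: image_subset_iff)
  moreover have "X i \<in> objs C" using X i by auto
  ultimately have ex1: "\<exists>!h. h \<in> mor C Z (X i) \<and> (\<forall>j\<in>I. cmp C (X j) Z (X i) h (\<iota> j) = ?g j)"
    by (intro coproduct_ex1[OF Z]) auto
  from theI'[OF this]
  show "coproj C I X Z \<iota> i \<in> mor C Z (X i)"
    "j \<in> I \<Longrightarrow> cmp C (X j) Z (X i) (coproj C I X Z \<iota> i) (\<iota> j) =
       (if j = i then idm C (X i) else \<zero>\<^bsub>Hom C (X j) (X i)\<^esub>)"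
    unfolding coproj_def by auto
  show "coproj C I X Z \<iota> i = h" if "h \<in> mor C Z (X i)" "\<And>j. j \<in> I \<Longrightarrow>
       cmp C (X j) Z (X i) h (\<iota> j) = (if j = i then idm C (X i) else \<zero>\<^bsub>Hom C (X j) (X i)\<^esub>)"
    unfolding coproj_def by (rule the1_equality[OF ex1]) (use that in auto)
qed

text \<open>The right-hand side satisfies the equations that characterise the projection of
  \<open>Z'\<close>.\<close>

lemma coproj_transfer:
  assumes Z: "is_coproduct C I X Z \<iota>" and Z': "is_coproduct C I X Z' \<iota>'" and X: "X ` I \<subseteq> objs C"
    and h: "h \<in> mor C Z' Z" "\<And>i. i \<in> I \<Longrightarrow> cmp C (X i) Z' Z h (\<iota>' i) = \<iota> i" and i: "i \<in> I"
  shows "coproj C I X Z' \<iota>' i = cmp C Z' Z (X i) (coproj C I X Z \<iota> i) h"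
proof (rule coproj_unique[OF Z' X i])
  note z = is_coproductD[OF Z] is_coproductD[OF Z']
  have Xi: "X i \<in> objs C" if "i \<in> I" for i using X that by auto
  show "cmp C Z' Z (X i) (coproj C I X Z \<iota> i) h \<in> mor C Z' (X i)"
    using coproj_mor[OF Z X i] h z Xi[OF i] by simp
  fix j assume j: "j \<in> I"
  show "cmp C (X j) Z' (X i) (cmp C Z' Z (X i) (coproj C I X Z \<iota> i) h) (\<iota>' j) =
        (if j = i then idm C (X i) else \<zero>\<^bsub>Hom C (X j) (X i)\<^esub>)"
    using coproj_mor[OF Z X i] coproj_inj[OF Z X i j] h z Xi i j by (simp add: cmp_assoc)
qed

text \<open>The hypotheses on a category will provide one well-behaved coproduct of each family,
  while those met later are arbitrary. The comparison map \<open>h\<close> carries projections to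
  projections, and its left inverse \<open>k\<close> cancels it.\<close>

lemma jointly_monic_transfer:
  assumes Z: "is_coproduct C I X Z \<iota>" and Z': "is_coproduct C I X Z' \<iota>'" and X: "X ` I \<subseteq> objs C"
    and jm: "jointly_monic C I X Z \<iota>"
  shows "jointly_monic C I X Z' \<iota>'"
  unfolding jointly_monic_def
proof (intro ballI impI)
  note z = is_coproductD[OF Z] is_coproductD[OF Z']
  obtain h k where hk: "h \<in> mor C Z' Z" "k \<in> mor C Z Z'" "cmp C Z' Z Z' k h = idm C Z'"
    "\<And>i. i \<in> I \<Longrightarrow> cmp C (X i) Z' Z h (\<iota>' i) = \<iota> i"
    using coproduct_iso[OF Z' Z X] by metis
  fix A f assume A: "A \<in> objs C" and f: "f \<in> mor C A Z'"
    and *: "\<forall>i\<in>I. cmp C A Z' (X i) (coproj C I X Z' \<iota>' i) f = \<zero>\<^bsub>Hom C A (X i)\<^esub>"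
  have "cmp C A Z' Z h f = \<zero>\<^bsub>Hom C A Z\<^esub>"
  proof (rule jm[unfolded jointly_monic_def, rule_format, OF A])
    fix i assume i: "i \<in> I"
    then have "X i \<in> objs C" using X by auto
    then show "cmp C A Z (X i) (coproj C I X Z \<iota> i) (cmp C A Z' Z h f) = \<zero>\<^bsub>Hom C A (X i)\<^esub>"
      using *[rule_format, OF i] coproj_transfer[OF Z Z' X hk(1,4) i] coproj_mor[OF Z X i] A f hk z
      by (simp add: cmp_assoc)
  qed (use A f hk z in auto)
  then have "cmp C A Z Z' k (cmp C A Z' Z h f) = \<zero>\<^bsub>Hom C A Z'\<^esub>" using A hk z by simp
  then show "f = \<zero>\<^bsub>Hom C A Z'\<^esub>" using A f hk z by (simp flip: cmp_assoc)
qed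

lemma countable_supports_transfer:
  assumes Z: "is_coproduct C I X Z \<iota>" and Z': "is_coproduct C I X Z' \<iota>'" and X: "X ` I \<subseteq> objs C"
    and G: "G \<subseteq> objs C" and cs: "countable_supports C G I X Z \<iota>"
  shows "countable_supports C G I X Z' \<iota>'"
  unfolding countable_supports_def
proof (intro ballI)
  note z = is_coproductD[OF Z] is_coproductD[OF Z']
  obtain h where h: "h \<in> mor C Z' Z" "\<And>i. i \<in> I \<Longrightarrow> cmp C (X i) Z' Z h (\<iota>' i) = \<iota> i"
    using coproduct_iso[OF Z' Z X] by metis
  fix g f assume g: "g \<in> G" and f: "f \<in> mor C g Z'"
  have "countable {i\<in>I. cmp C g Z (X i) (coproj C I X Z \<iota> i) (cmp C g Z' Z h f) \<noteq> \<zero>\<^bsub>Hom C g (X i)\<^esub>}"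
    using cs g f h z G unfolding countable_supports_def by (meson cmp_closed subsetD)
  moreover have "cmp C g Z' (X i) (coproj C I X Z' \<iota>' i) f =
      cmp C g Z (X i) (coproj C I X Z \<iota> i) (cmp C g Z' Z h f)" if "i \<in> I" for i
  proof -
    have "X i \<in> objs C" "g \<in> objs C" using X G g that by auto
    then show ?thesis
      using coproj_transfer[OF Z Z' X h that] coproj_mor[OF Z X that] f h z by (simp add: cmp_assoc)
  qed
  ultimately show "countable {i \<in> I. cmp C g Z' (X i) (coproj C I X Z' \<iota>' i) f \<noteq> \<zero>\<^bsub>Hom C g (X i)\<^esub>}"
    by (simp cong: conj_cong)
qed

lemma coproduct_mor_eqI:
  assumes Z: "is_coproduct C I X Z \<iota>" and jm: "jointly_monic C I X Z \<iota>" and X: "X ` I \<subseteq> objs C"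
    and A: "A \<in> objs C" "f \<in> mor C A Z" "f' \<in> mor C A Z"
    and eq: "\<And>i. i \<in> I \<Longrightarrow> cmp C A Z (X i) (coproj C I X Z \<iota> i) f = cmp C A Z (X i) (coproj C I X Z \<iota> i) f'"
  shows "f = f'"
proof -
  note z = is_coproductD[OF Z]
  have "f \<ominus>\<^bsub>Hom C A Z\<^esub> f' = \<zero>\<^bsub>Hom C A Z\<^esub>"
  proof (rule jm[unfolded jointly_monic_def, rule_format, OF A(1)])
    fix i assume i: "i \<in> I"
    then have "X i \<in> objs C" using X by auto
    then show "cmp C A Z (X i) (coproj C I X Z \<iota> i) (f \<ominus>\<^bsub>Hom C A Z\<^esub> f') = \<zero>\<^bsub>Hom C A (X i)\<^esub>"
      using eq[OF i] coproj_mor[OF Z X i] A z by (simp add: cmp_minus minus_eq_zero_iff)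
  qed (use A z in auto)
  then show ?thesis using A z by (simp add: minus_eq_zero_iff)
qed

end

section \<open>Complexes and the homotopy category\<close>

lemma ab_group_simps [simp]:
  "carrier (ab_group A p z) = A" "zero (ab_group A p z) = z" "add (ab_group A p z) = p"
  by (simp_all add: ab_group_def)

lemma Ch_simps [simp]:
  "objs (Ch A) = complexes A"
  "carrier (Hom (Ch A) X Y) = chain_maps A X Y"
  "zero (Hom (Ch A) X Y) = (\<lambda>n. \<zero>\<^bsub>Hom A (fst X n) (fst Y n)\<^esub>)"
  "add (Hom (Ch A) X Y) = (\<lambda>f g n. f n \<oplus>\<^bsub>Hom A (fst X n) (fst Y n)\<^esub> g n)"
  "cmp (Ch A) X Y Z g f = (\<lambda>n. cmp A (fst X n) (fst Y n) (fst Z n) (g n) (f n))"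
  "idm (Ch A) X = (\<lambda>n. idm A (fst X n))"
  by (simp_all add: Ch_def)

lemma complexes_iff:
  "X \<in> complexes A \<longleftrightarrow> (\<forall>n. fst X n \<in> objs A \<and> snd X n \<in> mor A (fst X n) (fst X (n - 1)) \<and>
     cmp A (fst X n) (fst X (n - 1)) (fst X (n - 2)) (snd X (n - 1)) (snd X n) = \<zero>\<^bsub>Hom A (fst X n) (fst X (n
         - 2))\<^esub>)"
  by (cases X) (simp add: complexes_def)

lemma complexesD [simp]:
  assumes "X \<in> complexes A"
  shows "fst X n \<in> objs A" "snd X n \<in> mor A (fst X n) (fst X (n - 1))"
    "cmp A (fst X n) (fst X (n - 1)) (fst X (n - 2)) (snd X (n - 1)) (snd X n) = \<zero>\<^bsub>Hom A (fst X n) (fst X (n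
        - 2))\<^esub>"
  using assms by (simp_all add: complexes_iff)

lemma complexes_diff_Suc [simp]: "X \<in> complexes A \<Longrightarrow> snd X (n + 1) \<in> mor A (fst X (n + 1)) (fst X n)"
  using complexesD(2)[of X A "n + 1"] by simp

lemma chain_maps_iff:
  "f \<in> chain_maps A X Y \<longleftrightarrow> (\<forall>n. f n \<in> mor A (fst X n) (fst Y n) \<and>
     cmp A (fst X n) (fst Y n) (fst Y (n - 1)) (snd Y n) (f n) =
     cmp A (fst X n) (fst X (n - 1)) (fst Y (n - 1)) (f (n - 1)) (snd X n))"
  by (cases X; cases Y) (simp add: chain_maps_def)

lemma chain_maps_mor [simp]: "f \<in> chain_maps A X Y \<Longrightarrow> f n \<in> mor A (fst X n) (fst Y n)"
  by (simp add: chain_maps_iff)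

lemma chain_maps_comm:
  "f \<in> chain_maps A X Y \<Longrightarrow> cmp A (fst X n) (fst Y n) (fst Y (n - 1)) (snd Y n) (f n) =
     cmp A (fst X n) (fst X (n - 1)) (fst Y (n - 1)) (f (n - 1)) (snd X n)"
  by (simp add: chain_maps_iff)

lemma null_homotopic_iff:
  "f \<in> null_homotopic A X Y \<longleftrightarrow> f \<in> chain_maps A X Y \<and>
     (\<exists>s. \<forall>n. s n \<in> mor A (fst X n) (fst Y (n + 1)) \<and>
       f n = cmp A (fst X n) (fst Y (n + 1)) (fst Y n) (snd Y (n + 1)) (s n)
               \<oplus>\<^bsub>Hom A (fst X n) (fst Y n)\<^esub> cmp A (fst X n) (fst X (n - 1)) (fst Y n) (s (n - 1)) (snd X
                   n))"
  by (cases X; cases Y) (simp add: null_homotopic_def)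

text \<open>The scheme is restricted to plain categories because \<open>Ch\<close> and
  \<open>K\<close> accept only those.\<close>

locale preadditive_cat = preadditive A for A :: "('o, 'm) category"
begin

lemma chain_maps_comm_extend:
  assumes "f \<in> chain_maps A X Y" "X \<in> complexes A" "Y \<in> complexes A" "k \<in> mor A W (fst X n)" "W \<in> objs A"
  shows "cmp A W (fst Y n) (fst Y (n - 1)) (snd Y n) (cmp A W (fst X n) (fst Y n) (f n) k) =
     cmp A W (fst X (n - 1)) (fst Y (n - 1)) (f (n - 1)) (cmp A W (fst X n) (fst X (n - 1)) (snd X n) k)"
  using assms by (intro cmp_eq_extend[OF chain_maps_comm]) auto

lemma chain_maps_comm_extend_Suc:
  assumes "f \<in> chain_maps A X Y" "X \<in> complexes A" "Y \<in> complexes A" "k \<in> mor A W (fst X (n + 1))" "W \<in> objs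
      A"
  shows "cmp A W (fst Y (n + 1)) (fst Y n) (snd Y (n + 1)) (cmp A W (fst X (n + 1)) (fst Y (n + 1)) (f (n +
      1)) k) =
     cmp A W (fst X n) (fst Y n) (f n) (cmp A W (fst X (n + 1)) (fst X n) (snd X (n + 1)) k)"
  using chain_maps_comm_extend[OF assms] by simp

lemma chain_maps_cmp [simp]:
  assumes "f \<in> chain_maps A X Y" "g \<in> chain_maps A Y Z" "X \<in> complexes A" "Y \<in> complexes A" "Z \<in> complexes
      A"
  shows "(\<lambda>n. cmp A (fst X n) (fst Y n) (fst Z n) (g n) (f n)) \<in> chain_maps A X Z"
  unfolding chain_maps_iff
proof (intro allI conjI)
  fix n
  show "cmp A (fst X n) (fst Z n) (fst Z (n - 1)) (snd Z n) (cmp A (fst X n) (fst Y n) (fst Z n) (g n) (f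
      n)) =
        cmp A (fst X n) (fst X (n - 1)) (fst Z (n - 1)) (cmp A (fst X (n - 1)) (fst Y (n - 1)) (fst Z (n -
            1)) (g (n - 1)) (f (n - 1))) (snd X n)"
    using assms by (simp add: cmp_assoc chain_maps_comm[OF assms(1)] chain_maps_comm_extend[OF assms(2)])
qed (use assms in simp)

lemma Ch_group:
  assumes X: "X \<in> complexes A" and Y: "Y \<in> complexes A"
  shows "abelian_group (Hom (Ch A) X Y)"
proof -
  interpret H: abelian_group "Hom A (fst X n) (fst Y n)" for n
    using assms by (simp add: Hom_group)
  show ?thesis
  proof (rule abelian_groupI, simp_all)
    fix f assume f: "f \<in> chain_maps A X Y"
    show "\<exists>g\<in>chain_maps A X Y. (\<lambda>n. g n \<oplus>\<^bsub>Hom A (fst X n) (fst Y n)\<^esub> f n) = (\<lambda>n. \<zero>\<^bsub>Hom A (fst X n) (fst Y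
        n)\<^esub>)"
    proof (rule bexI)
      show "(\<lambda>n. (\<ominus>\<^bsub>Hom A (fst X n) (fst Y n)\<^esub> f n)) \<in> chain_maps A X Y"
        using assms f chain_maps_comm[OF f] by (simp add: chain_maps_iff)
    qed (use f in \<open>simp add: H.l_neg\<close>)
    fix g assume g: "g \<in> chain_maps A X Y"
    show "(\<lambda>n. f n \<oplus>\<^bsub>Hom A (fst X n) (fst Y n)\<^esub> g n) \<in> chain_maps A X Y"
      using assms f g chain_maps_comm[OF f] chain_maps_comm[OF g]
      by (simp add: chain_maps_iff cmp_add_left cmp_add_right)
    show "(\<lambda>n. f n \<oplus>\<^bsub>Hom A (fst X n) (fst Y n)\<^esub> g n) = (\<lambda>n. g n \<oplus>\<^bsub>Hom A (fst X n) (fst Y n)\<^esub> f n)"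
      using f g by (simp add: H.a_comm)
    fix h assume h: "h \<in> chain_maps A X Y"
    show "(\<lambda>n. f n \<oplus>\<^bsub>Hom A (fst X n) (fst Y n)\<^esub> g n \<oplus>\<^bsub>Hom A (fst X n) (fst Y n)\<^esub> h n) =
      (\<lambda>n. f n \<oplus>\<^bsub>Hom A (fst X n) (fst Y n)\<^esub> (g n \<oplus>\<^bsub>Hom A (fst X n) (fst Y n)\<^esub> h n))"
      using f g h by (simp add: H.a_assoc)
  next
    show "(\<lambda>n. \<zero>\<^bsub>Hom A (fst X n) (fst Y n)\<^esub>) \<in> chain_maps A X Y"
      using assms by (simp add: chain_maps_iff)
  qed
qed

lemma Ch_preadditive: "preadditive (Ch A)"
proof (intro preadditive.intro categ.intro preadditive_axioms.intro)
  fix X Y Z W f g g' h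
  assume "f \<in> mor (Ch A) W X" "g \<in> mor (Ch A) X Y" "h \<in> mor (Ch A) Y Z"
    "W \<in> objs (Ch A)" "X \<in> objs (Ch A)" "Y \<in> objs (Ch A)" "Z \<in> objs (Ch A)"
  then show "cmp (Ch A) W X Z (cmp (Ch A) X Y Z h g) f = cmp (Ch A) W Y Z h (cmp (Ch A) W X Y g f)"
    by (simp add: cmp_assoc)
next
  show "idm (Ch A) X \<in> mor (Ch A) X X" if "X \<in> objs (Ch A)" for X
    using that by (simp add: chain_maps_iff)
qed (use Ch_group in \<open>simp_all add: cmp_add_left cmp_add_right\<close>)

sublocale Ch: preadditive "Ch A" by (rule Ch_preadditive)

lemma Ch_uminus:
  assumes "f \<in> chain_maps A X Y" "X \<in> complexes A" "Y \<in> complexes A"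
  shows "\<ominus>\<^bsub>Hom (Ch A) X Y\<^esub> f = (\<lambda>n. (\<ominus>\<^bsub>Hom A (fst X n) (fst Y n)\<^esub> f n))"
proof -
  interpret G: abelian_group "Hom (Ch A) X Y" using Ch_group assms by auto
  interpret H: abelian_group "Hom A (fst X n) (fst Y n)" for n
    using assms by (simp add: Hom_group)
  have "(\<lambda>n. (\<ominus>\<^bsub>Hom A (fst X n) (fst Y n)\<^esub> f n)) \<in> chain_maps A X Y"
    using assms chain_maps_comm[OF assms(1)] by (simp add: chain_maps_iff)
  then show ?thesis
    using assms G.minus_equality[of "\<lambda>n. (\<ominus>\<^bsub>Hom A (fst X n) (fst Y n)\<^esub> f n)" f] by (simp add: H.l_neg)
qed

lemma Ch_minus:
  assumes "f \<in> chain_maps A X Y" "g \<in> chain_maps A X Y" "X \<in> complexes A" "Y \<in> complexes A"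
  shows "f \<ominus>\<^bsub>Hom (Ch A) X Y\<^esub> g = (\<lambda>n. (f n \<ominus>\<^bsub>Hom A (fst X n) (fst Y n)\<^esub> g n))"
  using assms by (simp add: a_minus_def Ch_uminus)

section \<open>Null-homotopic maps form an ideal\<close>

text \<open>If \<open>s\<close> contracts \<open>f\<close>, then \<open>g s\<close> contracts
  \<open>g f\<close>: the chain map law moves \<open>g\<close> past the differential of
  \<open>Y\<close>.\<close>

lemma null_cmp:
  assumes "f \<in> null_homotopic A X Y" "g \<in> chain_maps A Y Z" "X \<in> complexes A" "Y \<in> complexes A" "Z \<in>
      complexes A"
  shows "cmp (Ch A) X Y Z g f \<in> null_homotopic A X Z"
proof -
  obtain s where f: "f \<in> chain_maps A X Y" and s: "\<And>n. s n \<in> mor A (fst X n) (fst Y (n + 1))"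
    and fs: "\<And>n. f n = cmp A (fst X n) (fst Y (n + 1)) (fst Y n) (snd Y (n + 1)) (s n)
               \<oplus>\<^bsub>Hom A (fst X n) (fst Y n)\<^esub> cmp A (fst X n) (fst X (n - 1)) (fst Y n) (s (n - 1)) (snd X n)"
    using assms(1) unfolding null_homotopic_iff by blast
  have s': "s (n - 1) \<in> mor A (fst X (n - 1)) (fst Y n)" for n using s[of "n - 1"] by simp
  show ?thesis
    unfolding null_homotopic_iff
  proof (intro conjI exI allI)
    fix n
    show "cmp A (fst X n) (fst Y (n + 1)) (fst Z (n + 1)) (g (n + 1)) (s n) \<in> mor A (fst X n) (fst Z (n +
        1))"
      using assms s by simp
    show "cmp (Ch A) X Y Z g f n =
      cmp A (fst X n) (fst Z (n + 1)) (fst Z n) (snd Z (n + 1)) (cmp A (fst X n) (fst Y (n + 1)) (fst Z (n +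
          1)) (g (n + 1)) (s n))
      \<oplus>\<^bsub>Hom A (fst X n) (fst Z n)\<^esub>
      cmp A (fst X n) (fst X (n - 1)) (fst Z n) (cmp A (fst X (n - 1)) (fst Y (n - 1 + 1)) (fst Z (n - 1 +
          1)) (g (n - 1 + 1)) (s (n - 1))) (snd X n)"
      using assms s s' by (simp add: fs[of n] cmp_add_right cmp_assoc chain_maps_comm_extend_Suc[OF
          assms(2)])
  qed (use assms f in simp)
qed

text \<open>Here the contracting homotopy is \<open>s f\<close>, and the chain map law for
  \<open>f\<close> exchanges the differentials of \<open>X\<close> and \<open>Y\<close>.\<close>

lemma cmp_null:
  assumes "f \<in> chain_maps A X Y" "g \<in> null_homotopic A Y Z" "X \<in> complexes A" "Y \<in> complexes A" "Z \<in>
      complexes A"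
  shows "cmp (Ch A) X Y Z g f \<in> null_homotopic A X Z"
proof -
  obtain s where g: "g \<in> chain_maps A Y Z" and s: "\<And>n. s n \<in> mor A (fst Y n) (fst Z (n + 1))"
    and gs: "\<And>n. g n = cmp A (fst Y n) (fst Z (n + 1)) (fst Z n) (snd Z (n + 1)) (s n)
               \<oplus>\<^bsub>Hom A (fst Y n) (fst Z n)\<^esub> cmp A (fst Y n) (fst Y (n - 1)) (fst Z n) (s (n - 1)) (snd Y n)"
    using assms(2) unfolding null_homotopic_iff by blast
  have s': "s (n - 1) \<in> mor A (fst Y (n - 1)) (fst Z n)" for n using s[of "n - 1"] by simp
  show ?thesis
    unfolding null_homotopic_iff
  proof (intro conjI exI allI)
    fix n
    show "cmp A (fst X n) (fst Y n) (fst Z (n + 1)) (s n) (f n) \<in> mor A (fst X n) (fst Z (n + 1))"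
      using assms s by simp
    show "cmp (Ch A) X Y Z g f n =
      cmp A (fst X n) (fst Z (n + 1)) (fst Z n) (snd Z (n + 1)) (cmp A (fst X n) (fst Y n) (fst Z (n + 1))
          (s n) (f n))
      \<oplus>\<^bsub>Hom A (fst X n) (fst Z n)\<^esub>
      cmp A (fst X n) (fst X (n - 1)) (fst Z n) (cmp A (fst X (n - 1)) (fst Y (n - 1)) (fst Z (n - 1 + 1))
          (s (n - 1)) (f (n - 1))) (snd X n)"
      using assms s s' chain_maps_comm[OF assms(1), of n]
      by (simp add: gs[of n] cmp_add_left cmp_assoc)
  qed (use assms g in simp)
qed

text \<open>Homotopies add and change sign along with the maps they contract.\<close>

lemma null_homotopic_subgroup:
  assumes X: "X \<in> complexes A" and Y: "Y \<in> complexes A"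
  shows "abelian_subgroup (null_homotopic A X Y) (Hom (Ch A) X Y)"
proof -
  interpret G: abelian_group "Hom (Ch A) X Y" using Ch_group assms by auto
  interpret H: abelian_group "Hom A (fst X n) (fst Y n)" for n
    using assms by (simp add: Hom_group)
  show ?thesis
  proof (rule abelian_subgroupI3[OF additive_subgroup.intro G.abelian_group_axioms], rule G.add.subgroupI)
    show "null_homotopic A X Y \<subseteq> carrier (Hom (Ch A) X Y)" by (auto simp: null_homotopic_iff)
    have "(\<lambda>n. \<zero>\<^bsub>Hom A (fst X n) (fst Y n)\<^esub>) \<in> null_homotopic A X Y"
      unfolding null_homotopic_iff
      by (intro conjI exI[of _ "\<lambda>n. \<zero>\<^bsub>Hom A (fst X n) (fst Y (n + 1))\<^esub>"])
        (use assms in \<open>simp_all add: chain_maps_iff\<close>)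
    then show "null_homotopic A X Y \<noteq> {}" by blast
    fix f assume f: "f \<in> null_homotopic A X Y"
    then obtain s where fc: "f \<in> chain_maps A X Y" and s: "\<And>n. s n \<in> mor A (fst X n) (fst Y (n + 1))"
      and fs: "\<And>n. f n = cmp A (fst X n) (fst Y (n + 1)) (fst Y n) (snd Y (n + 1)) (s n)
               \<oplus>\<^bsub>Hom A (fst X n) (fst Y n)\<^esub> cmp A (fst X n) (fst X (n - 1)) (fst Y n) (s (n - 1)) (snd X n)"
      unfolding null_homotopic_iff by blast
    have s': "s (n - 1) \<in> mor A (fst X (n - 1)) (fst Y n)" for n using s[of "n - 1"] by simp
    show "\<ominus>\<^bsub>Hom (Ch A) X Y\<^esub> f \<in> null_homotopic A X Y"
      unfolding null_homotopic_iff
    proof (intro conjI exI allI)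
      show "\<ominus>\<^bsub>Hom (Ch A) X Y\<^esub> f \<in> chain_maps A X Y" using fc G.a_inv_closed by simp
      fix n
      show "\<ominus>\<^bsub>Hom A (fst X n) (fst Y (n + 1))\<^esub> s n \<in> mor A (fst X n) (fst Y (n + 1))"
        using assms s by simp
      show "(\<ominus>\<^bsub>Hom (Ch A) X Y\<^esub> f) n =
        cmp A (fst X n) (fst Y (n + 1)) (fst Y n) (snd Y (n + 1)) (\<ominus>\<^bsub>Hom A (fst X n) (fst Y (n + 1))\<^esub> s n)
        \<oplus>\<^bsub>Hom A (fst X n) (fst Y n)\<^esub>
        cmp A (fst X n) (fst X (n - 1)) (fst Y n) (\<ominus>\<^bsub>Hom A (fst X (n - 1)) (fst Y (n - 1 + 1))\<^esub> s (n - 1))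
            (snd X n)"
        using assms s s' fc by (simp add: Ch_uminus fs[of n] H.minus_add)
    qed
    fix g assume g: "g \<in> null_homotopic A X Y"
    then obtain t where gc: "g \<in> chain_maps A X Y" and t: "\<And>n. t n \<in> mor A (fst X n) (fst Y (n + 1))"
      and gs: "\<And>n. g n = cmp A (fst X n) (fst Y (n + 1)) (fst Y n) (snd Y (n + 1)) (t n)
               \<oplus>\<^bsub>Hom A (fst X n) (fst Y n)\<^esub> cmp A (fst X n) (fst X (n - 1)) (fst Y n) (t (n - 1)) (snd X n)"
      unfolding null_homotopic_iff by blast
    have t': "t (n - 1) \<in> mor A (fst X (n - 1)) (fst Y n)" for n using t[of "n - 1"] by simp
    show "f \<oplus>\<^bsub>Hom (Ch A) X Y\<^esub> g \<in> null_homotopic A X Y"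
      unfolding null_homotopic_iff
    proof (intro conjI exI allI)
      show "f \<oplus>\<^bsub>Hom (Ch A) X Y\<^esub> g \<in> chain_maps A X Y" using G.a_closed[of f g] fc gc by simp
      fix n
      show "s n \<oplus>\<^bsub>Hom A (fst X n) (fst Y (n + 1))\<^esub> t n \<in> mor A (fst X n) (fst Y (n + 1))"
        using assms s t by simp
      show "(f \<oplus>\<^bsub>Hom (Ch A) X Y\<^esub> g) n =
        cmp A (fst X n) (fst Y (n + 1)) (fst Y n) (snd Y (n + 1)) (s n \<oplus>\<^bsub>Hom A (fst X n) (fst Y (n + 1))\<^esub> t
            n)
        \<oplus>\<^bsub>Hom A (fst X n) (fst Y n)\<^esub>
        cmp A (fst X n) (fst X (n - 1)) (fst Y n) (s (n - 1) \<oplus>\<^bsub>Hom A (fst X (n - 1)) (fst Y (n - 1 + 1))\<^esub> t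
            (n - 1)) (snd X n)"
        using assms s s' t t' by (simp add: fs[of n] gs[of n] cmp_add_left cmp_add_right H.a_ac)
    qed
  qed
qed

section \<open>Homotopy classes and their composition\<close>

abbreviation hclass :: "('o, 'm) complex \<Rightarrow> ('o, 'm) complex \<Rightarrow> (int \<Rightarrow> 'm) \<Rightarrow> (int \<Rightarrow> 'm) set" where
  "hclass \<equiv> homotopy_class A"

lemma mor_K: "mor (K A) X Y = hclass X Y ` chain_maps A X Y"
  by (auto simp: K_def A_RCOSETS_def' homotopy_class_def)

lemma objs_K [simp]: "objs (K A) = complexes A"
  by (simp add: K_def)

lemma hclass_mor [simp]: "f \<in> chain_maps A X Y \<Longrightarrow> hclass X Y f \<in> mor (K A) X Y"
  by (simp add: mor_K)

lemma hclass_eq_iff_null: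
  assumes "f \<in> chain_maps A X Y" "g \<in> chain_maps A X Y" "X \<in> complexes A" "Y \<in> complexes A"
  shows "hclass X Y f = hclass X Y g \<longleftrightarrow> f \<ominus>\<^bsub>Hom (Ch A) X Y\<^esub> g \<in> null_homotopic A X Y"
proof -
  interpret N: abelian_subgroup "null_homotopic A X Y" "Hom (Ch A) X Y"
    using null_homotopic_subgroup assms by auto
  show ?thesis
  proof
    assume "hclass X Y f = hclass X Y g"
    then have "f \<in> null_homotopic A X Y +>\<^bsub>Hom (Ch A) X Y\<^esub> g"
      using N.a_rcos_self[of f] assms by (simp add: homotopy_class_def)
    then show "f \<ominus>\<^bsub>Hom (Ch A) X Y\<^esub> g \<in> null_homotopic A X Y"
      using N.a_rcos_module[of g f] assms by (simp add: a_minus_def)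
  next
    assume "f \<ominus>\<^bsub>Hom (Ch A) X Y\<^esub> g \<in> null_homotopic A X Y"
    then have "f \<in> null_homotopic A X Y +>\<^bsub>Hom (Ch A) X Y\<^esub> g"
      using N.a_rcos_module[of g f] assms by (simp add: a_minus_def)
    then show "hclass X Y f = hclass X Y g"
      using N.a_repr_independence'[of f g] assms by (simp add: homotopy_class_def)
  qed
qed

lemma hclass_eq_iff:
  assumes "f \<in> chain_maps A X Y" "g \<in> chain_maps A X Y" "X \<in> complexes A" "Y \<in> complexes A"
  shows "hclass X Y f = hclass X Y g \<longleftrightarrow>
     (\<exists>s. \<forall>n. s n \<in> mor A (fst X n) (fst Y (n + 1)) \<and>
       f n \<ominus>\<^bsub>Hom A (fst X n) (fst Y n)\<^esub> g n = cmp A (fst X n) (fst Y (n + 1)) (fst Y n) (snd Y (n + 1)) (s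
           n)
               \<oplus>\<^bsub>Hom A (fst X n) (fst Y n)\<^esub> cmp A (fst X n) (fst X (n - 1)) (fst Y n) (s (n - 1)) (snd X
                   n))"
  unfolding hclass_eq_iff_null[OF assms] null_homotopic_iff
  using Ch.minus_mor[of f X Y g] assms by (simp add: Ch_minus)

text \<open>\<open>K\<close> takes the subgroup of null-homotopic maps itself as zero, and this is
  the coset of the zero map.\<close>

lemma hclass_zero:
  assumes "X \<in> complexes A" "Y \<in> complexes A"
  shows "\<zero>\<^bsub>Hom (K A) X Y\<^esub> = hclass X Y \<zero>\<^bsub>Hom (Ch A) X Y\<^esub>"
proof -
  interpret N: abelian_subgroup "null_homotopic A X Y" "Hom (Ch A) X Y"
    using null_homotopic_subgroup assms by auto
  show ?thesis using N.a_coset_add_zero[OF N.a_subset] by (simp add: K_def homotopy_class_def del: Ch_simps)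
qed

lemma hclass_eq_zero_iff:
  assumes "f \<in> chain_maps A X Y" "X \<in> complexes A" "Y \<in> complexes A"
  shows "hclass X Y f = hclass X Y \<zero>\<^bsub>Hom (Ch A) X Y\<^esub> \<longleftrightarrow> f \<in> null_homotopic A X Y"
proof -
  interpret G: abelian_group "Hom (Ch A) X Y" using Ch_group assms by auto
  have "\<ominus>\<^bsub>Hom (Ch A) X Y\<^esub> \<zero>\<^bsub>Hom (Ch A) X Y\<^esub> = \<zero>\<^bsub>Hom (Ch A) X Y\<^esub>"
    by (rule G.minus_equality[OF G.l_zero]) (rule G.zero_closed)+
  then have "f \<ominus>\<^bsub>Hom (Ch A) X Y\<^esub> \<zero>\<^bsub>Hom (Ch A) X Y\<^esub> = f"
    using assms(1) G.r_zero[of f] unfolding a_minus_def by (simp del: Ch_simps(3,4))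
  then show ?thesis
    using hclass_eq_iff_null[of f X Y "\<zero>\<^bsub>Hom (Ch A) X Y\<^esub>"] assms G.zero_closed by (simp del: Ch_simps(3,4))
qed

lemma hclass_members:
  assumes "f \<in> chain_maps A X Y" "X \<in> complexes A" "Y \<in> complexes A"
  shows "f \<in> hclass X Y f" and "g \<in> hclass X Y f \<Longrightarrow> g \<in> chain_maps A X Y"
    and "g \<in> hclass X Y f \<Longrightarrow> hclass X Y g = hclass X Y f"
proof -
  interpret N: abelian_subgroup "null_homotopic A X Y" "Hom (Ch A) X Y"
    using null_homotopic_subgroup assms by auto
  show "f \<in> hclass X Y f" using N.a_rcos_self[of f] assms by (simp add: homotopy_class_def)
  show "g \<in> chain_maps A X Y" if "g \<in> hclass X Y f"
    using that N.a_elemrcos_carrier[of f g] assms by (simp add: homotopy_class_def)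
  show "hclass X Y g = hclass X Y f" if "g \<in> hclass X Y f"
    using that N.a_repr_independence'[of g f] assms by (simp add: homotopy_class_def)
qed

text \<open>Composition in \<open>K\<close> is a union over all pairs of representatives. All pairs
  give the same class: replacing \<open>g'\<close> by \<open>g\<close> changes the composite by a
  map that is null-homotopic by \<open>cmp_null\<close>, replacing \<open>f'\<close> by
  \<open>f\<close> by one that is null-homotopic by \<open>null_cmp\<close>. As classes are
  nonempty, the union is this class.\<close>

lemma cmp_K [simp]:
  assumes f: "f \<in> chain_maps A X Y" and g: "g \<in> chain_maps A Y Z"
    and o: "X \<in> complexes A" "Y \<in> complexes A" "Z \<in> complexes A"
  shows "cmp (K A) X Y Z (hclass Y Z g) (hclass X Y f) = hclass X Z (cmp (Ch A) X Y Z g f)"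
proof -
  have eq: "hclass X Z (cmp (Ch A) X Y Z g' f') = hclass X Z (cmp (Ch A) X Y Z g f)"
    if "g' \<in> hclass Y Z g" "f' \<in> hclass X Y f" for g' f'
  proof -
    have g': "g' \<in> chain_maps A Y Z" "hclass Y Z g' = hclass Y Z g"
      and f': "f' \<in> chain_maps A X Y" "hclass X Y f' = hclass X Y f"
      using hclass_members(2,3)[OF g o(2,3) that(1)] hclass_members(2,3)[OF f o(1,2) that(2)] by simp_all
    have "hclass X Z (cmp (Ch A) X Y Z g' f') = hclass X Z (cmp (Ch A) X Y Z g f')"
    proof (subst hclass_eq_iff_null)
      have "cmp (Ch A) X Y Z (g' \<ominus>\<^bsub>Hom (Ch A) Y Z\<^esub> g) f' \<in> null_homotopic A X Z"
        using g' g f' o hclass_eq_iff_null[of g' Y Z g] by (intro cmp_null) auto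
      then show "cmp (Ch A) X Y Z g' f' \<ominus>\<^bsub>Hom (Ch A) X Z\<^esub> cmp (Ch A) X Y Z g f' \<in> null_homotopic A X Z"
        using g' g f' o by (simp add: Ch.minus_cmp del: Ch_simps(5))
    qed (use g' f' g o in auto)
    also have "\<dots> = hclass X Z (cmp (Ch A) X Y Z g f)"
    proof (subst hclass_eq_iff_null)
      have "cmp (Ch A) X Y Z g (f' \<ominus>\<^bsub>Hom (Ch A) X Y\<^esub> f) \<in> null_homotopic A X Z"
        using f' f g o hclass_eq_iff_null[of f' X Y f] by (intro null_cmp) auto
      then show "cmp (Ch A) X Y Z g f' \<ominus>\<^bsub>Hom (Ch A) X Z\<^esub> cmp (Ch A) X Y Z g f \<in> null_homotopic A X Z"
        using f' f g o by (simp add: Ch.cmp_minus del: Ch_simps(5))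
    qed (use f f' g o in auto)
    finally show ?thesis .
  qed
  have "cmp (K A) X Y Z (hclass Y Z g) (hclass X Y f) =
      (\<Union>g'\<in>hclass Y Z g. \<Union>f'\<in>hclass X Y f. hclass X Z (cmp (Ch A) X Y Z g' f'))"
    by (simp add: K_def)
  also have "\<dots> = (\<Union>g'\<in>hclass Y Z g. \<Union>f'\<in>hclass X Y f. hclass X Z (cmp (Ch A) X Y Z g f))"
    using eq by (simp del: Ch_simps(5))
  also have "\<dots> = hclass X Z (cmp (Ch A) X Y Z g f)"
    using hclass_members(1)[OF f] hclass_members(1)[OF g] o by auto
  finally show ?thesis .
qed

lemma idm_K: "idm (K A) X = hclass X X (idm (Ch A) X)"
  by (simp add: K_def)

lemma K_categ: "categ (K A)"
proof
  fix X Y f assume f: "f \<in> mor (K A) X Y" and o: "X \<in> objs (K A)" "Y \<in> objs (K A)"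
  then obtain f0 where f0: "f = hclass X Y f0" "f0 \<in> chain_maps A X Y" by (auto simp: mor_K)
  show "cmp (K A) X Y Y (idm (K A) Y) f = f" "cmp (K A) X X Y f (idm (K A) X) = f"
    using f0 o Ch.idm_closed[of Y] Ch.idm_closed[of X] Ch.cmp_idm_left[of f0 X Y] Ch.cmp_idm_right[of f0 X
        Y]
    by (auto simp add: idm_K simp del: Ch_simps(5,6))
  fix Z g assume g: "g \<in> mor (K A) Y Z" and Z: "Z \<in> objs (K A)"
  then obtain g0 where g0: "g = hclass Y Z g0" "g0 \<in> chain_maps A Y Z" by (auto simp: mor_K)
  show "cmp (K A) X Y Z g f \<in> mor (K A) X Z"
    using f0 g0 o Z by simp
  fix W h assume h: "h \<in> mor (K A) Z W" and W: "W \<in> objs (K A)"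
  then obtain h0 where h0: "h = hclass Z W h0" "h0 \<in> chain_maps A Z W" by (auto simp: mor_K)
  show "cmp (K A) X Y W (cmp (K A) Y Z W h g) f = cmp (K A) X Z W h (cmp (K A) X Y Z g f)"
    using f0 g0 h0 o Z W by (simp add: cmp_assoc)
next
  fix X assume "X \<in> objs (K A)"
  then show "idm (K A) X \<in> mor (K A) X X" using Ch.idm_closed[of X] by (simp add: idm_K del: Ch_simps(6))
qed

sublocale K: categ "K A" by (rule K_categ)

section \<open>Coproducts of complexes, formed degreewise\<close>

text \<open>The differentials of the summands induce \<open>d\<close>; that it squares to zero is
  tested on the injections.\<close>

lemma degreewise_coproduct_complex:
  assumes X: "X ` I \<subseteq> complexes A"
    and Z: "\<And>n. is_coproduct A I (\<lambda>i. fst (X i) n) (Z n) (\<lambda>i. \<iota> i n)"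
  obtains d where "(Z, d) \<in> complexes A" "\<And>i. i \<in> I \<Longrightarrow> \<iota> i \<in> chain_maps A (X i) (Z, d)"
proof -
  note z = is_coproductD[OF Z]
  have Xi: "X i \<in> complexes A" if "i \<in> I" for i using X that by auto
  then have Xn: "(\<lambda>i. fst (X i) n) ` I \<subseteq> objs A" for n by auto
  have "\<exists>d. d \<in> mor A (Z n) (Z (n - 1)) \<and> (\<forall>i\<in>I. cmp A (fst (X i) n) (Z n) (Z (n - 1)) d (\<iota> i n) =
      cmp A (fst (X i) n) (fst (X i) (n - 1)) (Z (n - 1)) (\<iota> i (n - 1)) (snd (X i) n))" for n
    using coproduct_ex1[OF Z[of n], of "Z (n - 1)" "\<lambda>i. cmp A (fst (X i) n) (fst (X i) (n - 1)) (Z (n - 1))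
        (\<iota> i (n - 1)) (snd (X i) n)"]
      z Xi by (auto elim!: ex1E)
  then obtain d where d: "\<And>n. d n \<in> mor A (Z n) (Z (n - 1))"
    and di: "\<And>n i. i \<in> I \<Longrightarrow> cmp A (fst (X i) n) (Z n) (Z (n - 1)) (d n) (\<iota> i n) =
      cmp A (fst (X i) n) (fst (X i) (n - 1)) (Z (n - 1)) (\<iota> i (n - 1)) (snd (X i) n)" by metis
  have d': "d (n - 1) \<in> mor A (Z (n - 1)) (Z (n - 2))" for n using d[of "n - 1"] by simp
  have "(Z, d) \<in> complexes A"
    unfolding complexes_iff fst_conv snd_conv
  proof (intro allI conjI)
    fix n
    show "cmp A (Z n) (Z (n - 1)) (Z (n - 2)) (d (n - 1)) (d n) = \<zero>\<^bsub>Hom A (Z n) (Z (n - 2))\<^esub>"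
    proof (rule coproduct_ext[OF Z _ Xn])
      fix i assume i: "i \<in> I"
      have s: "snd (X i) (n - 1) \<in> mor A (fst (X i) (n - 1)) (fst (X i) (n - 2))"
        using complexesD(2)[OF Xi[OF i], of "n - 1"] by simp
      have "cmp A (fst (X i) n) (Z n) (Z (n - 2)) (cmp A (Z n) (Z (n - 1)) (Z (n - 2)) (d (n - 1)) (d n)) (\<iota>
          i n) =
        cmp A (fst (X i) n) (fst (X i) (n - 1)) (Z (n - 2)) (cmp A (fst (X i) (n - 1)) (Z (n - 1)) (Z (n -
            2)) (d (n - 1)) (\<iota> i (n - 1))) (snd (X i) n)"
        using i z Xi d d' by (simp add: cmp_assoc di)
      also have "\<dots> = \<zero>\<^bsub>Hom A (fst (X i) n) (Z (n - 2))\<^esub>"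
        using di[OF i, of "n - 1"] i z Xi d d' s by (simp add: cmp_assoc)
      finally show "cmp A (fst (X i) n) (Z n) (Z (n - 2)) (cmp A (Z n) (Z (n - 1)) (Z (n - 2)) (d (n - 1))
          (d n)) (\<iota> i n) =
        cmp A (fst (X i) n) (Z n) (Z (n - 2)) \<zero>\<^bsub>Hom A (Z n) (Z (n - 2))\<^esub> (\<iota> i n)"
        using i z Xi by simp
    qed (use z d d' in auto)
  qed (use z d in auto)
  moreover have "\<iota> i \<in> chain_maps A (X i) (Z, d)" if "i \<in> I" for i
    using z di that by (simp add: chain_maps_iff)
  ultimately show ?thesis using that by blast
qed

lemma degreewise_coproduct_ex:
  assumes X: "X ` I \<subseteq> complexes A" and ZC: "Z \<in> complexes A"
    and Z: "\<And>n. is_coproduct A I (\<lambda>i. fst (X i) n) (fst Z n) (\<lambda>i. \<iota> i n)"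
    and \<iota>: "\<And>i. i \<in> I \<Longrightarrow> \<iota> i \<in> chain_maps A (X i) Z"
    and W: "W \<in> complexes A" and g: "\<And>i. i \<in> I \<Longrightarrow> g i \<in> chain_maps A (X i) W"
  obtains h where "h \<in> chain_maps A Z W" "\<And>i. i \<in> I \<Longrightarrow> cmp (Ch A) (X i) Z W h (\<iota> i) = g i"
proof -
  have Xi: "X i \<in> complexes A" if "i \<in> I" for i using X that by auto
  then have Xn: "(\<lambda>i. fst (X i) n) ` I \<subseteq> objs A" for n by auto
  have "\<exists>h. h \<in> mor A (fst Z n) (fst W n) \<and> (\<forall>i\<in>I. cmp A (fst (X i) n) (fst Z n) (fst W n) h (\<iota> i n) = g i
      n)" for n
    using coproduct_ex1[OF Z[of n], of "fst W n" "\<lambda>i. g i n"] g W by (auto elim!: ex1E)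
  then obtain h where h: "\<And>n. h n \<in> mor A (fst Z n) (fst W n)"
    and hi: "\<And>n i. i \<in> I \<Longrightarrow> cmp A (fst (X i) n) (fst Z n) (fst W n) (h n) (\<iota> i n) = g i n" by metis
  have "h \<in> chain_maps A Z W"
    unfolding chain_maps_iff
  proof (intro allI conjI h)
    fix n
    show "cmp A (fst Z n) (fst W n) (fst W (n - 1)) (snd W n) (h n) =
          cmp A (fst Z n) (fst Z (n - 1)) (fst W (n - 1)) (h (n - 1)) (snd Z n)"
    proof (rule coproduct_ext[OF Z _ Xn])
      fix i assume i: "i \<in> I"
      have "cmp A (fst (X i) n) (fst Z n) (fst W (n - 1)) (cmp A (fst Z n) (fst Z (n - 1)) (fst W (n - 1))
          (h (n - 1)) (snd Z n)) (\<iota> i n)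
        = cmp A (fst (X i) n) (fst (X i) (n - 1)) (fst W (n - 1)) (cmp A (fst (X i) (n - 1)) (fst Z (n - 1))
            (fst W (n - 1)) (h (n - 1)) (\<iota> i (n - 1))) (snd (X i) n)"
        using i h Xi[OF i] W ZC chain_maps_comm[OF \<iota>[OF i], of n] \<iota>[OF i] by (simp add: cmp_assoc)
      also have "\<dots> = cmp A (fst (X i) n) (fst Z n) (fst W (n - 1)) (cmp A (fst Z n) (fst W n) (fst W (n -
          1)) (snd W n) (h n)) (\<iota> i n)"
        using i h Xi[OF i] W ZC \<iota>[OF i] hi[OF i] chain_maps_comm[OF g[OF i], of n] by (simp add: cmp_assoc)
      finally show "cmp A (fst (X i) n) (fst Z n) (fst W (n - 1)) (cmp A (fst Z n) (fst W n) (fst W (n - 1))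
          (snd W n) (h n)) (\<iota> i n) =
         cmp A (fst (X i) n) (fst Z n) (fst W (n - 1)) (cmp A (fst Z n) (fst Z (n - 1)) (fst W (n - 1)) (h
             (n - 1)) (snd Z n)) (\<iota> i n)" ..
    qed (use h W ZC in auto)
  qed
  then show ?thesis using that hi by simp
qed

lemma degreewise_coproduct_Ch:
  assumes X: "X ` I \<subseteq> complexes A" and ZC: "Z \<in> complexes A"
    and Z: "\<And>n. is_coproduct A I (\<lambda>i. fst (X i) n) (fst Z n) (\<lambda>i. \<iota> i n)"
    and \<iota>: "\<And>i. i \<in> I \<Longrightarrow> \<iota> i \<in> chain_maps A (X i) Z"
  shows "is_coproduct (Ch A) I X Z \<iota>"
proof (rule is_coproductI)
  have Xi: "X i \<in> complexes A" if "i \<in> I" for i using X that by auto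
  then have Xn: "(\<lambda>i. fst (X i) n) ` I \<subseteq> objs A" for n by auto
  fix W assume W: "W \<in> objs (Ch A)"
  show "\<exists>h. h \<in> mor (Ch A) Z W \<and> (\<forall>i\<in>I. cmp (Ch A) (X i) Z W h (\<iota> i) = g i)"
    if "\<And>i. i \<in> I \<Longrightarrow> g i \<in> mor (Ch A) (X i) W" for g
    using degreewise_coproduct_ex[OF assms, of W g] W that by (metis Ch_simps(1,2))
  show "h = h'" if "h \<in> mor (Ch A) Z W" "h' \<in> mor (Ch A) Z W"
    "\<And>i. i \<in> I \<Longrightarrow> cmp (Ch A) (X i) Z W h (\<iota> i) = cmp (Ch A) (X i) Z W h' (\<iota> i)" for h h'
  proof
    fix n show "h n = h' n"
      by (rule coproduct_ext[OF Z[of n] _ Xn]) (use that W in \<open>auto simp: fun_eq_iff\<close>)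
  qed
qed (use assms in auto)

text \<open>Coproducts survive the passage to homotopy classes because homotopies can be glued: a
  homotopy out of \<open>Z\<close> is in each degree just a map out of a coproduct, so one may
  choose it summand by summand.\<close>

lemma degreewise_coproduct_K:
  assumes X: "X ` I \<subseteq> complexes A" and ZC: "Z \<in> complexes A"
    and Z: "\<And>n. is_coproduct A I (\<lambda>i. fst (X i) n) (fst Z n) (\<lambda>i. \<iota> i n)"
    and \<iota>: "\<And>i. i \<in> I \<Longrightarrow> \<iota> i \<in> chain_maps A (X i) Z"
  shows "is_coproduct (K A) I X Z (\<lambda>i. hclass (X i) Z (\<iota> i))"
proof (rule is_coproductI)
  have Xi: "X i \<in> complexes A" if "i \<in> I" for i using X that by auto
  then have Xn: "(\<lambda>i. fst (X i) n) ` I \<subseteq> objs A" for n by auto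
  fix W assume "W \<in> objs (K A)"
  then have W: "W \<in> complexes A" by simp
  show "\<exists>h. h \<in> mor (K A) Z W \<and> (\<forall>i\<in>I. cmp (K A) (X i) Z W h (hclass (X i) Z (\<iota> i)) = g i)"
    if g: "\<And>i. i \<in> I \<Longrightarrow> g i \<in> mor (K A) (X i) W" for g
  proof -
    have "\<forall>i\<in>I. \<exists>k. k \<in> chain_maps A (X i) W \<and> g i = hclass (X i) W k" using g by (auto simp: mor_K)
    then obtain k where k: "\<And>i. i \<in> I \<Longrightarrow> k i \<in> chain_maps A (X i) W" "\<And>i. i \<in> I \<Longrightarrow> g i = hclass (X i) W (k i)"
      by metis
    obtain h where "h \<in> chain_maps A Z W" "\<And>i. i \<in> I \<Longrightarrow> cmp (Ch A) (X i) Z W h (\<iota> i) = k i"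
      using degreewise_coproduct_ex[OF assms W, of k] k by blast
    then show ?thesis
      using k \<iota> Xi ZC W by (intro exI[of _ "hclass Z W h"]) (auto simp del: Ch_simps(5))
  qed
  show "h = h'" if h: "h \<in> mor (K A) Z W" "h' \<in> mor (K A) Z W"
    and eq: "\<And>i. i \<in> I \<Longrightarrow> cmp (K A) (X i) Z W h (hclass (X i) Z (\<iota> i)) = cmp (K A) (X i) Z W h' (hclass (X i)
        Z (\<iota> i))" for h h'
  proof -
    obtain a b where ab: "a \<in> chain_maps A Z W" "h = hclass Z W a" "b \<in> chain_maps A Z W" "h' = hclass Z W
        b"
      using h by (auto simp: mor_K)
    have "\<exists>s. \<forall>n. s n \<in> mor A (fst (X i) n) (fst W (n + 1)) \<and>
         cmp A (fst (X i) n) (fst Z n) (fst W n) (a n) (\<iota> i n) \<ominus>\<^bsub>Hom A (fst (X i) n) (fst W n)\<^esub>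
         cmp A (fst (X i) n) (fst Z n) (fst W n) (b n) (\<iota> i n)
         = cmp A (fst (X i) n) (fst W (n + 1)) (fst W n) (snd W (n + 1)) (s n)
               \<oplus>\<^bsub>Hom A (fst (X i) n) (fst W n)\<^esub> cmp A (fst (X i) n) (fst (X i) (n - 1)) (fst W n) (s (n -
                   1)) (snd (X i) n)"
      if i: "i \<in> I" for i
      using eq[OF i] ab \<iota>[OF i] Xi[OF i] W ZC by (simp add: hclass_eq_iff)
    \<comment> \<open>One homotopy is chosen for every index; the universal property in each degree
      assembles them into a single \<open>t\<close>.\<close>
    then obtain s where s: "\<And>i n. i \<in> I \<Longrightarrow> s i n \<in> mor A (fst (X i) n) (fst W (n + 1))"
      and seq: "\<And>i n. i \<in> I \<Longrightarrow> cmp A (fst (X i) n) (fst Z n) (fst W n) (a n) (\<iota> i n) \<ominus>\<^bsub>Hom A (fst (X i) n)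
          (fst W n)\<^esub>
         cmp A (fst (X i) n) (fst Z n) (fst W n) (b n) (\<iota> i n)
         = cmp A (fst (X i) n) (fst W (n + 1)) (fst W n) (snd W (n + 1)) (s i n)
               \<oplus>\<^bsub>Hom A (fst (X i) n) (fst W n)\<^esub> cmp A (fst (X i) n) (fst (X i) (n - 1)) (fst W n) (s i (n -
                   1)) (snd (X i) n)"
      by metis
    have "\<exists>t. t \<in> mor A (fst Z n) (fst W (n + 1)) \<and> (\<forall>i\<in>I. cmp A (fst (X i) n) (fst Z n) (fst W (n + 1)) t
        (\<iota> i n) = s i n)" for n
      using coproduct_ex1[OF Z[of n], of "fst W (n + 1)" "\<lambda>i. s i n"] s W by (auto elim!: ex1E)
    then obtain t where t: "\<And>n. t n \<in> mor A (fst Z n) (fst W (n + 1))"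
      and ti: "\<And>n i. i \<in> I \<Longrightarrow> cmp A (fst (X i) n) (fst Z n) (fst W (n + 1)) (t n) (\<iota> i n) = s i n" by metis
    have t': "t (n - 1) \<in> mor A (fst Z (n - 1)) (fst W n)" for n using t[of "n - 1"] by simp
    have ti': "i \<in> I \<Longrightarrow> cmp A (fst (X i) (n - 1)) (fst Z (n - 1)) (fst W n) (t (n - 1)) (\<iota> i (n - 1)) = s i
        (n - 1)" for n i
      using ti[of i "n - 1"] by simp
    have ti2: "cmp A (fst (X i) n) (fst Z (n - 1)) (fst W n) (t (n - 1)) (cmp A (fst (X i) n) (fst (X i) (n
        - 1)) (fst Z (n - 1)) (\<iota> i (n - 1)) (snd (X i) n)) =
      cmp A (fst (X i) n) (fst (X i) (n - 1)) (fst W n) (s i (n - 1)) (snd (X i) n)" if "i \<in> I" for i n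
      using that \<iota> Xi[OF that] ZC W t' ti'[OF that] by (simp flip: cmp_assoc)
    have "a n \<ominus>\<^bsub>Hom A (fst Z n) (fst W n)\<^esub> b n = cmp A (fst Z n) (fst W (n + 1)) (fst W n) (snd W (n + 1))
        (t n)
               \<oplus>\<^bsub>Hom A (fst Z n) (fst W n)\<^esub> cmp A (fst Z n) (fst Z (n - 1)) (fst W n) (t (n - 1)) (snd Z n)"
                   for n
    proof (rule coproduct_ext[OF Z[of n] _ Xn])
      fix i assume i: "i \<in> I"
      have s': "s i (n - 1) \<in> mor A (fst (X i) (n - 1)) (fst W n)" using s[OF i, of "n - 1"] by simp
      show "cmp A (fst (X i) n) (fst Z n) (fst W n) (a n \<ominus>\<^bsub>Hom A (fst Z n) (fst W n)\<^esub> b n) (\<iota> i n) =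
        cmp A (fst (X i) n) (fst Z n) (fst W n) (cmp A (fst Z n) (fst W (n + 1)) (fst W n) (snd W (n + 1))
            (t n)
               \<oplus>\<^bsub>Hom A (fst Z n) (fst W n)\<^esub> cmp A (fst Z n) (fst Z (n - 1)) (fst W n) (t (n - 1)) (snd Z n))
                   (\<iota> i n)"
        using i t t' ti[OF i, of n] ab \<iota>[OF i] Xi[OF i] W ZC s[OF i] s' seq[OF i, of n] chain_maps_comm[OF
            \<iota>[OF i], of n]
        by (simp add: minus_cmp cmp_add_left cmp_assoc ti2)
    qed (use t t' ab W ZC in auto)
    then show ?thesis using ab ZC W t by (auto simp: hclass_eq_iff)
  qed
qed (use assms in auto)

end

section \<open>Categories generated by countably supported objects\<close>

text \<open>A map whose components outside \<open>D\<close> vanish ought to factor through the part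
  of \<open>Z\<close> spanned by \<open>D\<close>. That part is never formed. Its place is taken by
  the endomorphism \<open>e\<close> of \<open>Z\<close> that keeps the summands in \<open>D\<close>
  and kills the others: \<open>e f = f\<close> because both sides have the same components, and
  \<open>h e = h' e\<close> by testing on summands.\<close>

lemma (in preadditive) coproduct_support_agree:
  assumes Z: "is_coproduct C I X Z \<iota>" and jm: "jointly_monic C I X Z \<iota>" and X: "X ` I \<subseteq> objs C"
    and W: "W \<in> objs C" and h: "h \<in> mor C Z W" "h' \<in> mor C Z W"
    and Y: "Y \<in> objs C" and f: "f \<in> mor C Y Z"
    and agree: "\<And>b. b \<in> I \<Longrightarrow> b \<in> D \<Longrightarrow> cmp C (X b) Z W h (\<iota> b) = cmp C (X b) Z W h' (\<iota> b)"
    and supp: "\<And>b. b \<in> I \<Longrightarrow> b \<notin> D \<Longrightarrow> cmp C Y Z (X b) (coproj C I X Z \<iota> b) f = \<zero>\<^bsub>Hom C Y (X b)\<^esub>"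
  shows "cmp C Y Z W h f = cmp C Y Z W h' f"
proof -
  note z = is_coproductD[OF Z]
  have Xb: "X b \<in> objs C" if "b \<in> I" for b using X that by auto
  obtain e where e: "e \<in> mor C Z Z"
    and eb: "\<And>b. b \<in> I \<Longrightarrow> cmp C (X b) Z Z e (\<iota> b) = (if b \<in> D then \<iota> b else \<zero>\<^bsub>Hom C (X b) Z\<^esub>)"
    by (rule coproduct_ex[OF Z, of Z "\<lambda>b. if b \<in> D then \<iota> b else \<zero>\<^bsub>Hom C (X b) Z\<^esub>"]) (use z Xb in auto)
  have "cmp C Y Z Z e f = f"
  proof (rule coproduct_mor_eqI[OF Z jm X Y _ f])
    fix b assume b: "b \<in> I"
    let ?p = "coproj C I X Z \<iota> b"
    have p: "?p \<in> mor C Z (X b)" by (rule coproj_mor[OF Z X b])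
    have pe: "cmp C Z Z (X b) ?p e = (if b \<in> D then ?p else \<zero>\<^bsub>Hom C Z (X b)\<^esub>)"
    proof (rule coproduct_ext[OF Z _ X])
      fix k assume k: "k \<in> I"
      show "cmp C (X k) Z (X b) (cmp C Z Z (X b) ?p e) (\<iota> k) =
        cmp C (X k) Z (X b) (if b \<in> D then ?p else \<zero>\<^bsub>Hom C Z (X b)\<^esub>) (\<iota> k)"
        using p e k b z Xb eb[OF k] coproj_inj[OF Z X b k] by (auto simp: cmp_assoc)
    qed (use p e b z Xb in auto)
    have "cmp C Y Z (X b) ?p (cmp C Y Z Z e f) = cmp C Y Z (X b) (cmp C Z Z (X b) ?p e) f"
      using p e f b z Y Xb by (simp add: cmp_assoc)
    also have "\<dots> = cmp C Y Z (X b) ?p f"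
      using supp[OF b] p f b z Y Xb by (auto simp: pe)
    finally show "cmp C Y Z (X b) ?p (cmp C Y Z Z e f) = cmp C Y Z (X b) ?p f" .
  qed (use e f z Y in auto)
  moreover have "cmp C Z Z W h e = cmp C Z Z W h' e"
  proof (rule coproduct_ext[OF Z _ X])
    fix k assume k: "k \<in> I"
    show "cmp C (X k) Z W (cmp C Z Z W h e) (\<iota> k) = cmp C (X k) Z W (cmp C Z Z W h' e) (\<iota> k)"
      using h e k z Xb W eb[OF k] agree[OF k] by (simp add: cmp_assoc)
  qed (use h e z W in auto)
  moreover have "cmp C Y Z W h (cmp C Y Z Z e f) = cmp C Y Z W (cmp C Z Z W h e) f"
    "cmp C Y Z W h' (cmp C Y Z Z e f) = cmp C Y Z W (cmp C Z Z W h' e) f"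
    using h e f z W Y by (simp_all add: cmp_assoc)
  ultimately show ?thesis by simp
qed

lemma card_Times_le_infinite: "\<lbrakk>infinite W; |X| \<le>o |W|; |Y| \<le>o |W|\<rbrakk> \<Longrightarrow> |X \<times> Y| \<le>o |W|"
  by (rule card_of_Times_ordLeq_infinite_Field) (simp_all add: Field_card_of card_of_card_order_on)

lemma small_mono: "B \<subseteq> C \<Longrightarrow> small u C \<Longrightarrow> small u B"
  unfolding small_def by (meson card_of_mono1 ordLeq_ordLess_trans)

text \<open>
  \<open>G\<close> will be the set of disk complexes. The set \<open>V\<close> only bounds cardinalities: it makes the set of
  complexes built from countable families in \<open>G\<close> small.
\<close>

locale countably_generated = preadditive_cat A for A :: "('o, 'm) category" +
  fixes u :: "'u itself" and G :: "'o set" and V :: "'u set"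
  assumes G: "G \<subseteq> objs A"
    and coproducts: "\<And>I X. \<lbrakk>small u I; X ` I \<subseteq> objs A\<rbrakk> \<Longrightarrow>
      \<exists>Z \<iota>. is_coproduct A (I :: 'u set) X Z \<iota> \<and> jointly_monic A I X Z \<iota> \<and> countable_supports A G I X Z \<iota>"
    and retract: "\<And>X. X \<in> objs A \<Longrightarrow> \<exists>(I :: 'u set) \<gamma> Z \<iota> i p. small u I \<and> \<gamma> ` I \<subseteq> G \<and> is_coproduct A I \<gamma> Z \<iota>
        \<and>
      i \<in> mor A X Z \<and> p \<in> mor A Z X \<and> cmp A X Z X p i = idm A X"
    and V: "infinite V" "small u (Pow V)"
    and card_G: "|G| \<le>o |V|"
    and card_mor: "\<And>g h. \<lbrakk>g \<in> G; h \<in> G\<rbrakk> \<Longrightarrow> |mor A g h| \<le>o |V|"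
begin

lemma coproduct_jm:
  assumes "small u I" "X ` I \<subseteq> objs A" "is_coproduct A (I :: 'u set) X Z \<iota>"
  shows "jointly_monic A I X Z \<iota>"
  using coproducts[OF assms(1,2)] jointly_monic_transfer[OF _ assms(3,2)] by blast

lemma coproduct_cs:
  assumes "small u I" "X ` I \<subseteq> objs A" "is_coproduct A (I :: 'u set) X Z \<iota>" "g \<in> G" "f \<in> mor A g Z"
  shows "countable {i\<in>I. cmp A g Z (X i) (coproj A I X Z \<iota> i) f \<noteq> \<zero>\<^bsub>Hom A g (X i)\<^esub>}"
proof -
  obtain Z' \<iota>' where Z': "is_coproduct A I X Z' \<iota>'" "countable_supports A G I X Z' \<iota>'"
    using coproducts[OF assms(1,2)] by blast
  have "countable_supports A G I X Z \<iota>"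
    by (rule countable_supports_transfer[OF Z'(1) assms(3,2) G Z'(2)])
  from bspec[OF bspec[OF this[unfolded countable_supports_def] assms(4)] assms(5)] show ?thesis .
qed

lemma card_countable_le:
  assumes "countable C"
  shows "|C| \<le>o |V|"
proof -
  have "|C| \<le>o |UNIV :: nat set|" using assms card_of_ordLeq[of C "UNIV :: nat set"] by (auto simp:
      countable_def)
  also have "|UNIV :: nat set| \<le>o |V|" using V(1) infinite_iff_card_of_nat[of V] by simp
  finally show ?thesis .
qed

lemma small_countable:
  assumes "countable C"
  shows "small u C"
proof -
  have "|C| \<le>o |V|" by (rule card_countable_le[OF assms])
  also have "|V| <o |Pow V|" by (rule card_of_Pow)
  also have "|Pow V| <o |UNIV :: 'u set|" using V(2) by (simp add: small_def)
  finally show ?thesis by (simp add: small_def)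
qed

lemma infinite_universe: "infinite (UNIV :: 'u set)"
  using V(1) finite_subset[OF subset_UNIV] by auto

section \<open>Chosen coproducts of countable families in \<open>G\<close>\<close>

text \<open>Up to renaming, every countable family is indexed by a subset of this one countably
  infinite set, which makes such families countable in terms of \<open>G\<close>-valued partial
  maps. It lies in \<open>'u\<close> because coproducts are provided for index sets in that
  type.\<close>

definition names :: "'u set" where
  "names = range (SOME e :: nat \<Rightarrow> 'u. inj e)"

lemma names: obtains e :: "nat \<Rightarrow> 'u" where "inj e" "names = range e"
proof -
  have "\<exists>e :: nat \<Rightarrow> 'u. inj e" using infinite_countable_subset[OF infinite_universe] by simp
  from someI_ex[OF this] that show ?thesis unfolding names_def by simp
qed

lemma countable_names: "countable (names :: 'u set)"
proof -
  obtain e :: "nat \<Rightarrow> 'u" where e: "names = range e" by (rule names)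
  show ?thesis unfolding e by (rule countable_image) simp
qed

text \<open>A countable family in \<open>G\<close> is coded by a partial map on \<open>names\<close>, so that a set of objects
  rather than a proper class contains a coproduct of each.\<close>

definition std_coproduct :: "('u \<Rightarrow> 'o option) \<Rightarrow> 'o" where
  "std_coproduct c = (SOME Z. \<exists>\<iota>. is_coproduct A (dom c) (\<lambda>b. the (c b)) Z \<iota>)"

definition codes :: "('u \<Rightarrow> 'o option) set" where
  "codes = {c. dom c \<subseteq> names \<and> ran c \<subseteq> G}"

definition std_objs :: "'o set" where
  "std_objs = std_coproduct ` codes"

lemma codes_G: "c \<in> codes \<Longrightarrow> b \<in> dom c \<Longrightarrow> the (c b) \<in> G"
  by (auto simp: codes_def ran_def)

lemma std_coproduct:
  assumes "c \<in> codes"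
  obtains \<iota> where "is_coproduct A (dom c) (\<lambda>b. the (c b)) (std_coproduct c) \<iota>"
proof -
  have "small u (dom c)" using assms countable_names by (auto simp: codes_def intro: small_countable
      countable_subset)
  moreover have "(\<lambda>b. the (c b)) ` dom c \<subseteq> objs A" using codes_G[OF assms] G by blast
  ultimately have "\<exists>Z \<iota>. is_coproduct A (dom c) (\<lambda>b. the (c b)) Z \<iota>" using coproducts[of "dom c" "\<lambda>b. the (c
      b)"] by auto
  from someI_ex[OF this] that show ?thesis unfolding std_coproduct_def by auto
qed

text \<open>The set \<open>C\<close> is enumerated and moved into \<open>names\<close>; a coproduct
  of the renamed family is also one of the original family.\<close>

lemma std_coproduct_exists:
  assumes "countable C" "\<gamma> ` C \<subseteq> G"
  obtains Z \<iota> where "Z \<in> std_objs" "is_coproduct A (C :: 'u set) \<gamma> Z \<iota>"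
proof -
  obtain e where e: "inj e" "names = range (e :: nat \<Rightarrow> 'u)" by (rule names)
  define \<phi> where "\<phi> = e \<circ> to_nat_on C"
  have inj: "inj_on \<phi> C" using e(1) inj_on_to_nat_on[OF assms(1)] unfolding \<phi>_def
    by (meson comp_inj_on inj_on_subset subset_UNIV)
  define c where "c = (\<lambda>b. if b \<in> \<phi> ` C then Some (\<gamma> (inv_into C \<phi> b)) else None)"
  have dom: "dom c = \<phi> ` C" by (auto simp: c_def dom_def)
  have c: "the (c (\<phi> b)) = \<gamma> b" if "b \<in> C" for b using that inj by (simp add: c_def)
  have "c \<in> codes"
    using assms(2) c unfolding codes_def ran_def mem_Collect_eq dom_def[symmetric]
  proof (intro conjI subsetI)
    fix x assume "x \<in> dom c"
    then show "x \<in> names" unfolding dom by (auto simp: \<phi>_def e(2))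
  next
    fix g assume "g \<in> {b. \<exists>a. c a = Some b}"
    then obtain x where x: "c x = Some g" by blast
    then have "x \<in> \<phi> ` C" using dom by auto
    then obtain b where "b \<in> C" "x = \<phi> b" by blast
    then show "g \<in> G" using c[of b] x assms(2) by auto
  qed
  then obtain \<iota> where \<iota>: "is_coproduct A (dom c) (\<lambda>b. the (c b)) (std_coproduct c) \<iota>" by (rule
      std_coproduct)
  have "is_coproduct A C \<gamma> (std_coproduct c) (\<iota> \<circ> \<phi>)"
  proof (rule coproduct_reindex[OF \<iota>])
    show "bij_betw \<phi> C (dom c)" using inj dom by (simp add: bij_betw_def)
    show "(\<lambda>b. the (c b)) ` dom c \<subseteq> objs A" using codes_G[OF \<open>c \<in> codes\<close>] G by blast
  qed (use c in auto)
  then show ?thesis using that \<open>c \<in> codes\<close> by (auto simp: std_objs_def)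
qed

lemma std_objsE:
  assumes "Z \<in> std_objs"
  obtains C \<gamma> \<iota> where "countable C" "C \<subseteq> names" "\<gamma> ` C \<subseteq> G" "is_coproduct A (C :: 'u set) \<gamma> Z \<iota>"
proof -
  obtain c where c: "c \<in> codes" "Z = std_coproduct c" using assms by (auto simp: std_objs_def)
  then obtain \<iota> where "is_coproduct A (dom c) (\<lambda>b. the (c b)) Z \<iota>" using std_coproduct by metis
  moreover have "countable (dom c)" "dom c \<subseteq> names" using c countable_names by (auto simp: codes_def intro:
      countable_subset)
  moreover have "(\<lambda>b. the (c b)) ` dom c \<subseteq> G" using codes_G[OF c(1)] by blast
  ultimately show ?thesis using that by blast
qed

section \<open>The generators and their number\<close>

definition gens :: "('o, 'm) complex set" where
  "gens = {X \<in> complexes A. \<forall>n. fst X n \<in> std_objs}"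

text \<open>All counts below code the objects in question by subsets of a set that is no larger than
  \<open>V\<close>.\<close>

lemma card_le_PowI:
  assumes "inj_on f X" "f ` X \<subseteq> Pow Y" "|Y| \<le>o |V|"
  shows "|X| \<le>o |Pow V|"
proof -
  have "|X| \<le>o |Pow Y|" using assms(1,2) card_of_ordLeq[of X "Pow Y"] by auto
  also have "|Pow Y| \<le>o |Pow V|"
  proof -
    obtain g where g: "inj_on g Y" "g ` Y \<subseteq> V" using assms(3) card_of_ordLeq[of Y V] by auto
    have "inj_on (image g) (Pow Y)" using g(1) by (rule inj_on_image_Pow)
    moreover have "image g ` Pow Y \<subseteq> Pow V" using g(2) by blast
    ultimately show ?thesis using card_of_ordLeq[of "Pow Y" "Pow V"] by auto
  qed
  finally show ?thesis .
qed

lemma card_Times_le: "|X| \<le>o |V| \<Longrightarrow> |Y| \<le>o |V| \<Longrightarrow> |X \<times> Y| \<le>o |V|"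
  by (rule card_Times_le_infinite[OF V(1)])

text \<open>A code is a partial map, hence determined by a subset of
  \<open>names \<times> G\<close>.\<close>

lemma card_std_objs: "|std_objs| \<le>o |Pow V|"
proof -
  have "|codes| \<le>o |Pow V|"
  proof (rule card_le_PowI)
    show "inj_on Map.graph codes"
      by (rule inj_onI, rule ext) (metis (no_types, lifting) Map.graph_def in_graphD in_graphI not_None_eq
          option.inject)
    show "Map.graph ` codes \<subseteq> Pow (names \<times> G)"
      by (auto simp: Map.graph_def codes_def ran_def)
    show "|names \<times> G| \<le>o |V|"
      by (intro card_Times_le card_countable_le countable_names card_G)
  qed
  then show ?thesis unfolding std_objs_def by (rule ordLeq_transitive[OF card_of_image])
qed

text \<open>A map between coproducts is determined by its matrix of components between members of
  \<open>G\<close>: on the source side by the universal property, on the target side by joint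
  monicity. The graph of the matrix is the code.\<close>

lemma card_mor_std_objs:
  assumes "Z \<in> std_objs" "W \<in> std_objs"
  shows "|mor A Z W| \<le>o |Pow V|"
proof -
  obtain C \<gamma> \<iota> where C: "C \<subseteq> names" "countable C" "\<gamma> ` C \<subseteq> G" "is_coproduct A (C :: 'u set) \<gamma> Z \<iota>"
    using std_objsE[OF assms(1)] by metis
  obtain D \<delta> \<kappa> where D: "D \<subseteq> names" "countable D" "\<delta> ` D \<subseteq> G" "is_coproduct A (D :: 'u set) \<delta> W \<kappa>"
    using std_objsE[OF assms(2)] by metis
  \<comment> \<open>Entries from all positions are collected in one set, since \<open>M\<close>
    records the position along with each entry.\<close>
  define H where "H = (\<Union>g\<in>G. \<Union>h\<in>G. mor A g h)"
  define \<pi> where "\<pi> = coproj A D \<delta> W \<kappa>"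
  define M where "M f = {((b, d), cmp A (\<gamma> b) W (\<delta> d) (\<pi> d) (cmp A (\<gamma> b) Z W f (\<iota> b))) | b d. b \<in> C \<and> d \<in>
      D}" for f
  note z = is_coproductD[OF C(4)] is_coproductD[OF D(4)]
  have o: "\<gamma> ` C \<subseteq> objs A" "\<delta> ` D \<subseteq> objs A" using C D G by auto
  then have o': "b \<in> C \<Longrightarrow> \<gamma> b \<in> objs A" "d \<in> D \<Longrightarrow> \<delta> d \<in> objs A" for b d by auto
  have \<pi>: "d \<in> D \<Longrightarrow> \<pi> d \<in> mor A W (\<delta> d)" for d unfolding \<pi>_def by (rule coproj_mor[OF D(4) o(2)])
  show ?thesis
  proof (rule card_le_PowI)
    show "inj_on M (mor A Z W)"
    proof (rule inj_onI)
      fix f g assume fg: "f \<in> mor A Z W" "g \<in> mor A Z W" "M f = M g"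
      show "f = g"
      proof (rule coproduct_ext[OF C(4) _ o(1) fg(1,2)])
        fix b assume b: "b \<in> C"
        show "cmp A (\<gamma> b) Z W f (\<iota> b) = cmp A (\<gamma> b) Z W g (\<iota> b)"
        proof (rule coproduct_mor_eqI[OF D(4) coproduct_jm[OF small_countable[OF D(2)] o(2) D(4)] o(2)])
          fix d assume d: "d \<in> D"
          have "((b, d), cmp A (\<gamma> b) W (\<delta> d) (\<pi> d) (cmp A (\<gamma> b) Z W f (\<iota> b))) \<in> M f"
            unfolding M_def using b d by blast
          then have "((b, d), cmp A (\<gamma> b) W (\<delta> d) (\<pi> d) (cmp A (\<gamma> b) Z W f (\<iota> b))) \<in> M g" using fg(3) by
              simp
          then show "cmp A (\<gamma> b) W (\<delta> d) (coproj A D \<delta> W \<kappa> d) (cmp A (\<gamma> b) Z W f (\<iota> b)) =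
            cmp A (\<gamma> b) W (\<delta> d) (coproj A D \<delta> W \<kappa> d) (cmp A (\<gamma> b) Z W g (\<iota> b))"
            unfolding M_def \<pi>_def by blast
        qed (use b o' z fg in auto)
      qed (use z in auto)
    qed
    show "M ` mor A Z W \<subseteq> Pow ((names \<times> names) \<times> H)"
    proof (clarsimp simp: M_def)
      fix f b d assume f: "f \<in> mor A Z W" and b: "b \<in> C" and d: "d \<in> D"
      have "cmp A (\<gamma> b) W (\<delta> d) (\<pi> d) (cmp A (\<gamma> b) Z W f (\<iota> b)) \<in> mor A (\<gamma> b) (\<delta> d)"
        using b d f z \<pi> o' by simp
      moreover have "\<gamma> b \<in> G" "\<delta> d \<in> G" using C D b d by auto
      ultimately show "b \<in> names \<and> d \<in> names \<and> cmp A (\<gamma> b) W (\<delta> d) (\<pi> d) (cmp A (\<gamma> b) Z W f (\<iota> b)) \<in> H"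
        using b d C(1) D(1) unfolding H_def by blast
    qed
    have "|H| \<le>o |V|"
      unfolding H_def using V(1) card_G card_mor by (intro card_of_UNION_ordLeq_infinite ballI) auto
    moreover have "|names \<times> names| \<le>o |V|"
      by (intro card_countable_le countable_SIGMA countable_names)
    ultimately show "|(names \<times> names) \<times> H| \<le>o |V|"
      by (rule card_Times_le[rotated])
  qed
qed

text \<open>A sequence of subsets of \<open>V\<close> amounts to one subset of the product of the
  integers with \<open>V\<close>, and this product is no larger than \<open>V\<close>.\<close>

lemma card_sequences:
  assumes "|X| \<le>o |Pow V|"
  shows "|{f :: int \<Rightarrow> 'c. range f \<subseteq> X}| \<le>o |Pow V|"
proof -
  obtain j where j: "inj_on j X" "j ` X \<subseteq> Pow V" using assms card_of_ordLeq[of X "Pow V"] by auto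
  show ?thesis
  proof (rule card_le_PowI)
    show "inj_on (\<lambda>f. {(n, v). v \<in> j (f n)}) {f :: int \<Rightarrow> 'c. range f \<subseteq> X}"
    proof (rule inj_onI, rule ext)
      fix f g n assume fg: "f \<in> {f. range f \<subseteq> X}" "g \<in> {f. range f \<subseteq> X}"
        and eq: "{(n, v). v \<in> j (f n)} = {(n, v). v \<in> j (g n)}"
      have "j (f n) = j (g n)" using eq by blast
      moreover have "f n \<in> X" "g n \<in> X" using fg by auto
      ultimately show "f n = g n" by (rule inj_onD[OF j(1)])
    qed
    show "(\<lambda>f. {(n, v). v \<in> j (f n)}) ` {f :: int \<Rightarrow> 'c. range f \<subseteq> X} \<subseteq> Pow ((UNIV :: int set) \<times> V)"
      using j(2) by blast
    show "|(UNIV :: int set) \<times> V| \<le>o |V|"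
      by (intro card_Times_le card_countable_le ordLeq_refl card_of_Card_order) simp_all
  qed
qed

text \<open>A generator is a sequence of standard objects with a sequence of maps between them, so
  there are at most \<open>|Pow V|\<close> of them. This is where the smallness of
  \<open>Pow V\<close>, rather than of \<open>V\<close>, matters.\<close>

lemma small_gens: "small u gens"
proof -
  have inf: "infinite (Pow V)" using V(1) by simp
  define M where "M = (\<Union>Z\<in>std_objs. \<Union>W\<in>std_objs. mor A Z W)"
  have "|M| \<le>o |Pow V|"
    unfolding M_def using inf card_std_objs card_mor_std_objs by (intro card_of_UNION_ordLeq_infinite ballI)
        auto
  then have "|{f :: int \<Rightarrow> 'o. range f \<subseteq> std_objs} \<times> {f :: int \<Rightarrow> 'm. range f \<subseteq> M}| \<le>o |Pow V|"
    by (intro card_Times_le_infinite[OF inf] card_sequences card_std_objs)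
  moreover have "gens \<subseteq> {f. range f \<subseteq> std_objs} \<times> {f. range f \<subseteq> M}"
  proof
    fix X assume X: "X \<in> gens"
    then have "snd X n \<in> mor A (fst X n) (fst X (n - 1))" "fst X n \<in> std_objs" for n
      using complexesD(2)[of X A n] by (auto simp: gens_def)
    then have "snd X n \<in> M" "fst X n \<in> std_objs" for n unfolding M_def by blast+
    then show "X \<in> {f. range f \<subseteq> std_objs} \<times> {f. range f \<subseteq> M}" by (cases X) auto
  qed
  ultimately have "|gens| \<le>o |Pow V|" using ordLeq_transitive[OF card_of_mono1] by simp
  then show ?thesis using V(2) unfolding small_def by (rule ordLeq_ordLess_trans)
qed

text \<open>The terms are only renumbered, hence remain standard; the two signs cancel when a
  complex is shifted forth and back.\<close>

lemma shift_gens: "shift (K A) ` gens = gens"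
proof -
  have shift: "shift (K A) X = (\<lambda>n. fst X (n - 1), \<lambda>n. \<ominus>\<^bsub>Hom A (fst X (n - 1)) (fst X (n - 2))\<^esub> snd X (n -
      1))" for X
    by (cases X) (simp add: K_def)
  have d1: "X \<in> complexes A \<Longrightarrow> snd X (n - 1) \<in> mor A (fst X (n - 1)) (fst X (n - 2))" for X n
    using complexesD(2)[of X A "n - 1"] by simp
  have d2: "X \<in> complexes A \<Longrightarrow> snd X (n - 2) \<in> mor A (fst X (n - 2)) (fst X (n - 3))" for X n
    using complexesD(2)[of X A "n - 2"] by simp
  have dd1: "X \<in> complexes A \<Longrightarrow> cmp A (fst X (n - 1)) (fst X (n - 2)) (fst X (n - 3)) (snd X (n - 2)) (snd X
      (n - 1)) =
      \<zero>\<^bsub>Hom A (fst X (n - 1)) (fst X (n - 3))\<^esub>" for X n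
    using complexesD(3)[of X A "n - 1"] by simp
  have dd2: "X \<in> complexes A \<Longrightarrow> cmp A (fst X (n + 1)) (fst X n) (fst X (n - 1)) (snd X n) (snd X (n + 1)) =
      \<zero>\<^bsub>Hom A (fst X (n + 1)) (fst X (n - 1))\<^esub>" for X n
    using complexesD(3)[of X A "n + 1"] by simp
  have neg0: "\<lbrakk>X \<in> objs A; Y \<in> objs A\<rbrakk> \<Longrightarrow> \<ominus>\<^bsub>Hom A X Y\<^esub> \<zero>\<^bsub>Hom A X Y\<^esub> = \<zero>\<^bsub>Hom A X Y\<^esub>" for X Y
    by (metis Hom_group abelian_group.minus_equality add_zero_right zero_mor)
  have negneg: "\<lbrakk>f \<in> mor A X Y; X \<in> objs A; Y \<in> objs A\<rbrakk> \<Longrightarrow> \<ominus>\<^bsub>Hom A X Y\<^esub> (\<ominus>\<^bsub>Hom A X Y\<^esub> f) = f" for f X Y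
    using Hom_group[of X Y] by (simp add: abelian_group.minus_minus)
  show ?thesis
  proof
    show "shift (K A) ` gens \<subseteq> gens"
    proof (rule image_subsetI)
      fix X assume X: "X \<in> gens"
      then have XC: "X \<in> complexes A" by (simp add: gens_def)
      have "shift (K A) X \<in> complexes A"
        unfolding shift complexes_iff fst_conv snd_conv
        using d1[OF XC] d2[OF XC] dd1[OF XC] XC by (simp add: neg0)
      then show "shift (K A) X \<in> gens" using X by (simp add: gens_def shift)
    qed
    show "gens \<subseteq> shift (K A) ` gens"
    proof
      fix X assume X: "X \<in> gens"
      define Y where "Y = (\<lambda>n. fst X (n + 1), \<lambda>n. \<ominus>\<^bsub>Hom A (fst X (n + 1)) (fst X n)\<^esub> snd X (n + 1))"
      have XC: "X \<in> complexes A" using X by (simp add: gens_def)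
      have "Y \<in> complexes A"
        unfolding Y_def complexes_iff fst_conv snd_conv
        using XC dd2[OF XC] by (simp add: neg0)
      then have "Y \<in> gens" using X by (simp add: gens_def Y_def)
      moreover have "shift (K A) Y = X"
        using XC by (simp add: shift Y_def negneg)
      ultimately show "X \<in> shift (K A) ` gens" by (metis imageI)
    qed
  qed
qed

end

section \<open>Complexes of free objects\<close>

text \<open>Each term comes with a basis, that is, with a decomposition into members of
  \<open>G\<close> indexed by \<open>B n\<close>. The decomposition belongs to each term alone; the
  differential need not respect it.\<close>

locale free_complex = countably_generated A u G V
  for A :: "('o, 'm) category" and u :: "'u itself" and G and V :: "'u set" +
  fixes F :: "('o, 'm) complex" and B :: "int \<Rightarrow> 'u set" and \<gamma> :: "int \<Rightarrow> 'u \<Rightarrow> 'o" and \<iota> :: "int \<Rightarrow> 'u \<Rightarrow> 'm"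
  assumes F [simp]: "F \<in> complexes A"
    and small_B: "small u (B n)"
    and gamma: "\<gamma> n ` B n \<subseteq> G"
    and coproduct: "is_coproduct A (B n) (\<gamma> n) (fst F n) (\<iota> n)"
begin

lemma gamma_objs: "\<gamma> n ` B n \<subseteq> objs A"
  using gamma G by blast

lemma gamma_G: "b \<in> B n \<Longrightarrow> \<gamma> n b \<in> G"
  using gamma by blast

lemma gamma_obj [simp]: "b \<in> B n \<Longrightarrow> \<gamma> n b \<in> objs A"
  using gamma_objs by blast

lemma iota_mor [simp]: "b \<in> B n \<Longrightarrow> \<iota> n b \<in> mor A (\<gamma> n b) (fst F n)"
  by (rule coproduct_inj[OF coproduct])

lemmas F_ext = coproduct_ext[OF coproduct _ gamma_objs]

lemmas F_jm = coproduct_jm[OF small_B gamma_objs coproduct]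

abbreviation \<pi> :: "int \<Rightarrow> 'u \<Rightarrow> 'm" where
  "\<pi> n b \<equiv> coproj A (B n) (\<gamma> n) (fst F n) (\<iota> n) b"

lemma pi_mor [simp]: "b \<in> B n \<Longrightarrow> \<pi> n b \<in> mor A (fst F n) (\<gamma> n b)"
  by (rule coproj_mor[OF coproduct gamma_objs])

definition bd :: "int \<Rightarrow> 'u \<Rightarrow> 'm" where
  "bd n b = cmp A (\<gamma> n b) (fst F n) (fst F (n - 1)) (snd F n) (\<iota> n b)"

lemma bd_mor [simp]: "b \<in> B n \<Longrightarrow> bd n b \<in> mor A (\<gamma> n b) (fst F (n - 1))"
  by (simp add: bd_def)

lemma d_bd:
  assumes "b \<in> B n"
  shows "cmp A (\<gamma> n b) (fst F (n - 1)) (fst F (n - 2)) (snd F (n - 1)) (bd n b) = \<zero>\<^bsub>Hom A (\<gamma> n b) (fst F (n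
      - 2))\<^esub>"
proof -
  have "snd F (n - 1) \<in> mor A (fst F (n - 1)) (fst F (n - 2))" using complexesD(2)[OF F, of "n - 1"] by simp
  then show ?thesis using assms by (simp add: bd_def flip: cmp_assoc)
qed

text \<open>The basis elements that occur in the boundary of \<open>b\<close>. They are countably
  many because the source \<open>\<gamma> n b\<close> of that boundary belongs to
  \<open>G\<close>.\<close>

definition dep :: "int \<Rightarrow> 'u \<Rightarrow> 'u set" where
  "dep n b = {c \<in> B (n - 1). cmp A (\<gamma> n b) (fst F (n - 1)) (\<gamma> (n - 1) c) (\<pi> (n - 1) c) (bd n b) \<noteq> \<zero>\<^bsub>Hom A (\<gamma>
      n b) (\<gamma> (n - 1) c)\<^esub>}"

lemma dep_subset: "dep n b \<subseteq> B (n - 1)"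
  by (auto simp: dep_def)

lemma countable_dep: "b \<in> B n \<Longrightarrow> countable (dep n b)"
  unfolding dep_def by (rule coproduct_cs[OF small_B gamma_objs coproduct gamma_G]) simp_all

section \<open>Parts of the basis that span subcomplexes\<close>

text \<open>The condition for a part of the basis to span a subcomplex, expressed by index sets
  only. It thus makes sense also for uncountable parts, for which no standard coproduct is
  available.\<close>

definition closed :: "(int \<Rightarrow> 'u set) \<Rightarrow> bool" where
  "closed D \<longleftrightarrow> (\<forall>n. D n \<subseteq> B n \<and> (\<forall>b\<in>D n. dep n b \<subseteq> D (n - 1)))"

lemma closedD: "closed D \<Longrightarrow> D n \<subseteq> B n" "closed D \<Longrightarrow> b \<in> D n \<Longrightarrow> dep n b \<subseteq> D (n - 1)"
  by (auto simp: closed_def)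

text \<open>Boundaries are adjoined over and over. Countably many rounds, each adding countably many
  indices, reach a closed part. The clause on empty families ensures later that a component of a map
  without any support yields a zero map from its generator.\<close>

lemma countable_closure:
  assumes D: "\<And>n. D n \<subseteq> B n" "\<And>n. countable (D n)"
  obtains E where "closed E" "\<And>n. D n \<subseteq> E n" "\<And>n. countable (E n)" "(\<forall>n. D n = {}) \<longrightarrow> (\<forall>n. E n = {})"
proof -
  \<comment> \<open>Each round adds to degree \<open>n\<close> the indices that occur in boundaries
    of elements of degree \<open>n + 1\<close>.\<close>
  define st where "st = rec_nat D (\<lambda>_ S n. S n \<union> (\<Union>b\<in>S (n + 1). dep (n + 1) b))"
  have st0: "st 0 = D" and stS: "st (Suc k) n = st k n \<union> (\<Union>b\<in>st k (n + 1). dep (n + 1) b)" for k n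
    by (simp_all add: st_def)
  have B: "st k n \<subseteq> B n" for k n
  proof (induction k arbitrary: n)
    case 0
    then show ?case using D(1) by (simp add: st0)
  next
    case (Suc k)
    have "dep (n + 1) b \<subseteq> B n" for b using dep_subset[of "n + 1" b] by simp
    then show ?case using Suc by (auto simp: stS)
  qed
  have cnt: "countable (st k n)" for k n
  proof (induction k arbitrary: n)
    case 0
    then show ?case using D(2) by (simp add: st0)
  next
    case (Suc k)
    then show ?case using B[of k "n + 1"] countable_dep by (auto simp: stS intro!: countable_UN)
  qed
  define E where "E n = (\<Union>k. st k n)" for n
  show ?thesis
  proof (rule that)
    show "closed E"
      unfolding closed_def
    proof (intro allI conjI ballI)
      fix n show "E n \<subseteq> B n" using B by (auto simp: E_def)
      fix b assume "b \<in> E n"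
      then obtain k where "b \<in> st k n" by (auto simp: E_def)
      then have "dep n b \<subseteq> st (Suc k) (n - 1)" by (auto simp: stS)
      then show "dep n b \<subseteq> E (n - 1)" unfolding E_def by blast
    qed
    show "D n \<subseteq> E n" for n using st0 unfolding E_def by (metis UN_upper UNIV_I)
    show "countable (E n)" for n using cnt by (simp add: E_def)
    have "st k n = {}" if "\<forall>n. D n = {}" for k n by (induction k arbitrary: n) (simp_all add: st0 stS that)
    then show "(\<forall>n. D n = {}) \<longrightarrow> (\<forall>n. E n = {})" by (simp add: E_def)
  qed
qed

text \<open>The boundary of \<open>b\<close> is supported in \<open>dep n b\<close>, so maps out of
  the term below are compared only there.\<close>

lemma bd_agree:
  assumes b: "b \<in> B n" and dep: "dep n b \<subseteq> D" and W: "W \<in> objs A"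
    and h: "h \<in> mor A (fst F (n - 1)) W" "h' \<in> mor A (fst F (n - 1)) W"
    and agree: "\<And>c. c \<in> B (n - 1) \<Longrightarrow> c \<in> D \<Longrightarrow> cmp A (\<gamma> (n - 1) c) (fst F (n - 1)) W h (\<iota> (n - 1) c) =
      cmp A (\<gamma> (n - 1) c) (fst F (n - 1)) W h' (\<iota> (n - 1) c)"
  shows "cmp A (\<gamma> n b) (fst F (n - 1)) W h (bd n b) = cmp A (\<gamma> n b) (fst F (n - 1)) W h' (bd n b)"
proof (rule coproduct_support_agree[OF coproduct F_jm gamma_objs W h _ _ agree])
  show "cmp A (\<gamma> n b) (fst F (n - 1)) (\<gamma> (n - 1) c) (\<pi> (n - 1) c) (bd n b) = \<zero>\<^bsub>Hom A (\<gamma> n b) (\<gamma> (n - 1) c)\<^esub>"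
    if "c \<in> B (n - 1)" "c \<notin> D" for c using that dep by (auto simp: dep_def)
qed (use b in simp_all)

text \<open>A standard object spanned by the part \<open>C\<close> of the basis and split off by the
  inclusion \<open>j\<close> and the retraction \<open>r\<close>, where \<open>r\<close> kills the
  remaining basis elements. Taken over all degrees, neither map need commute with
  differentials.\<close>

definition sub_std :: "int \<Rightarrow> 'u set \<Rightarrow> 'o \<Rightarrow> ('u \<Rightarrow> 'm) \<Rightarrow> 'm \<Rightarrow> 'm \<Rightarrow> bool" where
  "sub_std n C Z \<kappa> j r \<longleftrightarrow> Z \<in> std_objs \<and> is_coproduct A C (\<gamma> n) Z \<kappa> \<and> j \<in> mor A Z (fst F n) \<and> r \<in> mor A (fst
      F n) Z \<and>
     (\<forall>b\<in>C. cmp A (\<gamma> n b) Z (fst F n) j (\<kappa> b) = \<iota> n b) \<and>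
     (\<forall>b\<in>B n. cmp A (\<gamma> n b) (fst F n) Z r (\<iota> n b) = (if b \<in> C then \<kappa> b else \<zero>\<^bsub>Hom A (\<gamma> n b) Z\<^esub>)) \<and>
     cmp A Z (fst F n) Z r j = idm A Z"

lemma sub_std_exists:
  assumes C: "C \<subseteq> B n" "countable C"
  shows "\<exists>Z \<kappa> j r. sub_std n C Z \<kappa> j r"
proof -
  have "\<gamma> n ` C \<subseteq> G" using C(1) gamma by blast
  then obtain Z \<kappa> where Z: "Z \<in> std_objs" "is_coproduct A C (\<gamma> n) Z \<kappa>"
    by (rule std_coproduct_exists[OF C(2)])
  note z = is_coproductD[OF Z(2)]
  have o: "\<gamma> n ` C \<subseteq> objs A" using C(1) gamma_objs by blast
  then have o': "b \<in> C \<Longrightarrow> \<gamma> n b \<in> objs A" for b by blast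
  obtain j where j: "j \<in> mor A Z (fst F n)" "\<And>b. b \<in> C \<Longrightarrow> cmp A (\<gamma> n b) Z (fst F n) j (\<kappa> b) = \<iota> n b"
    by (rule coproduct_ex[OF Z(2), of "fst F n" "\<iota> n"]) (use C in auto)
  obtain r where r: "r \<in> mor A (fst F n) Z"
    "\<And>b. b \<in> B n \<Longrightarrow> cmp A (\<gamma> n b) (fst F n) Z r (\<iota> n b) = (if b \<in> C then \<kappa> b else \<zero>\<^bsub>Hom A (\<gamma> n b) Z\<^esub>)"
    by (rule coproduct_ex[OF coproduct[of n], of Z "\<lambda>b. if b \<in> C then \<kappa> b else \<zero>\<^bsub>Hom A (\<gamma> n b) Z\<^esub>"]) (use z
        in auto)
  have "cmp A Z (fst F n) Z r j = idm A Z"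
  proof (rule coproduct_ext[OF Z(2) _ o])
    fix b assume b: "b \<in> C"
    then show "cmp A (\<gamma> n b) Z Z (cmp A Z (fst F n) Z r j) (\<kappa> b) = cmp A (\<gamma> n b) Z Z (idm A Z) (\<kappa> b)"
      using j r z o' C by (auto simp: cmp_assoc)
  qed (use j r z in auto)
  then show ?thesis using Z j r unfolding sub_std_def by blast
qed

lemma sub_stdD:
  assumes "sub_std n C Z \<kappa> j r"
  shows "Z \<in> std_objs" "Z \<in> objs A" "is_coproduct A C (\<gamma> n) Z \<kappa>" "b \<in> C \<Longrightarrow> \<kappa> b \<in> mor A (\<gamma> n b) Z"
    "j \<in> mor A Z (fst F n)" "r \<in> mor A (fst F n) Z"
    "b \<in> C \<Longrightarrow> cmp A (\<gamma> n b) Z (fst F n) j (\<kappa> b) = \<iota> n b"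
    "b \<in> B n \<Longrightarrow> cmp A (\<gamma> n b) (fst F n) Z r (\<iota> n b) = (if b \<in> C then \<kappa> b else \<zero>\<^bsub>Hom A (\<gamma> n b) Z\<^esub>)"
    "cmp A Z (fst F n) Z r j = idm A Z"
  using assms is_coproductD[of A C "\<gamma> n" Z \<kappa>] unfolding sub_std_def by auto

section \<open>Extending contracting homotopies\<close>

text \<open>The equation \<open>f = d s + s d\<close> is demanded only on basis elements in
  \<open>D\<close>, while \<open>s\<close> is defined on all of \<open>F\<close>. As
  \<open>D\<close> may be uncountable, this avoids an object spanned by it; the values of
  \<open>s\<close> elsewhere carry no information.\<close>

definition contracts :: "('o, 'm) complex \<Rightarrow> (int \<Rightarrow> 'm) \<Rightarrow> (int \<Rightarrow> 'u set) \<Rightarrow> (int \<Rightarrow> 'm) \<Rightarrow> bool" where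
  "contracts T f D s \<longleftrightarrow> closed D \<and> (\<forall>n. s n \<in> mor A (fst F n) (fst T (n + 1))) \<and>
     (\<forall>n. \<forall>b\<in>D n. cmp A (\<gamma> n b) (fst F n) (fst T n) (f n) (\<iota> n b) =
        cmp A (\<gamma> n b) (fst T (n + 1)) (fst T n) (snd T (n + 1)) (cmp A (\<gamma> n b) (fst F n) (fst T (n + 1)) (s
            n) (\<iota> n b))
        \<oplus>\<^bsub>Hom A (\<gamma> n b) (fst T n)\<^esub> cmp A (\<gamma> n b) (fst F (n - 1)) (fst T n) (s (n - 1)) (bd n b))"

text \<open>The successor step of the transfinite argument. A countable closed part \<open>E\<close>
  around \<open>b0\<close> is adjoined to \<open>D\<close>. The quotient of the new subcomplex by
  the old one has basis \<open>C = E - D\<close>, hence is a generator \<open>S\<close>. After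
  subtracting what \<open>s\<close> contracts already, \<open>f\<close> vanishes on \<open>D\<close>
  and induces a map from \<open>S\<close> to \<open>T\<close>. A contraction \<open>t\<close> of
  this map, pulled back along \<open>r\<close>, corrects \<open>s\<close>.\<close>

lemma contracts_extend:
  assumes T: "T \<in> complexes A" and f: "f \<in> chain_maps A F T"
    and null: "\<And>S g. \<lbrakk>S \<in> gens; g \<in> chain_maps A S T\<rbrakk> \<Longrightarrow> g \<in> null_homotopic A S T"
    and con: "contracts T f D s" and b0: "b0 \<in> B m"
  obtains D' s' where "contracts T f D' s'" "\<And>n. D n \<subseteq> D' n" "b0 \<in> D' m"
    "\<And>n b. b \<in> D n \<Longrightarrow> cmp A (\<gamma> n b) (fst F n) (fst T (n + 1)) (s' n) (\<iota> n b) = cmp A (\<gamma> n b) (fst F n) (fst T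
        (n + 1)) (s n) (\<iota> n b)"
proof -
  have clD: "closed D" and s: "\<And>n. s n \<in> mor A (fst F n) (fst T (n + 1))"
    and fD: "\<And>n b. b \<in> D n \<Longrightarrow> cmp A (\<gamma> n b) (fst F n) (fst T n) (f n) (\<iota> n b) =
        cmp A (\<gamma> n b) (fst T (n + 1)) (fst T n) (snd T (n + 1)) (cmp A (\<gamma> n b) (fst F n) (fst T (n + 1)) (s
            n) (\<iota> n b))
        \<oplus>\<^bsub>Hom A (\<gamma> n b) (fst T n)\<^esub> cmp A (\<gamma> n b) (fst F (n - 1)) (fst T n) (s (n - 1)) (bd n b)"
    using con by (auto simp: contracts_def)
  have s1: "s (n - 1) \<in> mor A (fst F (n - 1)) (fst T n)" for n using s[of "n - 1"] by simp
  have DB: "b \<in> B n" if "b \<in> D n" for b n using closedD(1)[OF clD] that by blast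
  have d1: "snd F (n - 1) \<in> mor A (fst F (n - 1)) (fst F (n - 2))" for n using complexesD(2)[OF F, of "n -
      1"] by simp
  have dT1: "snd T (n - 1) \<in> mor A (fst T (n - 1)) (fst T (n - 2))" for n using complexesD(2)[OF T, of "n -
      1"] by simp
  obtain E where E: "closed E" "\<And>n. (if n = m then {b0} else {}) \<subseteq> E n" "\<And>n. countable (E n)"
    by (rule countable_closure[of "\<lambda>n. if n = m then {b0} else {}"]) (use b0 in auto)
  \<comment> \<open>In general \<open>C\<close> is not closed, since boundaries of its elements may
    run into \<open>D\<close>; it describes a quotient, not a subcomplex.\<close>
  define C where "C n = E n - D n" for n
  have CB: "C n \<subseteq> B n" for n using closedD(1)[OF E(1)] by (auto simp: C_def)
  then have CB': "b \<in> B n" if "b \<in> C n" for b n using that by blast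
  have depC: "dep n b \<subseteq> D (n - 1) \<union> C (n - 1)" if "b \<in> C n" for b n
    using closedD(2)[OF E(1), of b n] that by (auto simp: C_def)
  have "\<forall>n. \<exists>Z \<kappa> j r. sub_std n (C n) Z \<kappa> j r"
    using sub_std_exists CB E(3) by (simp add: C_def)
  then obtain S \<kappa> j r where "\<And>n. sub_std n (C n) (S n) (\<kappa> n) (j n) (r n)" by metis
  note S = sub_stdD[OF this]
  note [simp] = S(2) S(4) S(5) S(6)
  have r1: "r (n - 1) \<in> mor A (fst F (n - 1)) (S (n - 1))" "r (n - 2) \<in> mor A (fst F (n - 2)) (S (n - 2))"
      for n
    by simp_all
  have Co: "\<gamma> n ` C n \<subseteq> objs A" for n using CB gamma_objs by blast
  have r_D: "cmp A (\<gamma> n b) (fst F n) (S n) (r n) (\<iota> n b) = \<zero>\<^bsub>Hom A (\<gamma> n b) (S n)\<^esub>" if "b \<in> D n" for n b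
    using S(8)[of b n] DB[OF that] that by (simp add: C_def)
  have r_C: "cmp A (\<gamma> n b) (fst F n) (S n) (r n) (\<iota> n b) = \<kappa> n b" if "b \<in> C n" for n b
    using S(8)[of b n] CB' that by simp
  \<comment> \<open>As \<open>D\<close> is closed, \<open>r\<close> kills not only its elements but
    also their boundaries.\<close>
  have r_bd: "cmp A (\<gamma> n b) (fst F (n - 1)) (S (n - 1)) (r (n - 1)) (bd n b) = \<zero>\<^bsub>Hom A (\<gamma> n b) (S (n - 1))\<^esub>"
      if "b \<in> D n" for n b
  proof -
    have "cmp A (\<gamma> n b) (fst F (n - 1)) (S (n - 1)) (r (n - 1)) (bd n b) =
        cmp A (\<gamma> n b) (fst F (n - 1)) (S (n - 1)) \<zero>\<^bsub>Hom A (fst F (n - 1)) (S (n - 1))\<^esub> (bd n b)"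
      by (rule bd_agree[OF DB[OF that] closedD(2)[OF clD that]]) (simp_all add: r_D)
    then show ?thesis using DB[OF that] by simp
  qed
  \<comment> \<open>The differential of the quotient: include, apply the differential of
    \<open>F\<close>, and forget the components in \<open>D\<close>.\<close>
  define dS where "dS n = cmp A (S n) (fst F (n - 1)) (S (n - 1)) (r (n - 1)) (cmp A (S n) (fst F n) (fst F
      (n - 1)) (snd F n) (j n))" for n
  have dS [simp]: "dS n \<in> mor A (S n) (S (n - 1))" for n by (simp add: dS_def)
  have dS1: "dS (n - 1) \<in> mor A (S (n - 1)) (S (n - 2))" for n using dS[of "n - 1"] by simp
  have dS_kappa: "cmp A (\<gamma> n b) (S n) (S (n - 1)) (dS n) (\<kappa> n b) = cmp A (\<gamma> n b) (fst F (n - 1)) (S (n - 1))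
      (r (n - 1)) (bd n b)"
    if b: "b \<in> C n" for n b
    using b CB' S(7)[OF b] by (simp add: dS_def cmp_assoc bd_def)
  \<comment> \<open>On \<open>D\<close> and \<open>C\<close> the maps \<open>h j r\<close> and
    \<open>h\<close> agree as soon as \<open>h\<close> kills \<open>D\<close>, and the boundary of
    \<open>b\<close> is supported there. Both the vanishing square of \<open>dS\<close> and the
    chain map law for \<open>\<phi> j\<close> reduce to this.\<close>
  have jr_agree: "cmp A (\<gamma> n b) (fst F (n - 1)) W h (cmp A (\<gamma> n b) (S (n - 1)) (fst F (n - 1)) (j (n - 1))
      (cmp A (\<gamma> n b) (S n) (S (n - 1)) (dS n) (\<kappa> n b)))
      = cmp A (\<gamma> n b) (fst F (n - 1)) W h (bd n b)"
    if b: "b \<in> C n" and W: "W \<in> objs A" and h: "h \<in> mor A (fst F (n - 1)) W"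
      and hD: "\<And>c. c \<in> D (n - 1) \<Longrightarrow> cmp A (\<gamma> (n - 1) c) (fst F (n - 1)) W h (\<iota> (n - 1) c) = \<zero>\<^bsub>Hom A (\<gamma> (n -
          1) c) W\<^esub>" for n b W h
  proof -
    have "cmp A (\<gamma> n b) (fst F (n - 1)) W (cmp A (fst F (n - 1)) (S (n - 1)) W (cmp A (S (n - 1)) (fst F (n
        - 1)) W h (j (n - 1))) (r (n - 1))) (bd n b)
      = cmp A (\<gamma> n b) (fst F (n - 1)) W h (bd n b)"
    proof (rule bd_agree[OF CB'[OF b] depC[OF b] W _ h])
      fix c assume c: "c \<in> B (n - 1)" "c \<in> D (n - 1) \<union> C (n - 1)"
      show "cmp A (\<gamma> (n - 1) c) (fst F (n - 1)) W (cmp A (fst F (n - 1)) (S (n - 1)) W (cmp A (S (n - 1))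
          (fst F (n - 1)) W h (j (n - 1))) (r (n - 1))) (\<iota> (n - 1) c)
        = cmp A (\<gamma> (n - 1) c) (fst F (n - 1)) W h (\<iota> (n - 1) c)"
      proof (cases "c \<in> D (n - 1)")
        case True
        then show ?thesis using c h W hD[OF True] r_D[OF True] by (simp add: cmp_assoc)
      next
        case False
        then have "c \<in> C (n - 1)" using c by simp
        then show ?thesis using c h W r_C[of c "n - 1"] S(7)[of c "n - 1"] by (simp add: cmp_assoc)
      qed
    qed (use h W in simp)
    then show ?thesis using b CB'[OF b] h W by (simp add: cmp_assoc dS_kappa)
  qed
  have SC: "(S, dS) \<in> complexes A"
    unfolding complexes_iff fst_conv snd_conv
  proof (intro allI conjI)
    fix n
    show "cmp A (S n) (S (n - 1)) (S (n - 2)) (dS (n - 1)) (dS n) = \<zero>\<^bsub>Hom A (S n) (S (n - 2))\<^esub>"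
    proof (rule coproduct_ext[OF S(3) _ Co])
      fix b assume b: "b \<in> C n"
      \<comment> \<open>This map kills the elements of \<open>D\<close> because their boundaries are
        supported in \<open>D\<close>, where \<open>r\<close> vanishes.\<close>
      let ?h = "cmp A (fst F (n - 1)) (fst F (n - 2)) (S (n - 2)) (r (n - 2)) (snd F (n - 1))"
      have "cmp A (\<gamma> n b) (S n) (S (n - 2)) (cmp A (S n) (S (n - 1)) (S (n - 2)) (dS (n - 1)) (dS n)) (\<kappa> n
          b)
        = cmp A (\<gamma> n b) (fst F (n - 1)) (S (n - 2)) ?h (cmp A (\<gamma> n b) (S (n - 1)) (fst F (n - 1)) (j (n -
            1)) (cmp A (\<gamma> n b) (S n) (S (n - 1)) (dS n) (\<kappa> n b)))"
        using b CB'[OF b] dS1[of n] dS[of n] d1[of n] by (simp add: cmp_assoc del: dS) (simp add: dS_def[of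
            "n - 1"] cmp_assoc)
      also have "\<dots> = cmp A (\<gamma> n b) (fst F (n - 1)) (S (n - 2)) ?h (bd n b)"
      proof (rule jr_agree[OF b])
        fix c assume c: "c \<in> D (n - 1)"
        show "cmp A (\<gamma> (n - 1) c) (fst F (n - 1)) (S (n - 2)) ?h (\<iota> (n - 1) c) = \<zero>\<^bsub>Hom A (\<gamma> (n - 1) c) (S (n
            - 2))\<^esub>"
          using r_bd[OF c] DB[OF c] d1[of n] by (simp add: cmp_assoc bd_def)
      qed (use d1 in auto)
      also have "\<dots> = \<zero>\<^bsub>Hom A (\<gamma> n b) (S (n - 2))\<^esub>"
        using CB'[OF b] d1[of n] d_bd[OF CB'[OF b]] by (simp add: cmp_assoc)
      finally show "cmp A (\<gamma> n b) (S n) (S (n - 2)) (cmp A (S n) (S (n - 1)) (S (n - 2)) (dS (n - 1)) (dS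
          n)) (\<kappa> n b) =
        cmp A (\<gamma> n b) (S n) (S (n - 2)) \<zero>\<^bsub>Hom A (S n) (S (n - 2))\<^esub> (\<kappa> n b)"
        using b CB'[OF b] by simp
    qed (use dS1 in auto)
  qed simp_all
  then have gen: "(S, dS) \<in> gens" using S(1) by (simp add: gens_def)
  \<comment> \<open>The part of \<open>f\<close> that \<open>s\<close> accounts for. Being of the
    form \<open>d s + s d\<close>, it is a chain map on all of \<open>F\<close>, and it agrees with
    \<open>f\<close> on \<open>D\<close>.\<close>
  define \<psi> where "\<psi> n = cmp A (fst F n) (fst T (n + 1)) (fst T n) (snd T (n + 1)) (s n)
      \<oplus>\<^bsub>Hom A (fst F n) (fst T n)\<^esub> cmp A (fst F n) (fst F (n - 1)) (fst T n) (s (n - 1)) (snd F n)" for n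
  have psi_mor [simp]: "\<psi> n \<in> mor A (fst F n) (fst T n)" for n using T s[of n] s1[of n] by (simp add: \<psi>_def)
  have "\<psi> \<in> chain_maps A F T"
    unfolding chain_maps_iff
  proof (intro allI conjI psi_mor)
    fix n
    have ddT: "cmp A (fst T (n + 1)) (fst T n) (fst T (n - 1)) (snd T n) (snd T (n + 1)) = \<zero>\<^bsub>Hom A (fst T (n
        + 1)) (fst T (n - 1))\<^esub>"
      using complexesD(3)[OF T, of "n + 1"] by simp
    have 1: "cmp A (fst F n) (fst T n) (fst T (n - 1)) (snd T n) (cmp A (fst F n) (fst T (n + 1)) (fst T n)
        (snd T (n + 1)) (s n)) = \<zero>\<^bsub>Hom A (fst F n) (fst T (n - 1))\<^esub>"
      using T s[of n] ddT by (simp flip: cmp_assoc)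
    have s2: "s (n - 2) \<in> mor A (fst F (n - 2)) (fst T (n - 1))" using s1[of "n - 1"] by simp
    have 2: "cmp A (fst F n) (fst F (n - 1)) (fst T (n - 1)) (cmp A (fst F (n - 1)) (fst F (n - 2)) (fst T
        (n - 1)) (s (n - 2)) (snd F (n - 1))) (snd F n) = \<zero>\<^bsub>Hom A (fst F n) (fst T (n - 1))\<^esub>"
      using T s2 d1[of n] by (simp add: cmp_assoc)
    show "cmp A (fst F n) (fst T n) (fst T (n - 1)) (snd T n) (\<psi> n) = cmp A (fst F n) (fst F (n - 1)) (fst T
        (n - 1)) (\<psi> (n - 1)) (snd F n)"
      using T s[of n] s1[of n] s2 1 2 d1[of n] by (simp add: \<psi>_def cmp_add_left cmp_add_right) (simp add:
          cmp_assoc)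
  qed
  then have phi_chain: "f \<ominus>\<^bsub>Hom (Ch A) F T\<^esub> \<psi> \<in> chain_maps A F T"
    using Ch.minus_mor[of f F T \<psi>] f T by simp
  define \<phi> where "\<phi> n = f n \<ominus>\<^bsub>Hom A (fst F n) (fst T n)\<^esub> \<psi> n" for n
  have phi: "\<phi> \<in> chain_maps A F T"
    using phi_chain f T \<open>\<psi> \<in> chain_maps A F T\<close> by (simp add: Ch_minus \<phi>_def[abs_def])
  have psi_iota: "cmp A (\<gamma> n b) (fst F n) (fst T n) (\<psi> n) (\<iota> n b) =
        cmp A (\<gamma> n b) (fst T (n + 1)) (fst T n) (snd T (n + 1)) (cmp A (\<gamma> n b) (fst F n) (fst T (n + 1)) (s
            n) (\<iota> n b))
        \<oplus>\<^bsub>Hom A (\<gamma> n b) (fst T n)\<^esub> cmp A (\<gamma> n b) (fst F (n - 1)) (fst T n) (s (n - 1)) (bd n b)" if "b \<in> B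
            n" for n b
    using that s[of n] s1[of n] T by (simp add: \<psi>_def cmp_add_left cmp_assoc bd_def)
  have phi_D: "cmp A (\<gamma> n b) (fst F n) (fst T n) (\<phi> n) (\<iota> n b) = \<zero>\<^bsub>Hom A (\<gamma> n b) (fst T n)\<^esub>" if b: "b \<in> D n"
      for n b
    using DB[OF b] fD[OF b] psi_iota[OF DB[OF b]] f T s[of n] s1[of n]
    by (simp add: \<phi>_def minus_cmp minus_eq_zero_iff)
  \<comment> \<open>Although \<open>j\<close> need not be a chain map, \<open>\<phi> j\<close> is
    one: the failure of \<open>j\<close> lies in \<open>D\<close>, where \<open>\<phi>\<close>
    vanishes.\<close>
  have phij: "(\<lambda>n. cmp A (S n) (fst F n) (fst T n) (\<phi> n) (j n)) \<in> chain_maps A (S, dS) T"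
    unfolding chain_maps_iff fst_conv snd_conv
  proof (intro allI conjI)
    fix n
    show "cmp A (S n) (fst T n) (fst T (n - 1)) (snd T n) (cmp A (S n) (fst F n) (fst T n) (\<phi> n) (j n)) =
      cmp A (S n) (S (n - 1)) (fst T (n - 1)) (cmp A (S (n - 1)) (fst F (n - 1)) (fst T (n - 1)) (\<phi> (n - 1))
          (j (n - 1))) (dS n)"
    proof (rule coproduct_ext[OF S(3) _ Co])
      fix b assume b: "b \<in> C n"
      have "cmp A (\<gamma> n b) (S n) (fst T (n - 1)) (cmp A (S n) (fst T n) (fst T (n - 1)) (snd T n) (cmp A (S
          n) (fst F n) (fst T n) (\<phi> n) (j n))) (\<kappa> n b)
        = cmp A (\<gamma> n b) (fst F (n - 1)) (fst T (n - 1)) (\<phi> (n - 1)) (bd n b)"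
        using b CB'[OF b] T phi S(7)[OF b] by (simp add: cmp_assoc chain_maps_comm_extend[OF phi] bd_def)
      also have "\<dots> = cmp A (\<gamma> n b) (fst F (n - 1)) (fst T (n - 1)) (\<phi> (n - 1)) (cmp A (\<gamma> n b) (S (n - 1))
          (fst F (n - 1)) (j (n - 1)) (cmp A (\<gamma> n b) (S n) (S (n - 1)) (dS n) (\<kappa> n b)))"
        by (rule jr_agree[OF b, symmetric]) (use T phi phi_D in auto)
      finally show "cmp A (\<gamma> n b) (S n) (fst T (n - 1)) (cmp A (S n) (fst T n) (fst T (n - 1)) (snd T n)
          (cmp A (S n) (fst F n) (fst T n) (\<phi> n) (j n))) (\<kappa> n b) =
        cmp A (\<gamma> n b) (S n) (fst T (n - 1)) (cmp A (S n) (S (n - 1)) (fst T (n - 1)) (cmp A (S (n - 1)) (fst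
            F (n - 1)) (fst T (n - 1)) (\<phi> (n - 1)) (j (n - 1))) (dS n)) (\<kappa> n b)"
        using b CB'[OF b] T phi by (simp add: cmp_assoc)
    qed (use T phi in auto)
  qed (use T phi in auto)
  from null[OF gen phij] obtain t where t: "\<And>n. t n \<in> mor A (S n) (fst T (n + 1))"
    and phij_t: "\<And>n. cmp A (S n) (fst F n) (fst T n) (\<phi> n) (j n) = cmp A (S n) (fst T (n + 1)) (fst T n)
        (snd T (n + 1)) (t n)
        \<oplus>\<^bsub>Hom A (S n) (fst T n)\<^esub> cmp A (S n) (S (n - 1)) (fst T n) (t (n - 1)) (dS n)"
    unfolding null_homotopic_iff fst_conv snd_conv by blast
  have t1: "t (n - 1) \<in> mor A (S (n - 1)) (fst T n)" for n using t[of "n - 1"] by simp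
  \<comment> \<open>The correction \<open>t r\<close> vanishes on \<open>D\<close>, so the homotopy
    constructed so far is left unchanged there.\<close>
  define s' where "s' n = s n \<oplus>\<^bsub>Hom A (fst F n) (fst T (n + 1))\<^esub> cmp A (fst F n) (S n) (fst T (n + 1)) (t n)
      (r n)" for n
  have s': "s' n \<in> mor A (fst F n) (fst T (n + 1))" for n using s[of n] t[of n] T by (simp add: s'_def)
  have s'_iota: "cmp A (\<gamma> n b) (fst F n) (fst T (n + 1)) (s' n) (\<iota> n b) = cmp A (\<gamma> n b) (fst F n) (fst T (n
      + 1)) (s n) (\<iota> n b)
      \<oplus>\<^bsub>Hom A (\<gamma> n b) (fst T (n + 1))\<^esub> cmp A (\<gamma> n b) (S n) (fst T (n + 1)) (t n) (cmp A (\<gamma> n b) (fst F n) (S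
          n) (r n) (\<iota> n b))" if "b \<in> B n" for n b
    using that s[of n] t[of n] T by (simp add: s'_def cmp_add_left cmp_assoc)
  have s'_bd: "cmp A (\<gamma> n b) (fst F (n - 1)) (fst T n) (s' (n - 1)) (bd n b) = cmp A (\<gamma> n b) (fst F (n - 1))
      (fst T n) (s (n - 1)) (bd n b)
      \<oplus>\<^bsub>Hom A (\<gamma> n b) (fst T n)\<^esub> cmp A (\<gamma> n b) (S (n - 1)) (fst T n) (t (n - 1)) (cmp A (\<gamma> n b) (fst F (n -
          1)) (S (n - 1)) (r (n - 1)) (bd n b))" if "b \<in> B n" for n b
    using that s1[of n] t1[of n] T by (simp add: s'_def cmp_add_left cmp_assoc)
  have s'_D: "cmp A (\<gamma> n b) (fst F n) (fst T (n + 1)) (s' n) (\<iota> n b) = cmp A (\<gamma> n b) (fst F n) (fst T (n +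
      1)) (s n) (\<iota> n b)"
    if b: "b \<in> D n" for n b
    using DB[OF b] r_D[OF b] s'_iota[OF DB[OF b]] s[of n] t[of n] T by simp
  show ?thesis
  proof (rule that)
    show "contracts T f (\<lambda>n. D n \<union> C n) s'"
      unfolding contracts_def
    proof (intro conjI allI ballI)
      show "closed (\<lambda>n. D n \<union> C n)"
        using clD CB depC unfolding closed_def by blast
      show "s' n \<in> mor A (fst F n) (fst T (n + 1))" for n by (rule s')
      fix n b assume bDC: "b \<in> D n \<union> C n"
      show "cmp A (\<gamma> n b) (fst F n) (fst T n) (f n) (\<iota> n b) =
        cmp A (\<gamma> n b) (fst T (n + 1)) (fst T n) (snd T (n + 1)) (cmp A (\<gamma> n b) (fst F n) (fst T (n + 1)) (s'
            n) (\<iota> n b))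
        \<oplus>\<^bsub>Hom A (\<gamma> n b) (fst T n)\<^esub> cmp A (\<gamma> n b) (fst F (n - 1)) (fst T n) (s' (n - 1)) (bd n b)"
      proof (cases "b \<in> D n")
        case True
        then show ?thesis
          using DB[OF True] fD[OF True] s'_D[OF True] s'_bd[OF DB[OF True]] r_bd[OF True] s1[of n] t1[of n]
              T by simp
      next
        case False
        then have b: "b \<in> C n" using bDC by simp
        interpret H: abelian_group "Hom A (\<gamma> n b) (fst T n)" using Hom_group CB'[OF b] T by simp
        let ?ds = "cmp A (\<gamma> n b) (fst T (n + 1)) (fst T n) (snd T (n + 1)) (cmp A (\<gamma> n b) (fst F n) (fst T
            (n + 1)) (s n) (\<iota> n b))"
        let ?sd = "cmp A (\<gamma> n b) (fst F (n - 1)) (fst T n) (s (n - 1)) (bd n b)"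
        let ?dt = "cmp A (\<gamma> n b) (fst T (n + 1)) (fst T n) (snd T (n + 1)) (cmp A (\<gamma> n b) (S n) (fst T (n +
            1)) (t n) (\<kappa> n b))"
        let ?td = "cmp A (\<gamma> n b) (S (n - 1)) (fst T n) (t (n - 1)) (cmp A (\<gamma> n b) (fst F (n - 1)) (S (n -
            1)) (r (n - 1)) (bd n b))"
        have cl: "?ds \<in> mor A (\<gamma> n b) (fst T n)" "?sd \<in> mor A (\<gamma> n b) (fst T n)" "?dt \<in> mor A (\<gamma> n b) (fst T
            n)" "?td \<in> mor A (\<gamma> n b) (fst T n)"
          using b CB'[OF b] s[of n] s1[of n] t[of n] t1[of n] T by simp_all
        have "cmp A (\<gamma> n b) (fst F n) (fst T n) (\<phi> n) (\<iota> n b) = cmp A (\<gamma> n b) (S n) (fst T n) (cmp A (S n)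
            (fst F n) (fst T n) (\<phi> n) (j n)) (\<kappa> n b)"
          using b CB'[OF b] phi T S(7)[OF b] by (simp add: cmp_assoc)
        also have "\<dots> = ?dt \<oplus>\<^bsub>Hom A (\<gamma> n b) (fst T n)\<^esub> ?td"
          using b CB'[OF b] T t[of n] t1[of n] dS_kappa[OF b] by (simp add: phij_t cmp_add_left cmp_assoc)
        finally have 1: "cmp A (\<gamma> n b) (fst F n) (fst T n) (\<phi> n) (\<iota> n b) = ?dt \<oplus>\<^bsub>Hom A (\<gamma> n b) (fst T n)\<^esub>
            ?td" .
        have fm: "cmp A (\<gamma> n b) (fst F n) (fst T n) (f n) (\<iota> n b) \<in> mor A (\<gamma> n b) (fst T n)"
          using CB'[OF b] f T by simp
        have "cmp A (\<gamma> n b) (fst F n) (fst T n) (\<phi> n) (\<iota> n b) = cmp A (\<gamma> n b) (fst F n) (fst T n) (f n) (\<iota> n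
            b)
            \<ominus>\<^bsub>Hom A (\<gamma> n b) (fst T n)\<^esub> (?ds \<oplus>\<^bsub>Hom A (\<gamma> n b) (fst T n)\<^esub> ?sd)"
          using CB'[OF b] f T psi_iota[OF CB'[OF b]] by (simp add: \<phi>_def minus_cmp)
        \<comment> \<open>On a new basis element \<open>f\<close> is the sum of
          \<open>\<phi>\<close>, contracted by \<open>t\<close>, and \<open>\<psi>\<close>,
          contracted by \<open>s\<close>; the four terms are then regrouped into those of
          \<open>s'\<close>.\<close>
        then have "cmp A (\<gamma> n b) (fst F n) (fst T n) (f n) (\<iota> n b) =
            (?dt \<oplus>\<^bsub>Hom A (\<gamma> n b) (fst T n)\<^esub> ?td) \<oplus>\<^bsub>Hom A (\<gamma> n b) (fst T n)\<^esub> (?ds \<oplus>\<^bsub>Hom A (\<gamma> n b) (fst T n)\<^esub>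
                ?sd)"
          unfolding 1 using cl fm by (simp add: a_minus_def H.a_assoc H.l_neg)
        also have "\<dots> = (?ds \<oplus>\<^bsub>Hom A (\<gamma> n b) (fst T n)\<^esub> ?dt) \<oplus>\<^bsub>Hom A (\<gamma> n b) (fst T n)\<^esub> (?sd \<oplus>\<^bsub>Hom A (\<gamma> n b)
            (fst T n)\<^esub> ?td)"
          using cl by (simp add: H.a_ac)
        finally show ?thesis
          using b CB'[OF b] s[of n] t[of n] T s'_iota[OF CB'[OF b]] s'_bd[OF CB'[OF b]] r_C[OF b] by (simp
              add: cmp_add_right)
      qed
    qed
    show "D n \<subseteq> D n \<union> C n" for n by blast
    show "b0 \<in> D m \<union> C m" using E(2)[of m] by (simp add: C_def)
  qed (rule s'_D)
qed

text \<open>Homotopies that agree on \<open>D\<close> have to be identified, and the graph retains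
  exactly this restriction. Inclusion of graphs then says that the part of the basis grows and the
  homotopy is extended.\<close>

definition graph_of :: "('o, 'm) complex \<Rightarrow> (int \<Rightarrow> 'u set) \<Rightarrow> (int \<Rightarrow> 'm) \<Rightarrow> ((int \<times> 'u) \<times> 'm) set" where
  "graph_of T D s = {((n, b), cmp A (\<gamma> n b) (fst F n) (fst T (n + 1)) (s n) (\<iota> n b)) | n b. b \<in> D n}"

text \<open>
  This is Eklof's lemma for the filtration of \<open>F\<close> by the subcomplexes spanned by closed subsets of
  the basis: Zorn's lemma is applied to the graphs of the contracting homotopies defined on them.
\<close>

lemma free_null_homotopic:
  assumes T: "T \<in> complexes A" and f: "f \<in> chain_maps A F T"
    and null: "\<And>S g. \<lbrakk>S \<in> gens; g \<in> chain_maps A S T\<rbrakk> \<Longrightarrow> g \<in> null_homotopic A S T"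
  shows "f \<in> null_homotopic A F T"
proof -
  define \<A> where "\<A> = {graph_of T D s | D s. contracts T f D s}"
  have "\<exists>M\<in>\<A>. \<forall>X\<in>\<A>. M \<subseteq> X \<longrightarrow> X = M"
  proof (rule Zorn_Lemma2, intro ballI)
    fix \<C> assume "\<C> \<in> chains \<A>"
    then have sub: "\<C> \<subseteq> \<A>" and lin: "\<And>X Y. \<lbrakk>X \<in> \<C>; Y \<in> \<C>\<rbrakk> \<Longrightarrow> X \<subseteq> Y \<or> Y \<subseteq> X"
      by (auto simp: chains_def chain_subset_def)
    \<comment> \<open>The union of a chain of graphs is again the graph of a function;
      \<open>D\<close> is its domain and \<open>v\<close> reads off its values.\<close>
    define U where "U = \<Union>\<C>"
    define D where "D n = {b. \<exists>x. ((n, b), x) \<in> U}" for n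
    define v where "v n b = (THE x. ((n, b), x) \<in> U)" for n b
    have member: "\<exists>D' s'. contracts T f D' s' \<and> graph_of T D' s' \<in> \<C> \<and> x = cmp A (\<gamma> n b) (fst F n) (fst T (n
        + 1)) (s' n) (\<iota> n b) \<and> b \<in> D' n"
      if x: "((n, b), x) \<in> U" for n b x
    proof -
      obtain X where X: "X \<in> \<C>" "((n, b), x) \<in> X" using x by (auto simp: U_def)
      then obtain D' s' where "contracts T f D' s'" "X = graph_of T D' s'" using sub by (auto simp: \<A>_def)
      then show ?thesis using X by (intro exI[of _ D'] exI[of _ s']) (auto simp: graph_of_def)
    qed
    have v: "v n b = x" if x: "((n, b), x) \<in> U" for n b x
      unfolding v_def
    proof (rule the_equality)
      show "((n, b), x) \<in> U" by (rule x)
      fix y assume y: "((n, b), y) \<in> U"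
      obtain X Y where X: "X \<in> \<C>" "((n, b), x) \<in> X" "Y \<in> \<C>" "((n, b), y) \<in> Y" using x y by (auto simp:
          U_def)
      then obtain Z where Z: "Z \<in> \<C>" "((n, b), x) \<in> Z" "((n, b), y) \<in> Z" using lin[of X Y] by blast
      then obtain D' s' where "Z = graph_of T D' s'" using sub by (auto simp: \<A>_def)
      then show "y = x" using Z by (auto simp: graph_of_def)
    qed
    have DB: "D n \<subseteq> B n" for n
    proof
      fix b assume "b \<in> D n"
      then obtain x where "((n, b), x) \<in> U" by (auto simp: D_def)
      then obtain D' s' where "contracts T f D' s'" "b \<in> D' n" using member by blast
      then show "b \<in> B n" using closedD(1)[of D' n] by (auto simp: contracts_def)
    qed
    \<comment> \<open>Zero is chosen off \<open>D\<close> so that the universal property yields a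
      map on the whole term. For the empty chain this gives the zero homotopy on the empty part,
      which bounds it.\<close>
    define g where "g n b = (if b \<in> D n then v n b else \<zero>\<^bsub>Hom A (\<gamma> n b) (fst T (n + 1))\<^esub>)" for n b
    have g: "g n b \<in> mor A (\<gamma> n b) (fst T (n + 1))" if b: "b \<in> B n" for n b
    proof (cases "b \<in> D n")
      case True
      then obtain x where x: "((n, b), x) \<in> U" by (auto simp: D_def)
      then obtain D' s' where "contracts T f D' s'" "x = cmp A (\<gamma> n b) (fst F n) (fst T (n + 1)) (s' n) (\<iota> n
          b)"
        using member by blast
      then show ?thesis using v[OF x] b True T by (auto simp: g_def contracts_def)
    qed (use b T in \<open>simp add: g_def\<close>)
    have "\<forall>n. \<exists>h. h \<in> mor A (fst F n) (fst T (n + 1)) \<and> (\<forall>b\<in>B n. cmp A (\<gamma> n b) (fst F n) (fst T (n + 1)) h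
        (\<iota> n b) = g n b)"
    proof
      fix n
      have "\<exists>!h. h \<in> mor A (fst F n) (fst T (n + 1)) \<and> (\<forall>b\<in>B n. cmp A (\<gamma> n b) (fst F n) (fst T (n + 1)) h (\<iota>
          n b) = g n b)"
        by (rule coproduct_ex1[OF coproduct]) (use g T in auto)
      then show "\<exists>h. h \<in> mor A (fst F n) (fst T (n + 1)) \<and> (\<forall>b\<in>B n. cmp A (\<gamma> n b) (fst F n) (fst T (n + 1))
          h (\<iota> n b) = g n b)"
        by (rule ex1_implies_ex)
    qed
    from choice[OF this] obtain s where s: "\<And>n. s n \<in> mor A (fst F n) (fst T (n + 1))"
      and s_iota: "\<And>n b. b \<in> B n \<Longrightarrow> cmp A (\<gamma> n b) (fst F n) (fst T (n + 1)) (s n) (\<iota> n b) = g n b" by blast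
    have s1: "s (n - 1) \<in> mor A (fst F (n - 1)) (fst T n)" for n using s[of "n - 1"] by simp
    have key: "cmp A (\<gamma> n b) (fst F n) (fst T (n + 1)) (s n) (\<iota> n b) = cmp A (\<gamma> n b) (fst F n) (fst T (n +
        1)) (s' n) (\<iota> n b) \<and> b \<in> D n"
      if "graph_of T D' s' \<in> \<C>" "b \<in> D' n" for D' s' n b
    proof -
      have x: "((n, b), cmp A (\<gamma> n b) (fst F n) (fst T (n + 1)) (s' n) (\<iota> n b)) \<in> U"
        unfolding U_def graph_of_def using that by (auto simp: graph_of_def intro!: bexI[OF _ that(1)])
      then have "b \<in> D n" by (auto simp: D_def)
      then show ?thesis using s_iota[of b n] DB v[OF x] by (auto simp: g_def)
    qed
    have "contracts T f D s"
      unfolding contracts_def closed_def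
    proof (intro conjI allI ballI DB s)
      fix n b assume b: "b \<in> D n"
      then obtain x where x: "((n, b), x) \<in> U" by (auto simp: D_def)
      then obtain D' s' where D': "contracts T f D' s'" "graph_of T D' s' \<in> \<C>" "b \<in> D' n" using member by
          blast
      have cl: "closed D'" and s'1: "s' (n - 1) \<in> mor A (fst F (n - 1)) (fst T n)"
        using D'(1) unfolding contracts_def by (auto dest: spec[of _ "n - 1"])
      show "dep n b \<subseteq> D (n - 1)"
        using closedD(2)[OF cl D'(3)] key[OF D'(2)] by blast
      \<comment> \<open>The equation at \<open>b\<close> also involves \<open>s\<close> on the
        boundary of \<open>b\<close>. One member of the chain serves for both, because its part
        \<open>D'\<close> is closed.\<close>
      have "cmp A (\<gamma> n b) (fst F (n - 1)) (fst T n) (s (n - 1)) (bd n b) = cmp A (\<gamma> n b) (fst F (n - 1))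
          (fst T n) (s' (n - 1)) (bd n b)"
      proof (rule bd_agree[OF _ closedD(2)[OF cl D'(3)]])
        fix c assume "c \<in> D' (n - 1)"
        then show "cmp A (\<gamma> (n - 1) c) (fst F (n - 1)) (fst T n) (s (n - 1)) (\<iota> (n - 1) c) =
          cmp A (\<gamma> (n - 1) c) (fst F (n - 1)) (fst T n) (s' (n - 1)) (\<iota> (n - 1) c)"
          using key[OF D'(2), of c "n - 1"] by simp
      qed (use b DB s1 s'1 T in auto)
      then show "cmp A (\<gamma> n b) (fst F n) (fst T n) (f n) (\<iota> n b) =
        cmp A (\<gamma> n b) (fst T (n + 1)) (fst T n) (snd T (n + 1)) (cmp A (\<gamma> n b) (fst F n) (fst T (n + 1)) (s
            n) (\<iota> n b))
        \<oplus>\<^bsub>Hom A (\<gamma> n b) (fst T n)\<^esub> cmp A (\<gamma> n b) (fst F (n - 1)) (fst T n) (s (n - 1)) (bd n b)"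
        using D'(1,3) key[OF D'(2,3)] unfolding contracts_def by simp
    qed
    then have "graph_of T D s \<in> \<A>" by (auto simp: \<A>_def)
    moreover have "X \<subseteq> graph_of T D s" if X: "X \<in> \<C>" for X
    proof -
      obtain D' s' where "X = graph_of T D' s'" using X sub by (auto simp: \<A>_def)
      then show ?thesis using key[of D' s'] X by (auto simp: graph_of_def)
    qed
    ultimately show "\<exists>U\<in>\<A>. \<forall>X\<in>\<C>. X \<subseteq> U" by blast
  qed
  then obtain M where M: "M \<in> \<A>" "\<And>X. \<lbrakk>X \<in> \<A>; M \<subseteq> X\<rbrakk> \<Longrightarrow> X = M" by auto
  from M(1) obtain D s where con: "contracts T f D s" and MD: "M = graph_of T D s" by (auto simp: \<A>_def)
  have max: "graph_of T D' s' = graph_of T D s"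
    if "contracts T f D' s'" "graph_of T D s \<subseteq> graph_of T D' s'" for D' s'
    unfolding MD[symmetric] by (rule M(2)) (use that MD in \<open>auto simp: \<A>_def\<close>)
  \<comment> \<open>A basis element missing from \<open>D\<close> could be adjoined by the successor
    step, against maximality.\<close>
  have full: "b \<in> D m" if b: "b \<in> B m" for b m
  proof -
    obtain D' s' where D': "contracts T f D' s'" "\<And>n. D n \<subseteq> D' n" "b \<in> D' m"
      "\<And>n b. b \<in> D n \<Longrightarrow> cmp A (\<gamma> n b) (fst F n) (fst T (n + 1)) (s' n) (\<iota> n b) = cmp A (\<gamma> n b) (fst F n) (fst
          T (n + 1)) (s n) (\<iota> n b)"
      by (rule contracts_extend[OF T f null con b]) simp_all
    have "graph_of T D s \<subseteq> graph_of T D' s'" using D'(2,4) by (fastforce simp: graph_of_def)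
    then have "graph_of T D' s' = graph_of T D s" by (rule max[OF D'(1)])
    moreover have "((m, b), cmp A (\<gamma> m b) (fst F m) (fst T (m + 1)) (s' m) (\<iota> m b)) \<in> graph_of T D' s'"
      using D'(3) by (auto simp: graph_of_def)
    ultimately show ?thesis by (auto simp: graph_of_def)
  qed
  have s: "s n \<in> mor A (fst F n) (fst T (n + 1))" for n using con by (simp add: contracts_def)
  have s1: "s (n - 1) \<in> mor A (fst F (n - 1)) (fst T n)" for n using s[of "n - 1"] by simp
  have "f n = cmp A (fst F n) (fst T (n + 1)) (fst T n) (snd T (n + 1)) (s n)
      \<oplus>\<^bsub>Hom A (fst F n) (fst T n)\<^esub> cmp A (fst F n) (fst F (n - 1)) (fst T n) (s (n - 1)) (snd F n)" for n
  proof (rule F_ext)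
    fix b assume b: "b \<in> B n"
    have "cmp A (\<gamma> n b) (fst F n) (fst T n) (f n) (\<iota> n b) =
        cmp A (\<gamma> n b) (fst T (n + 1)) (fst T n) (snd T (n + 1)) (cmp A (\<gamma> n b) (fst F n) (fst T (n + 1)) (s
            n) (\<iota> n b))
        \<oplus>\<^bsub>Hom A (\<gamma> n b) (fst T n)\<^esub> cmp A (\<gamma> n b) (fst F (n - 1)) (fst T n) (s (n - 1)) (bd n b)"
      using con full[OF b] by (simp add: contracts_def)
    then show "cmp A (\<gamma> n b) (fst F n) (fst T n) (f n) (\<iota> n b) =
      cmp A (\<gamma> n b) (fst F n) (fst T n) (cmp A (fst F n) (fst T (n + 1)) (fst T n) (snd T (n + 1)) (s n)
      \<oplus>\<^bsub>Hom A (fst F n) (fst T n)\<^esub> cmp A (fst F n) (fst F (n - 1)) (fst T n) (s (n - 1)) (snd F n)) (\<iota> n b)"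
      using b T s[of n] s1[of n] by (simp add: cmp_add_left cmp_assoc bd_def)
  qed (use f T s s1 in auto)
  then show ?thesis using f s unfolding null_homotopic_iff by blast
qed

end

section \<open>Maps from generators into coproducts\<close>

context free_complex
begin

text \<open>The closed countable part \<open>E\<close> around \<open>D\<close> spans a genuine
  subcomplex, so here \<open>j\<close> is a chain map, which \<open>r\<close> splits degreewise. The
  penultimate conclusion factors maps supported in \<open>D\<close> through \<open>j\<close>. The
  last one serves to show that only countably many components of a factorisation are
  nonzero.\<close>

lemma gens_subcomplex:
  assumes D: "\<And>n. D n \<subseteq> B n" "\<And>n. countable (D n)"
  obtains S j r where "S \<in> gens" "j \<in> chain_maps A S F" "\<And>n. r n \<in> mor A (fst F n) (fst S n)"
    "\<And>n. cmp A (fst S n) (fst F n) (fst S n) (r n) (j n) = idm A (fst S n)"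
    "\<And>n Y f. \<lbrakk>Y \<in> objs A; f \<in> mor A Y (fst F n); \<And>b. b \<in> B n \<Longrightarrow> b \<notin> D n \<Longrightarrow> cmp A Y (fst F n) (\<gamma> n b) (\<pi> n b) f
        = \<zero>\<^bsub>Hom A Y (\<gamma> n b)\<^esub>\<rbrakk> \<Longrightarrow>
       cmp A Y (fst S n) (fst F n) (j n) (cmp A Y (fst F n) (fst S n) (r n) f) = f"
    "\<forall>n. D n = {} \<Longrightarrow> j = (\<lambda>n. \<zero>\<^bsub>Hom A (fst S n) (fst F n)\<^esub>)"
proof -
  obtain E where E: "closed E" "\<And>n. D n \<subseteq> E n" "\<And>n. countable (E n)" "(\<forall>n. D n = {}) \<longrightarrow> (\<forall>n. E n = {})"
    by (rule countable_closure[OF D]) (rule that)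
  have EB: "E n \<subseteq> B n" for n by (rule closedD(1)[OF E(1)])
  then have EB': "b \<in> B n" if "b \<in> E n" for b n using that by blast
  have d1: "snd F (n - 1) \<in> mor A (fst F (n - 1)) (fst F (n - 2))" for n using complexesD(2)[OF F, of "n -
      1"] by simp
  have "\<forall>n. \<exists>Z \<kappa> j r. sub_std n (E n) Z \<kappa> j r" using sub_std_exists EB E(3) by simp
  then obtain S \<kappa> j r where "\<And>n. sub_std n (E n) (S n) (\<kappa> n) (j n) (r n)" by metis
  note S = sub_stdD[OF this]
  note [simp] = S(2) S(4) S(5) S(6)
  have Eo: "\<gamma> n ` E n \<subseteq> objs A" for n using EB gamma_objs by blast
  have jr_iota: "cmp A (\<gamma> n b) (fst F n) (fst F n) (cmp A (fst F n) (S n) (fst F n) (j n) (r n)) (\<iota> n b) =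
     cmp A (\<gamma> n b) (fst F n) (fst F n) (idm A (fst F n)) (\<iota> n b)" if "b \<in> E n" for n b
    using that EB'[OF that] S(7)[OF that] S(8)[of b n] by (simp add: cmp_assoc)
  define dS where "dS n = cmp A (S n) (fst F (n - 1)) (S (n - 1)) (r (n - 1)) (cmp A (S n) (fst F n) (fst F
      (n - 1)) (snd F n) (j n))" for n
  have dS [simp]: "dS n \<in> mor A (S n) (S (n - 1))" for n by (simp add: dS_def)
  have dS1: "dS (n - 1) \<in> mor A (S (n - 1)) (S (n - 2))" for n using dS[of "n - 1"] by simp
  \<comment> \<open>The boundary of an element of \<open>E\<close> is supported in \<open>E\<close>,
    where \<open>j r\<close> is the identity.\<close>
  have comm: "cmp A (S n) (fst F n) (fst F (n - 1)) (snd F n) (j n) = cmp A (S n) (S (n - 1)) (fst F (n -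
      1)) (j (n - 1)) (dS n)" for n
  proof (rule coproduct_ext[OF S(3) _ Eo])
    fix b assume b: "b \<in> E n"
    have "cmp A (\<gamma> n b) (S n) (fst F (n - 1)) (cmp A (S n) (S (n - 1)) (fst F (n - 1)) (j (n - 1)) (dS n))
        (\<kappa> n b)
      = cmp A (\<gamma> n b) (fst F (n - 1)) (fst F (n - 1)) (cmp A (fst F (n - 1)) (S (n - 1)) (fst F (n - 1)) (j
          (n - 1)) (r (n - 1))) (bd n b)"
      using b EB'[OF b] S(7)[OF b] by (simp add: dS_def cmp_assoc bd_def)
    also have "\<dots> = cmp A (\<gamma> n b) (fst F (n - 1)) (fst F (n - 1)) (idm A (fst F (n - 1))) (bd n b)"
      by (rule bd_agree[OF EB'[OF b] closedD(2)[OF E(1) b]]) (simp_all add: jr_iota)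
    finally show "cmp A (\<gamma> n b) (S n) (fst F (n - 1)) (cmp A (S n) (fst F n) (fst F (n - 1)) (snd F n) (j
        n)) (\<kappa> n b) =
      cmp A (\<gamma> n b) (S n) (fst F (n - 1)) (cmp A (S n) (S (n - 1)) (fst F (n - 1)) (j (n - 1)) (dS n)) (\<kappa> n
          b)"
      using b EB'[OF b] S(7)[OF b] by (simp add: cmp_assoc bd_def)
  qed simp_all
  have comm1: "cmp A (S (n - 1)) (fst F (n - 1)) (fst F (n - 2)) (snd F (n - 1)) (j (n - 1)) = cmp A (S (n -
      1)) (S (n - 2)) (fst F (n - 2)) (j (n - 2)) (dS (n - 1))" for n
    using comm[of "n - 1"] by simp
  have SC: "(S, dS) \<in> complexes A"
    unfolding complexes_iff fst_conv snd_conv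
  proof (intro allI conjI)
    fix n
    \<comment> \<open>The square of \<open>dS\<close> vanishes after composition with
      \<open>j\<close>, which has the left inverse \<open>r\<close> and can be cancelled.\<close>
    have "cmp A (S n) (S (n - 2)) (fst F (n - 2)) (j (n - 2)) (cmp A (S n) (S (n - 1)) (S (n - 2)) (dS (n -
        1)) (dS n))
      = cmp A (S n) (S (n - 1)) (fst F (n - 2)) (cmp A (S (n - 1)) (fst F (n - 1)) (fst F (n - 2)) (snd F (n
          - 1)) (j (n - 1))) (dS n)"
      using dS1[of n] by (simp add: comm1 cmp_assoc)
    also have "\<dots> = cmp A (S n) (fst F (n - 1)) (fst F (n - 2)) (snd F (n - 1)) (cmp A (S n) (fst F n) (fst F
        (n - 1)) (snd F n) (j n))"
      using d1[of n] by (simp add: comm cmp_assoc)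
    also have "\<dots> = \<zero>\<^bsub>Hom A (S n) (fst F (n - 2))\<^esub>"
      using d1[of n] by (simp flip: cmp_assoc)
    finally have "cmp A (S n) (fst F (n - 2)) (S (n - 2)) (r (n - 2)) (cmp A (S n) (S (n - 2)) (fst F (n -
        2)) (j (n - 2)) (cmp A (S n) (S (n - 1)) (S (n - 2)) (dS (n - 1)) (dS n))) = \<zero>\<^bsub>Hom A (S n) (S (n -
        2))\<^esub>"
      by simp
    then show "cmp A (S n) (S (n - 1)) (S (n - 2)) (dS (n - 1)) (dS n) = \<zero>\<^bsub>Hom A (S n) (S (n - 2))\<^esub>"
      using dS1[of n] S(9)[of "n - 2"] by (simp flip: cmp_assoc[of _ _ _ "j (n - 2)"])
  qed simp_all
  show ?thesis
  proof (rule that)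
    show "(S, dS) \<in> gens" using SC S(1) by (simp add: gens_def)
    show "j \<in> chain_maps A (S, dS) F" using comm by (simp add: chain_maps_iff)
    show "r n \<in> mor A (fst F n) (fst (S, dS) n)" for n by simp
    show "cmp A (fst (S, dS) n) (fst F n) (fst (S, dS) n) (r n) (j n) = idm A (fst (S, dS) n)" for n using
        S(9) by simp
    show "cmp A Y (fst (S, dS) n) (fst F n) (j n) (cmp A Y (fst F n) (fst (S, dS) n) (r n) f) = f"
      if Y: "Y \<in> objs A" "f \<in> mor A Y (fst F n)"
        and supp: "\<And>b. b \<in> B n \<Longrightarrow> b \<notin> D n \<Longrightarrow> cmp A Y (fst F n) (\<gamma> n b) (\<pi> n b) f = \<zero>\<^bsub>Hom A Y (\<gamma> n b)\<^esub>" for n Y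
            f
    proof -
      have "cmp A Y (fst F n) (fst F n) (cmp A (fst F n) (S n) (fst F n) (j n) (r n)) f = cmp A Y (fst F n)
          (fst F n) (idm A (fst F n)) f"
      proof (rule coproduct_support_agree[OF coproduct F_jm gamma_objs _ _ _ Y(1) Y(2), where D = "D n"])
        show "cmp A (\<gamma> n b) (fst F n) (fst F n) (cmp A (fst F n) (S n) (fst F n) (j n) (r n)) (\<iota> n b) =
         cmp A (\<gamma> n b) (fst F n) (fst F n) (idm A (fst F n)) (\<iota> n b)" if "b \<in> D n" for b
          by (rule jr_iota) (use that E(2) in blast)
      qed (use supp in simp_all)
      then show ?thesis using Y by (simp add: cmp_assoc)
    qed
    assume "\<forall>n. D n = {}"
    then have "\<forall>n. E n = {}" using E(4) by simp
    have "j n = \<zero>\<^bsub>Hom A (fst (S, dS) n) (fst F n)\<^esub>" for n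
      by (rule coproduct_ext[OF S(3)[of n] _ Eo, of "fst F n"]) (simp_all add: \<open>\<forall>n. E n = {}\<close>)
    then show "j = (\<lambda>n. \<zero>\<^bsub>Hom A (fst (S, dS) n) (fst F n)\<^esub>)" by (rule ext)
  qed
qed

end

context countably_generated
begin

section \<open>Free covers and coproducts of complexes\<close>

definition free_cover where
  "free_cover X F B \<gamma> \<iota> i p \<longleftrightarrow> free_complex A u G V F B \<gamma> \<iota> \<and> i \<in> chain_maps A X F \<and> p \<in> chain_maps A F X \<and>
     (\<forall>n. cmp A (fst X n) (fst F n) (fst X n) (p n) (i n) = idm A (fst X n))"

text \<open>
  The objects \<open>X\<^sub>n\<close> are retracts of free objects only degreewise; giving the latter the differential
  \<open>i d p\<close> makes the inclusions \<open>i\<close> and the retractions \<open>p\<close> chain maps.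
\<close>

lemma free_cover_exists:
  assumes X: "X \<in> complexes A"
  shows "\<exists>F B \<gamma> \<iota> i p. free_cover X F B \<gamma> \<iota> i p"
proof -
  define R where "R n I \<gamma> Z \<iota> i p \<longleftrightarrow> small u (I :: 'u set) \<and> \<gamma> ` I \<subseteq> G \<and> is_coproduct A I \<gamma> Z \<iota> \<and>
      i \<in> mor A (fst X n) Z \<and> p \<in> mor A Z (fst X n) \<and> cmp A (fst X n) Z (fst X n) p i = idm A (fst X n)" for
          n I \<gamma> Z \<iota> i p
  have "\<forall>n. \<exists>I \<gamma> Z \<iota> i p. R n I \<gamma> Z \<iota> i p" unfolding R_def using retract[OF complexesD(1)[OF X]] by blast
  then obtain B \<gamma> F \<iota> i p where R: "\<And>n. R n (B n) (\<gamma> n) (F n) (\<iota> n) (i n) (p n)" by metis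
  have i [simp]: "i n \<in> mor A (fst X n) (F n)" and p [simp]: "p n \<in> mor A (F n) (fst X n)"
    and pi: "cmp A (fst X n) (F n) (fst X n) (p n) (i n) = idm A (fst X n)"
    and cop: "is_coproduct A (B n) (\<gamma> n) (F n) (\<iota> n)" and sm: "small u (B n)" "\<gamma> n ` B n \<subseteq> G" for n
    using R[of n] by (auto simp: R_def)
  have Fo [simp]: "F n \<in> objs A" for n by (rule coproduct_obj[OF cop])
  have pi': "cmp A W (F n) (fst X n) (p n) (cmp A W (fst X n) (F n) (i n) k) = k" if "W \<in> objs A" "k \<in> mor A
      W (fst X n)" for W k n
    using that X pi[of n] by (simp flip: cmp_assoc)
  have d1: "snd X (n - 1) \<in> mor A (fst X (n - 1)) (fst X (n - 2))" for n using complexesD(2)[OF X, of "n -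
      1"] by simp
  have ddx: "cmp A W (fst X (n - 1)) (fst X (n - 2)) (snd X (n - 1)) (cmp A W (fst X n) (fst X (n - 1)) (snd
      X n) k) = \<zero>\<^bsub>Hom A W (fst X (n - 2))\<^esub>"
    if "W \<in> objs A" "k \<in> mor A W (fst X n)" for W k n
    using that X d1[of n] by (simp flip: cmp_assoc)
  define d where "d n = cmp A (F n) (fst X (n - 1)) (F (n - 1)) (i (n - 1)) (cmp A (F n) (fst X n) (fst X (n
      - 1)) (snd X n) (p n))" for n
  have d [simp]: "d n \<in> mor A (F n) (F (n - 1))" for n using X by (simp add: d_def)
  have "(F, d) \<in> complexes A"
    unfolding complexes_iff fst_conv snd_conv
  proof (intro allI conjI)
    fix n
    have "d (n - 1) = cmp A (F (n - 1)) (fst X (n - 2)) (F (n - 2)) (i (n - 2)) (cmp A (F (n - 1)) (fst X (n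
        - 1)) (fst X (n - 2)) (snd X (n - 1)) (p (n - 1)))"
      by (simp add: d_def)
    then show "cmp A (F n) (F (n - 1)) (F (n - 2)) (d (n - 1)) (d n) = \<zero>\<^bsub>Hom A (F n) (F (n - 2))\<^esub>"
      using X d1[of n] by (simp add: d_def[of n] cmp_assoc pi' ddx)
  qed simp_all
  then have "free_complex A u G V (F, d) B \<gamma> \<iota>"
    using sm cop by unfold_locales auto
  moreover have "i \<in> chain_maps A X (F, d)" "p \<in> chain_maps A (F, d) X"
    using X by (simp_all add: chain_maps_iff d_def cmp_assoc pi' pi)
  ultimately show ?thesis using pi unfolding free_cover_def by (metis fst_conv)
qed

lemma coproduct_complex_exists:
  assumes "small u (I :: 'u set)" "X ` I \<subseteq> complexes A"
  obtains Z \<iota> where "Z \<in> complexes A" "\<And>n. is_coproduct A I (\<lambda>i. fst (X i) n) (fst Z n) (\<lambda>i. \<iota> i n)"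
    "\<And>i. i \<in> I \<Longrightarrow> \<iota> i \<in> chain_maps A (X i) Z"
proof -
  have "\<forall>n. \<exists>Z \<iota>. is_coproduct A I (\<lambda>i. fst (X i) n) Z \<iota>"
  proof
    fix n
    have "(\<lambda>i. fst (X i) n) ` I \<subseteq> objs A" using assms(2) by auto
    then show "\<exists>Z \<iota>. is_coproduct A I (\<lambda>i. fst (X i) n) Z \<iota>" using coproducts[OF assms(1)] by blast
  qed
  then obtain Z \<iota> where Z: "\<And>n. is_coproduct A I (\<lambda>i. fst (X i) n) (Z n) (\<iota> n)" by metis
  obtain d where "(Z, d) \<in> complexes A" "\<And>i. i \<in> I \<Longrightarrow> (\<lambda>n. \<iota> n i) \<in> chain_maps A (X i) (Z, d)"
    by (rule degreewise_coproduct_complex[OF assms(2), of Z "\<lambda>i n. \<iota> n i"]) (use Z in simp_all)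
  then show ?thesis using that[of "(Z, d)" "\<lambda>i n. \<iota> n i"] Z by simp
qed

lemma K_zero_mor [simp]: "\<lbrakk>X \<in> complexes A; Y \<in> complexes A\<rbrakk> \<Longrightarrow> \<zero>\<^bsub>Hom (K A) X Y\<^esub> \<in> mor (K A) X Y"
  using Ch.zero_mor[of X Y] by (simp add: hclass_zero del: Ch_simps(3))

section \<open>The factorisation behind perfectness and smallness\<close>

text \<open>The object \<open>ZY\<close> is split off a coproduct \<open>ZF\<close> of free
  complexes, where a map has components with supports. In each degree \<open>S\<close> has countably
  many basis elements, each with countable support, so the component at \<open>i\<close> lies in a
  countable subcomplex \<open>Q i\<close> of \<open>F i\<close>. The last conclusion says that
  \<open>f\<close> is \<open>f'\<close> followed by whichever map \<open>h\<close> restricts to the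
  \<open>a i\<close>; this leaves the users free to construct \<open>h\<close> in their own
  way.\<close>

lemma gens_factor:
  assumes I: "small u (I :: 'u set)" and Y: "Y ` I \<subseteq> complexes A" and ZY: "is_coproduct (K A) I Y ZY \<kappa>"
    and S: "S \<in> gens" and f: "f \<in> mor (K A) S ZY"
  obtains Q a W \<omega> f' where "\<And>i. i \<in> I \<Longrightarrow> Q i \<in> gens" "\<And>i. i \<in> I \<Longrightarrow> a i \<in> mor (K A) (Q i) (Y i)"
    "is_coproduct (K A) I Q W \<omega>" "f' \<in> mor (K A) S W" "countable {i\<in>I. a i \<noteq> \<zero>\<^bsub>Hom (K A) (Q i) (Y i)\<^esub>}"
    "\<And>h. \<lbrakk>h \<in> mor (K A) W ZY; \<And>i. i \<in> I \<Longrightarrow> cmp (K A) (Q i) W ZY h (\<omega> i) = cmp (K A) (Q i) (Y i) ZY (\<kappa> i) (a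
        i)\<rbrakk> \<Longrightarrow>
      f = cmp (K A) S W ZY h f'"
proof -
  have Yi: "Y i \<in> complexes A" if "i \<in> I" for i using Y that by blast
  have SC: "S \<in> complexes A" using S by (simp add: gens_def)
  have ZYC: "ZY \<in> complexes A" using coproduct_obj[OF ZY] by simp
  have \<kappa>: "i \<in> I \<Longrightarrow> \<kappa> i \<in> mor (K A) (Y i) ZY" for i by (rule coproduct_inj[OF ZY])
  have "\<forall>i. \<exists>F B \<gamma> \<iota> e p. i \<in> I \<longrightarrow> free_cover (Y i) F B \<gamma> \<iota> e p" using free_cover_exists Yi by blast
  then obtain F B \<gamma> \<iota> e p where fc: "\<And>i. i \<in> I \<Longrightarrow> free_cover (Y i) (F i) (B i) (\<gamma> i) (\<iota> i) (e i) (p i)" by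
      metis
  have fr: "free_complex A u G V (F i) (B i) (\<gamma> i) (\<iota> i)" and e: "e i \<in> chain_maps A (Y i) (F i)" and p: "p
      i \<in> chain_maps A (F i) (Y i)"
    and pe: "cmp (Ch A) (Y i) (F i) (Y i) (p i) (e i) = idm (Ch A) (Y i)" if "i \<in> I" for i
    using fc[OF that] by (simp_all add: free_cover_def)
  have Fi: "F i \<in> complexes A" if "i \<in> I" for i using free_complex.F[OF fr[OF that]] .
  then have FI: "F ` I \<subseteq> complexes A" by blast
  then have FIn: "(\<lambda>i. fst (F i) n) ` I \<subseteq> objs A" for n by auto
  obtain ZF \<mu> where ZFC: "ZF \<in> complexes A" and ZF: "\<And>n. is_coproduct A I (\<lambda>i. fst (F i) n) (fst ZF n) (\<lambda>i.
      \<mu> i n)"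
    and \<mu>: "\<And>i. i \<in> I \<Longrightarrow> \<mu> i \<in> chain_maps A (F i) ZF"
    using coproduct_complex_exists[OF I FI] by metis
  note ZF_K = degreewise_coproduct_K[OF FI ZFC ZF \<mu>]
  have YK: "Y ` I \<subseteq> objs (K A)" using Y by simp
  \<comment> \<open>The retractions of the single complexes pass to coproducts in \<open>K\<close>
    and make \<open>ZY\<close> a retract of \<open>ZF\<close> through \<open>En\<close> and
    \<open>P\<close>.\<close>
  obtain En where En: "En \<in> mor (K A) ZY ZF"
    "\<And>i. i \<in> I \<Longrightarrow> cmp (K A) (Y i) ZY ZF En (\<kappa> i) = cmp (K A) (Y i) (F i) ZF (hclass (F i) ZF (\<mu> i)) (hclass
        (Y i) (F i) (e i))"
    by (rule coproduct_ex[OF ZY, of ZF "\<lambda>i. cmp (K A) (Y i) (F i) ZF (hclass (F i) ZF (\<mu> i)) (hclass (Y i)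
        (F i) (e i))"])
      (use ZFC e \<mu> Yi Fi in auto)
  obtain P where P: "P \<in> mor (K A) ZF ZY"
    "\<And>i. i \<in> I \<Longrightarrow> cmp (K A) (F i) ZF ZY P (hclass (F i) ZF (\<mu> i)) = cmp (K A) (F i) (Y i) ZY (\<kappa> i) (hclass (F
        i) (Y i) (p i))"
    by (rule coproduct_ex[OF ZF_K, of ZY "\<lambda>i. cmp (K A) (F i) (Y i) ZY (\<kappa> i) (hclass (F i) (Y i) (p i))"])
      (use ZYC p \<kappa> Yi Fi in auto)
  have PE: "cmp (K A) ZY ZF ZY P En = idm (K A) ZY"
  proof (rule K.coproduct_ext[OF ZY _ YK])
    fix i assume i: "i \<in> I"
    have pe': "cmp (K A) (Y i) (F i) (Y i) (hclass (F i) (Y i) (p i)) (hclass (Y i) (F i) (e i)) = idm (K A)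
        (Y i)"
      using pe[OF i] e[OF i] p[OF i] Yi[OF i] Fi[OF i] by (simp add: idm_K del: Ch_simps)
    have "cmp (K A) (Y i) ZY ZY (cmp (K A) ZY ZF ZY P En) (\<kappa> i) = cmp (K A) (Y i) ZF ZY P (cmp (K A) (Y i)
        ZY ZF En (\<kappa> i))"
      using i P(1) En(1) \<kappa>[OF i] Yi[OF i] ZYC ZFC by (simp add: K.cmp_assoc)
    also have "\<dots> = cmp (K A) (Y i) (F i) ZY (cmp (K A) (F i) ZF ZY P (hclass (F i) ZF (\<mu> i))) (hclass (Y i)
        (F i) (e i))"
      unfolding En(2)[OF i]
      by (rule K.cmp_assoc[symmetric]) (use i P(1) \<mu> e Yi Fi ZYC ZFC in auto)
    also have "\<dots> = cmp (K A) (Y i) (Y i) ZY (\<kappa> i) (cmp (K A) (Y i) (F i) (Y i) (hclass (F i) (Y i) (p i))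
        (hclass (Y i) (F i) (e i)))"
      unfolding P(2)[OF i]
      by (rule K.cmp_assoc) (use i p e \<kappa> Yi Fi ZYC in auto)
    finally show "cmp (K A) (Y i) ZY ZY (cmp (K A) ZY ZF ZY P En) (\<kappa> i) = cmp (K A) (Y i) ZY ZY (idm (K A)
        ZY) (\<kappa> i)"
      unfolding pe' using \<kappa>[OF i] Yi[OF i] ZYC by simp
  qed (use P(1) En(1) ZYC ZFC in auto)
  have "cmp (K A) S ZY ZF En f \<in> mor (K A) S ZF" using En(1) f SC ZYC ZFC by simp
  \<comment> \<open>From here on an honest chain map is factored, not a homotopy class, so that
    degreewise supports are available.\<close>
  then obtain \<phi> where \<phi>: "\<phi> \<in> chain_maps A S ZF" and Ef: "cmp (K A) S ZY ZF En f = hclass S ZF \<phi>"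
    by (auto simp: mor_K)
  have f_eq: "f = cmp (K A) S ZF ZY P (hclass S ZF \<phi>)"
    using PE P(1) En(1) f SC ZYC ZFC by (simp flip: Ef K.cmp_assoc)
  have "\<forall>n. \<exists>C \<delta> \<sigma>. countable C \<and> \<delta> ` C \<subseteq> G \<and> is_coproduct A (C :: 'u set) \<delta> (fst S n) \<sigma>"
    using S std_objsE unfolding gens_def by (metis (mono_tags, lifting) mem_Collect_eq)
  then obtain C \<delta> \<sigma> where C: "\<And>n. countable (C n)" and \<delta>: "\<And>n. \<delta> n ` C n \<subseteq> G"
    and Sn: "\<And>n. is_coproduct A (C n :: 'u set) (\<delta> n) (fst S n) (\<sigma> n)" by metis
  have \<delta>o: "\<delta> n ` C n \<subseteq> objs A" for n using \<delta> G by blast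
  then have \<delta>o': "c \<in> C n \<Longrightarrow> \<delta> n c \<in> objs A" for c n by blast
  have \<sigma>: "c \<in> C n \<Longrightarrow> \<sigma> n c \<in> mor A (\<delta> n c) (fst S n)" for c n by (rule coproduct_inj[OF Sn])
  define \<pi> where "\<pi> n i = coproj A I (\<lambda>i. fst (F i) n) (fst ZF n) (\<lambda>i. \<mu> i n) i" for n i
  have \<pi>: "\<pi> n i \<in> mor A (fst ZF n) (fst (F i) n)" if "i \<in> I" for n i
    unfolding \<pi>_def by (rule coproj_mor[OF ZF FIn that])
  define \<tau> where "\<tau> n i c = cmp A (\<delta> n c) (fst ZF n) (fst (F i) n) (\<pi> n i) (cmp A (\<delta> n c) (fst S n) (fst ZF
      n) (\<phi> n) (\<sigma> n c))" for n i c
  have \<tau>: "\<tau> n i c \<in> mor A (\<delta> n c) (fst (F i) n)" if "i \<in> I" "c \<in> C n" for n i c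
    unfolding \<tau>_def using that \<pi> \<phi> \<sigma> \<delta>o' SC ZFC Fi by simp
  \<comment> \<open>The basis elements of \<open>F i\<close> met in degree \<open>n\<close> by the
    component of \<open>\<phi>\<close> at \<open>i\<close>: a countable union of countable
    sets.\<close>
  define D where "D i n = (\<Union>c\<in>C n. {b \<in> B i n. cmp A (\<delta> n c) (fst (F i) n) (\<gamma> i n b) (coproj A (B i n) (\<gamma> i
      n) (fst (F i) n) (\<iota> i n) b) (\<tau> n i c)
      \<noteq> \<zero>\<^bsub>Hom A (\<delta> n c) (\<gamma> i n b)\<^esub>})" for i n
  have D: "D i n \<subseteq> B i n" "countable (D i n)" if i: "i \<in> I" for i n
  proof -
    interpret Fi: free_complex A u G V "F i" "B i" "\<gamma> i" "\<iota> i" by (rule fr[OF i])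
    show "D i n \<subseteq> B i n" by (auto simp: D_def)
    show "countable (D i n)" unfolding D_def
    proof (rule countable_UN[OF C])
      fix c assume c: "c \<in> C n"
      show "countable {b \<in> B i n. cmp A (\<delta> n c) (fst (F i) n) (\<gamma> i n b) (coproj A (B i n) (\<gamma> i n) (fst (F i)
          n) (\<iota> i n) b) (\<tau> n i c)
        \<noteq> \<zero>\<^bsub>Hom A (\<delta> n c) (\<gamma> i n b)\<^esub>}"
        by (rule coproduct_cs[OF Fi.small_B Fi.gamma_objs Fi.coproduct]) (use c \<delta> \<tau>[OF i c] in auto)
    qed
  qed
  define sub where "sub i Q j r \<longleftrightarrow> Q \<in> gens \<and> j \<in> chain_maps A Q (F i) \<and> (\<forall>n. r n \<in> mor A (fst (F i) n) (fst
      Q n)) \<and>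
    (\<forall>n. cmp A (fst Q n) (fst (F i) n) (fst Q n) (r n) (j n) = idm A (fst Q n)) \<and>
    (\<forall>n. \<forall>c\<in>C n. cmp A (\<delta> n c) (fst Q n) (fst (F i) n) (j n) (cmp A (\<delta> n c) (fst (F i) n) (fst Q n) (r n) (\<tau>
        n i c)) = \<tau> n i c) \<and>
    ((\<forall>n. D i n = {}) \<longrightarrow> j = (\<lambda>n. \<zero>\<^bsub>Hom A (fst Q n) (fst (F i) n)\<^esub>))" for i Q j r
  have "\<exists>Q j r. sub i Q j r" if i: "i \<in> I" for i
  proof -
    interpret Fi: free_complex A u G V "F i" "B i" "\<gamma> i" "\<iota> i" by (rule fr[OF i])
    show ?thesis
    proof (rule Fi.gens_subcomplex[OF D[OF i]])
      fix Q j r assume Q: "Q \<in> gens" "j \<in> chain_maps A Q (F i)" "\<And>n. r n \<in> mor A (fst (F i) n) (fst Q n)"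
        "\<And>n. cmp A (fst Q n) (fst (F i) n) (fst Q n) (r n) (j n) = idm A (fst Q n)"
        and supp: "\<And>n Y f. \<lbrakk>Y \<in> objs A; f \<in> mor A Y (fst (F i) n); \<And>b. b \<in> B i n \<Longrightarrow> b \<notin> D i n \<Longrightarrow> cmp A Y (fst
            (F i) n) (\<gamma> i n b) (Fi.\<pi> n b) f = \<zero>\<^bsub>Hom A Y (\<gamma> i n b)\<^esub>\<rbrakk> \<Longrightarrow>
         cmp A Y (fst Q n) (fst (F i) n) (j n) (cmp A Y (fst (F i) n) (fst Q n) (r n) f) = f"
        and j0: "\<forall>n. D i n = {} \<Longrightarrow> j = (\<lambda>n. \<zero>\<^bsub>Hom A (fst Q n) (fst (F i) n)\<^esub>)"
      have "cmp A (\<delta> n c) (fst Q n) (fst (F i) n) (j n) (cmp A (\<delta> n c) (fst (F i) n) (fst Q n) (r n) (\<tau> n i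
          c)) = \<tau> n i c"
        if c: "c \<in> C n" for n c
        by (rule supp[OF \<delta>o'[OF c] \<tau>[OF i c]]) (use c in \<open>auto simp: D_def\<close>)
      then show "\<exists>Q j r. sub i Q j r" using Q j0 unfolding sub_def by blast
    qed
  qed
  then have "\<forall>i. \<exists>Q j r. i \<in> I \<longrightarrow> sub i Q j r" by blast
  then obtain Q j r where "\<And>i. i \<in> I \<Longrightarrow> sub i (Q i) (j i) (r i)" by metis
  then have Q: "\<And>i. i \<in> I \<Longrightarrow> Q i \<in> gens" and j: "\<And>i. i \<in> I \<Longrightarrow> j i \<in> chain_maps A (Q i) (F i)"
    and r: "\<And>i n. i \<in> I \<Longrightarrow> r i n \<in> mor A (fst (F i) n) (fst (Q i) n)"
    and rj: "\<And>i n. i \<in> I \<Longrightarrow> cmp A (fst (Q i) n) (fst (F i) n) (fst (Q i) n) (r i n) (j i n) = idm A (fst (Q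
        i) n)"
    and jr: "\<And>i n c. i \<in> I \<Longrightarrow> c \<in> C n \<Longrightarrow> cmp A (\<delta> n c) (fst (Q i) n) (fst (F i) n) (j i n) (cmp A (\<delta> n c) (fst
        (F i) n) (fst (Q i) n) (r i n) (\<tau> n i c)) = \<tau> n i c"
    and j0: "\<And>i. i \<in> I \<Longrightarrow> \<forall>n. D i n = {} \<Longrightarrow> j i = (\<lambda>n. \<zero>\<^bsub>Hom A (fst (Q i) n) (fst (F i) n)\<^esub>)"
    unfolding sub_def by blast+
  have Qi: "Q i \<in> complexes A" if "i \<in> I" for i using Q[OF that] by (simp add: gens_def)
  then have QI: "Q ` I \<subseteq> complexes A" by blast
  then have QIn: "(\<lambda>i. fst (Q i) n) ` I \<subseteq> objs A" for n by auto
  obtain W \<nu> where WC: "W \<in> complexes A" and W: "\<And>n. is_coproduct A I (\<lambda>i. fst (Q i) n) (fst W n) (\<lambda>i. \<nu> i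
      n)"
    and \<nu>: "\<And>i. i \<in> I \<Longrightarrow> \<nu> i \<in> chain_maps A (Q i) W"
    using coproduct_complex_exists[OF I QI] by metis
  note W_K = degreewise_coproduct_K[OF QI WC W \<nu>]
  obtain J where J: "J \<in> chain_maps A W ZF" "\<And>i. i \<in> I \<Longrightarrow> cmp (Ch A) (Q i) W ZF J (\<nu> i) = cmp (Ch A) (Q i) (F
      i) ZF (\<mu> i) (j i)"
    by (rule degreewise_coproduct_ex[OF QI WC W \<nu> ZFC, of "\<lambda>i. cmp (Ch A) (Q i) (F i) ZF (\<mu> i) (j i)"]) (use
        \<mu> j Qi Fi ZFC in auto)
  have J\<nu>: "cmp A (fst (Q i) n) (fst W n) (fst ZF n) (J n) (\<nu> i n) = cmp A (fst (Q i) n) (fst (F i) n) (fst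
      ZF n) (\<mu> i n) (j i n)" if "i \<in> I" for i n
    using J(2)[OF that] by (simp add: fun_eq_iff)
  \<comment> \<open>The degreewise retractions \<open>r i\<close> glue to a degreewise retraction
    \<open>q\<close> of \<open>J\<close>, which need not be a chain map.\<close>
  have "\<forall>n. \<exists>q. q \<in> mor A (fst ZF n) (fst W n) \<and> (\<forall>i\<in>I. cmp A (fst (F i) n) (fst ZF n) (fst W n) q (\<mu> i n) =
      cmp A (fst (F i) n) (fst (Q i) n) (fst W n) (\<nu> i n) (r i n))"
    by (rule allI, rule ex1_implies_ex, rule coproduct_ex1[OF ZF]) (use r \<nu> Qi Fi WC in auto)
  from choice[OF this] obtain q where q: "\<And>n. q n \<in> mor A (fst ZF n) (fst W n)"
    and q\<mu>: "\<And>n i. i \<in> I \<Longrightarrow> cmp A (fst (F i) n) (fst ZF n) (fst W n) (q n) (\<mu> i n) = cmp A (fst (F i) n) (fst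
        (Q i) n) (fst W n) (\<nu> i n) (r i n)"
    by blast
  have qJ: "cmp A (fst W n) (fst ZF n) (fst W n) (q n) (J n) = idm A (fst W n)" for n
  proof (rule coproduct_ext[OF W _ QIn])
    fix i assume i: "i \<in> I"
    have "cmp A (fst (Q i) n) (fst W n) (fst W n) (cmp A (fst W n) (fst ZF n) (fst W n) (q n) (J n)) (\<nu> i n)
      = cmp A (fst (Q i) n) (fst (F i) n) (fst W n) (cmp A (fst (F i) n) (fst ZF n) (fst W n) (q n) (\<mu> i n))
          (j i n)"
      using i q[of n] J(1) \<nu>[OF i] \<mu>[OF i] j[OF i] Qi[OF i] Fi[OF i] WC ZFC by (simp add: cmp_assoc J\<nu>)
    also have "\<dots> = \<nu> i n"
      using i \<nu>[OF i] j[OF i] r[OF i, of n] Qi[OF i] Fi[OF i] WC rj[OF i, of n] by (simp add: q\<mu> cmp_assoc)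
    finally show "cmp A (fst (Q i) n) (fst W n) (fst W n) (cmp A (fst W n) (fst ZF n) (fst W n) (q n) (J n))
        (\<nu> i n)
      = cmp A (fst (Q i) n) (fst W n) (fst W n) (idm A (fst W n)) (\<nu> i n)"
      using i \<nu>[OF i] Qi[OF i] WC by simp
  qed (use q J(1) WC ZFC in auto)
  \<comment> \<open>The composite \<open>J q\<close> is diagonal, with entry \<open>j i\<close>
    after \<open>r i\<close> at the index \<open>i\<close>.\<close>
  have \<pi>Jq: "cmp A (fst ZF n) (fst ZF n) (fst (F i) n) (\<pi> n i) (cmp A (fst ZF n) (fst W n) (fst ZF n) (J n)
      (q n)) =
     cmp A (fst ZF n) (fst (F i) n) (fst (F i) n) (cmp A (fst (F i) n) (fst (Q i) n) (fst (F i) n) (j i n)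
         (r i n)) (\<pi> n i)" if i: "i \<in> I" for n i
  proof (rule coproduct_ext[OF ZF _ FIn])
    fix k assume k: "k \<in> I"
    have "cmp A (fst (F k) n) (fst ZF n) (fst (F i) n) (cmp A (fst ZF n) (fst ZF n) (fst (F i) n) (\<pi> n i)
        (cmp A (fst ZF n) (fst W n) (fst ZF n) (J n) (q n))) (\<mu> k n)
      = cmp A (fst (F k) n) (fst ZF n) (fst (F i) n) (\<pi> n i) (cmp A (fst (F k) n) (fst (Q k) n) (fst ZF n)
          (cmp A (fst (Q k) n) (fst W n) (fst ZF n) (J n) (\<nu> k n)) (r k n))"
      using i k \<pi>[OF i] q[of n] J(1) \<mu>[OF k] \<nu>[OF k] r[OF k, of n] Fi[OF k] Fi[OF i] Qi[OF k] ZFC WC by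
          (simp add: cmp_assoc q\<mu>)
    also have "\<dots> = cmp A (fst (F k) n) (fst (F k) n) (fst (F i) n) (cmp A (fst (F k) n) (fst ZF n) (fst (F
        i) n) (\<pi> n i) (\<mu> k n)) (cmp A (fst (F k) n) (fst (Q k) n) (fst (F k) n) (j k n) (r k n))"
      using i k \<pi>[OF i] J(1) \<mu>[OF k] \<nu>[OF k] j[OF k] r[OF k, of n] Fi[OF k] Fi[OF i] Qi[OF k] ZFC WC by
          (simp add: cmp_assoc J\<nu>)
    also have "\<dots> = cmp A (fst (F k) n) (fst (F i) n) (fst (F i) n) (cmp A (fst (F i) n) (fst (Q i) n) (fst
        (F i) n) (j i n) (r i n)) (cmp A (fst (F k) n) (fst ZF n) (fst (F i) n) (\<pi> n i) (\<mu> k n))"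
      using coproj_inj[OF ZF FIn i k, of n] i k j[OF k] r[OF k, of n] j[OF i] r[OF i, of n] Fi[OF k] Fi[OF
          i] Qi[OF k] Qi[OF i] by (simp add: \<pi>_def)
    finally show "cmp A (fst (F k) n) (fst ZF n) (fst (F i) n) (cmp A (fst ZF n) (fst ZF n) (fst (F i) n) (\<pi>
        n i) (cmp A (fst ZF n) (fst W n) (fst ZF n) (J n) (q n))) (\<mu> k n)
      = cmp A (fst (F k) n) (fst ZF n) (fst (F i) n) (cmp A (fst ZF n) (fst (F i) n) (fst (F i) n) (cmp A
          (fst (F i) n) (fst (Q i) n) (fst (F i) n) (j i n) (r i n)) (\<pi> n i)) (\<mu> k n)"
      using i k \<pi>[OF i] j[OF i] r[OF i, of n] \<mu>[OF k] Fi[OF k] Fi[OF i] Qi[OF i] ZFC by (simp add: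
          cmp_assoc)
  qed (use i \<pi> q J(1) r j Qi Fi WC ZFC in auto)
  define \<phi>' where "\<phi>' n = cmp A (fst S n) (fst ZF n) (fst W n) (q n) (\<phi> n)" for n
  have \<phi>'m [simp]: "\<phi>' n \<in> mor A (fst S n) (fst W n)" for n unfolding \<phi>'_def using q \<phi> SC ZFC WC by simp
  \<comment> \<open>By joint monicity the equation can be checked on components, where it holds
    because \<open>Q i\<close> was chosen to contain the support of each
    \<open>\<tau> n i c\<close>.\<close>
  have J\<phi>': "cmp A (fst S n) (fst W n) (fst ZF n) (J n) (\<phi>' n) = \<phi> n" for n
  proof (rule coproduct_ext[OF Sn _ \<delta>o])
    fix c assume c: "c \<in> C n"
    let ?x = "cmp A (\<delta> n c) (fst S n) (fst ZF n) (\<phi> n) (\<sigma> n c)"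
    have x: "?x \<in> mor A (\<delta> n c) (fst ZF n)" using c \<phi> \<sigma>[OF c] \<delta>o'[OF c] SC ZFC by simp
    have "cmp A (\<delta> n c) (fst ZF n) (fst ZF n) (cmp A (fst ZF n) (fst W n) (fst ZF n) (J n) (q n)) ?x = ?x"
    proof (rule coproduct_mor_eqI[OF ZF coproduct_jm[OF I FIn ZF] FIn])
      fix i assume i: "i \<in> I"
      have "cmp A (\<delta> n c) (fst ZF n) (fst (F i) n) (\<pi> n i) (cmp A (\<delta> n c) (fst ZF n) (fst ZF n) (cmp A (fst
          ZF n) (fst W n) (fst ZF n) (J n) (q n)) ?x)
        = cmp A (\<delta> n c) (fst ZF n) (fst (F i) n) (cmp A (fst ZF n) (fst ZF n) (fst (F i) n) (\<pi> n i) (cmp A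
            (fst ZF n) (fst W n) (fst ZF n) (J n) (q n))) ?x"
        by (rule cmp_assoc[symmetric]) (use x \<pi>[OF i] q[of n] J(1) \<delta>o'[OF c] Fi[OF i] ZFC WC in auto)
      also have "\<dots> = cmp A (\<delta> n c) (fst (F i) n) (fst (F i) n) (cmp A (fst (F i) n) (fst (Q i) n) (fst (F i)
          n) (j i n) (r i n)) (\<tau> n i c)"
        unfolding \<pi>Jq[OF i] \<tau>_def
        by (rule cmp_assoc) (use x \<pi>[OF i] j[OF i] r[OF i, of n] \<delta>o'[OF c] Fi[OF i] Qi[OF i] ZFC in auto)
      also have "\<dots> = \<tau> n i c"
        using jr[OF i c] \<tau>[OF i c] j[OF i] r[OF i, of n] \<delta>o'[OF c] Fi[OF i] Qi[OF i] by (simp add: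
            cmp_assoc)
      finally show "cmp A (\<delta> n c) (fst ZF n) (fst (F i) n) (coproj A I (\<lambda>i. fst (F i) n) (fst ZF n) (\<lambda>i. \<mu> i
          n) i)
          (cmp A (\<delta> n c) (fst ZF n) (fst ZF n) (cmp A (fst ZF n) (fst W n) (fst ZF n) (J n) (q n)) ?x) =
        cmp A (\<delta> n c) (fst ZF n) (fst (F i) n) (coproj A I (\<lambda>i. fst (F i) n) (fst ZF n) (\<lambda>i. \<mu> i n) i) ?x"
        by (simp add: \<pi>_def \<tau>_def)
    qed (use x q[of n] J(1) \<delta>o'[OF c] ZFC WC in auto)
    then show "cmp A (\<delta> n c) (fst S n) (fst ZF n) (cmp A (fst S n) (fst W n) (fst ZF n) (J n) (\<phi>' n)) (\<sigma> n
        c) = ?x"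
      using c q[of n] J(1) \<phi> \<sigma>[OF c] \<delta>o'[OF c] SC ZFC WC by (simp add: \<phi>'_def cmp_assoc)
  qed (use J(1) \<phi> SC ZFC WC in auto)
  \<comment> \<open>The map \<open>q \<phi>\<close> commutes with the differentials even if
    \<open>q\<close> does not: \<open>J\<close> and \<open>\<phi> = J \<phi>'\<close> do, and
    \<open>J\<close> can be cancelled.\<close>
  have \<phi>': "\<phi>' \<in> chain_maps A S W"
    unfolding chain_maps_iff
  proof (intro allI conjI \<phi>'m)
    fix n
    have "cmp A (fst S n) (fst W (n - 1)) (fst ZF (n - 1)) (J (n - 1)) (cmp A (fst S n) (fst W n) (fst W (n
        - 1)) (snd W n) (\<phi>' n))
      = cmp A (fst S n) (fst ZF n) (fst ZF (n - 1)) (snd ZF n) (\<phi> n)"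
      using J(1) SC WC ZFC chain_maps_comm_extend[OF J(1) WC ZFC \<phi>'m[of n]] by (simp add: J\<phi>')
    also have "\<dots> = cmp A (fst S n) (fst S (n - 1)) (fst ZF (n - 1)) (cmp A (fst S (n - 1)) (fst W (n - 1))
        (fst ZF (n - 1)) (J (n - 1)) (\<phi>' (n - 1))) (snd S n)"
      by (simp add: J\<phi>' chain_maps_comm[OF \<phi>])
    also have "\<dots> = cmp A (fst S n) (fst W (n - 1)) (fst ZF (n - 1)) (J (n - 1)) (cmp A (fst S n) (fst S (n -
        1)) (fst W (n - 1)) (\<phi>' (n - 1)) (snd S n))"
      by (rule cmp_assoc) (use J(1) SC WC ZFC in auto)
    finally have eq: "cmp A (fst S n) (fst W (n - 1)) (fst ZF (n - 1)) (J (n - 1)) (cmp A (fst S n) (fst W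
        n) (fst W (n - 1)) (snd W n) (\<phi>' n))
      = cmp A (fst S n) (fst W (n - 1)) (fst ZF (n - 1)) (J (n - 1)) (cmp A (fst S n) (fst S (n - 1)) (fst W
          (n - 1)) (\<phi>' (n - 1)) (snd S n))" .
    have cancel: "cmp A (fst S n) (fst ZF (n - 1)) (fst W (n - 1)) (q (n - 1)) (cmp A (fst S n) (fst W (n -
        1)) (fst ZF (n - 1)) (J (n - 1)) k) = k"
      if "k \<in> mor A (fst S n) (fst W (n - 1))" for k
      using that J(1) q[of "n - 1"] qJ[of "n - 1"] SC WC ZFC by (simp flip: cmp_assoc)
    show "cmp A (fst S n) (fst W n) (fst W (n - 1)) (snd W n) (\<phi>' n) = cmp A (fst S n) (fst S (n - 1)) (fst
        W (n - 1)) (\<phi>' (n - 1)) (snd S n)"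
      using arg_cong[OF eq, of "cmp A (fst S n) (fst ZF (n - 1)) (fst W (n - 1)) (q (n - 1))"] SC WC by
          (simp add: cancel)
  qed
  define a where "a i = hclass (Q i) (Y i) (cmp (Ch A) (Q i) (F i) (Y i) (p i) (j i))" for i
  show ?thesis
  proof (rule that)
    show "Q i \<in> gens" if "i \<in> I" for i by (rule Q[OF that])
    show "a i \<in> mor (K A) (Q i) (Y i)" if "i \<in> I" for i
      unfolding a_def using that p j Qi Fi Yi by (auto simp: mor_K)
    show "is_coproduct (K A) I Q W (\<lambda>i. hclass (Q i) W (\<nu> i))" by (rule W_K)
    show "hclass S W \<phi>' \<in> mor (K A) S W" using \<phi>' by simp
    \<comment> \<open>If all \<open>\<tau> n i c\<close> vanish for some \<open>i\<close>, then
      \<open>D i\<close> is empty, so \<open>j i\<close> and with it \<open>a i\<close> are zero.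
      For fixed \<open>n\<close> and \<open>c\<close> only countably many
      \<open>\<tau> n i c\<close> are nonzero, by countable supports in \<open>ZF\<close>.\<close>
    have "{i\<in>I. a i \<noteq> \<zero>\<^bsub>Hom (K A) (Q i) (Y i)\<^esub>} \<subseteq> (\<Union>n. \<Union>c\<in>C n. {i\<in>I. \<tau> n i c \<noteq> \<zero>\<^bsub>Hom A (\<delta> n c) (fst (F i)
        n)\<^esub>})"
    proof
      fix i assume i': "i \<in> {i\<in>I. a i \<noteq> \<zero>\<^bsub>Hom (K A) (Q i) (Y i)\<^esub>}"
      then have i: "i \<in> I" by simp
      interpret Fi: free_complex A u G V "F i" "B i" "\<gamma> i" "\<iota> i" by (rule fr[OF i])
      have "\<exists>n. \<exists>c\<in>C n. \<tau> n i c \<noteq> \<zero>\<^bsub>Hom A (\<delta> n c) (fst (F i) n)\<^esub>"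
      proof (rule ccontr)
        assume "\<not> ?thesis"
        then have "D i n = {}" for n
          using \<delta>o' Fi[OF i] by (auto simp: D_def)
        then have "j i = (\<lambda>n. \<zero>\<^bsub>Hom A (fst (Q i) n) (fst (F i) n)\<^esub>)" using j0[OF i] by simp
        then have "cmp (Ch A) (Q i) (F i) (Y i) (p i) (j i) = \<zero>\<^bsub>Hom (Ch A) (Q i) (Y i)\<^esub>"
          using p[OF i] Fi[OF i] Qi[OF i] Yi[OF i] by simp
        then have "a i = \<zero>\<^bsub>Hom (K A) (Q i) (Y i)\<^esub>" using Qi[OF i] Yi[OF i] by (simp add: a_def hclass_zero
            del: Ch_simps)
        then show False using i' by simp
      qed
      then show "i \<in> (\<Union>n. \<Union>c\<in>C n. {i\<in>I. \<tau> n i c \<noteq> \<zero>\<^bsub>Hom A (\<delta> n c) (fst (F i) n)\<^esub>})" using i by blast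
    qed
    moreover have "countable {i\<in>I. \<tau> n i c \<noteq> \<zero>\<^bsub>Hom A (\<delta> n c) (fst (F i) n)\<^esub>}" if c: "c \<in> C n" for n c
      unfolding \<tau>_def \<pi>_def
      by (rule coproduct_cs[OF I FIn ZF]) (use c \<delta> \<phi> \<sigma>[OF c] \<delta>o'[OF c] SC ZFC in auto)
    ultimately show "countable {i\<in>I. a i \<noteq> \<zero>\<^bsub>Hom (K A) (Q i) (Y i)\<^esub>}"
      using C by (meson countable_UN countable_subset countableI_type)
    fix h assume h: "h \<in> mor (K A) W ZY"
      and hi: "\<And>i. i \<in> I \<Longrightarrow> cmp (K A) (Q i) W ZY h (hclass (Q i) W (\<nu> i)) = cmp (K A) (Q i) (Y i) ZY (\<kappa> i) (a
          i)"
    \<comment> \<open>Both sides have the same restrictions to the summands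
      \<open>Q i\<close>.\<close>
    have hPJ: "h = cmp (K A) W ZF ZY P (hclass W ZF J)"
    proof (rule K.coproduct_ext[OF W_K])
      fix i assume i: "i \<in> I"
      have "cmp (K A) (Q i) W ZY (cmp (K A) W ZF ZY P (hclass W ZF J)) (hclass (Q i) W (\<nu> i))
        = cmp (K A) (Q i) ZF ZY P (cmp (K A) (Q i) W ZF (hclass W ZF J) (hclass (Q i) W (\<nu> i)))"
        by (rule K.cmp_assoc) (use i P(1) J(1) \<nu> Qi WC ZFC ZYC in auto)
      also have "\<dots> = cmp (K A) (Q i) ZF ZY P (cmp (K A) (Q i) (F i) ZF (hclass (F i) ZF (\<mu> i)) (hclass (Q i)
          (F i) (j i)))"
        using i J \<nu>[OF i] \<mu>[OF i] j[OF i] Qi[OF i] Fi[OF i] WC ZFC by (simp del: Ch_simps(5))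
      also have "\<dots> = cmp (K A) (Q i) (F i) ZY (cmp (K A) (F i) ZF ZY P (hclass (F i) ZF (\<mu> i))) (hclass (Q
          i) (F i) (j i))"
        by (rule K.cmp_assoc[symmetric]) (use i P(1) j \<mu> Qi Fi ZFC ZYC in auto)
      also have "\<dots> = cmp (K A) (Q i) (Y i) ZY (\<kappa> i) (cmp (K A) (Q i) (F i) (Y i) (hclass (F i) (Y i) (p i))
          (hclass (Q i) (F i) (j i)))"
        unfolding P(2)[OF i] by (rule K.cmp_assoc) (use i p j \<kappa> Qi Fi Yi ZYC in auto)
      also have "\<dots> = cmp (K A) (Q i) (Y i) ZY (\<kappa> i) (a i)"
        using i p[OF i] j[OF i] Qi[OF i] Fi[OF i] Yi[OF i] by (simp add: a_def del: Ch_simps(5))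
      finally show "cmp (K A) (Q i) W ZY h (hclass (Q i) W (\<nu> i)) = cmp (K A) (Q i) W ZY (cmp (K A) W ZF ZY
          P (hclass W ZF J)) (hclass (Q i) W (\<nu> i))"
        using hi[OF i] by simp
    qed (use h P(1) J(1) QI WC ZFC ZYC in auto)
    have "hclass S ZF \<phi> = cmp (K A) S W ZF (hclass W ZF J) (hclass S W \<phi>')"
      using J(1) \<phi>' SC WC ZFC by (simp add: J\<phi>')
    then have "f = cmp (K A) S ZF ZY P (cmp (K A) S W ZF (hclass W ZF J) (hclass S W \<phi>'))" using f_eq by
        simp
    also have "\<dots> = cmp (K A) S W ZY h (hclass S W \<phi>')"
      unfolding hPJ by (rule K.cmp_assoc[symmetric]) (use P(1) J(1) \<phi>' SC WC ZFC ZYC in auto)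
    finally show "f = cmp (K A) S W ZY h (hclass S W \<phi>')" .
  qed
qed

end

section \<open>Well generation\<close>

context countably_generated
begin

lemma K_has_small_coproducts: "has_small_coproducts u (K A)"
  unfolding has_small_coproducts_def
proof (intro allI impI)
  fix I :: "'u set" and X assume I: "small u I \<and> X ` I \<subseteq> objs (K A)"
  then have X: "X ` I \<subseteq> complexes A" by simp
  obtain Z \<iota> where Z: "Z \<in> complexes A" "\<And>n. is_coproduct A I (\<lambda>i. fst (X i) n) (fst Z n) (\<lambda>i. \<iota> i n)"
    "\<And>i. i \<in> I \<Longrightarrow> \<iota> i \<in> chain_maps A (X i) Z"
    by (rule coproduct_complex_exists[OF conjunct1[OF I] X]) (rule that)
  show "\<exists>Z \<iota>. is_coproduct (K A) I X Z \<iota>"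
    using degreewise_coproduct_K[OF X Z] by blast
qed

text \<open>The identity of \<open>X\<close> passes through a free cover, whose retraction onto
  \<open>X\<close> is null-homotopic; so it is zero in \<open>K\<close>. An object whose identity is
  zero has exactly one map to and from every object.\<close>

lemma gens_generate:
  assumes X: "X \<in> complexes A" and zero: "\<And>S. S \<in> gens \<Longrightarrow> mor (K A) S X = {\<zero>\<^bsub>Hom (K A) S X\<^esub>}"
  shows "zero_object (K A) X"
proof -
  have null: "g \<in> null_homotopic A S X" if S: "S \<in> gens" and g: "g \<in> chain_maps A S X" for S g
  proof -
    have SC: "S \<in> complexes A" using S by (simp add: gens_def)
    have "hclass S X g = \<zero>\<^bsub>Hom (K A) S X\<^esub>" using hclass_mor[OF g] zero[OF S] by simp
    then show ?thesis using hclass_eq_zero_iff[OF g SC X] hclass_zero[OF SC X] by simp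
  qed
  obtain F B \<gamma> \<iota> i p where fc: "free_cover X F B \<gamma> \<iota> i p" using free_cover_exists[OF X] by blast
  then interpret F: free_complex A u G V F B \<gamma> \<iota> by (simp add: free_cover_def)
  have i: "i \<in> chain_maps A X F" and p: "p \<in> chain_maps A F X" and pi: "cmp (Ch A) X F X p i = idm (Ch A) X"
    using fc by (simp_all add: free_cover_def)
  have "p \<in> null_homotopic A F X" by (rule F.free_null_homotopic[OF X p null])
  then have "idm (Ch A) X \<in> null_homotopic A X X"
    unfolding pi[symmetric] by (rule cmp_null[OF i _ X F.F X])
  moreover have id: "idm (Ch A) X \<in> chain_maps A X X" using Ch.idm_closed[of X] X by simp
  ultimately have id0: "idm (K A) X = hclass X X \<zero>\<^bsub>Hom (Ch A) X X\<^esub>"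
    unfolding idm_K using hclass_eq_zero_iff[OF id X X] by simp
  have z: "\<zero>\<^bsub>Hom (Ch A) Y Z\<^esub> \<in> chain_maps A Y Z" if "Y \<in> complexes A" "Z \<in> complexes A" for Y Z
    using Ch.zero_mor[of Y Z] that by simp
  show ?thesis
    unfolding zero_object_def
  proof (intro conjI ballI)
    show "X \<in> objs (K A)" using X by simp
    fix W assume "W \<in> objs (K A)"
    then have W: "W \<in> complexes A" by simp
    show "\<exists>!f. f \<in> mor (K A) W X"
    proof (rule ex1I)
      show "\<zero>\<^bsub>Hom (K A) W X\<^esub> \<in> mor (K A) W X" using X W by simp
      fix f assume f: "f \<in> mor (K A) W X"
      then obtain f0 where f0: "f = hclass W X f0" "f0 \<in> chain_maps A W X" by (auto simp: mor_K)
      have "f = cmp (K A) W X X (idm (K A) X) f" using f X W by simp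
      also have "\<dots> = hclass W X (cmp (Ch A) W X X \<zero>\<^bsub>Hom (Ch A) X X\<^esub> f0)"
        unfolding id0 f0(1) by (rule cmp_K[OF f0(2) z]) (use X W in simp_all)
      also have "\<dots> = \<zero>\<^bsub>Hom (K A) W X\<^esub>"
        using f0(2) X W by (simp add: hclass_zero del: Ch_simps(3,4,5))
      finally show "f = \<zero>\<^bsub>Hom (K A) W X\<^esub>" .
    qed
    show "\<exists>!f. f \<in> mor (K A) X W"
    proof (rule ex1I)
      show "\<zero>\<^bsub>Hom (K A) X W\<^esub> \<in> mor (K A) X W" using X W by simp
      fix f assume f: "f \<in> mor (K A) X W"
      then obtain f0 where f0: "f = hclass X W f0" "f0 \<in> chain_maps A X W" by (auto simp: mor_K)
      have "f = cmp (K A) X X W f (idm (K A) X)" using f X W by simp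
      also have "\<dots> = hclass X W (cmp (Ch A) X X W f0 \<zero>\<^bsub>Hom (Ch A) X X\<^esub>)"
        unfolding id0 f0(1) by (rule cmp_K[OF z f0(2)]) (use X W in simp_all)
      also have "\<dots> = \<zero>\<^bsub>Hom (K A) X W\<^esub>"
        using f0(2) X W by (simp add: hclass_zero del: Ch_simps(3,4,5))
      finally show "f = \<zero>\<^bsub>Hom (K A) X W\<^esub>" .
    qed
  qed
qed

text \<open>The maps \<open>a i\<close> of the factorisation start at generators, so the hypothesis
  lifts each of them along \<open>f i\<close>; the lifts glue to a map \<open>t\<close> on
  \<open>W\<close>, and \<open>h t\<close> can serve as the map that the factorisation leaves
  open.\<close>

lemma gens_perfect:
  assumes I: "small u (I :: 'u set)" and X: "X ` I \<subseteq> complexes A" and Y: "Y ` I \<subseteq> complexes A"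
    and f: "\<And>i. i \<in> I \<Longrightarrow> f i \<in> mor (K A) (X i) (Y i)"
    and ZX: "is_coproduct (K A) I X ZX \<iota>" and ZY: "is_coproduct (K A) I Y ZY \<kappa>"
    and h: "h \<in> mor (K A) ZX ZY" "\<And>i. i \<in> I \<Longrightarrow> cmp (K A) (X i) ZX ZY h (\<iota> i) = cmp (K A) (X i) (Y i) ZY (\<kappa> i)
        (f i)"
    and surj: "\<And>i S. \<lbrakk>i \<in> I; S \<in> gens\<rbrakk> \<Longrightarrow> Hom_surjective (K A) S (X i) (Y i) (f i)" and S: "S \<in> gens"
  shows "Hom_surjective (K A) S ZX ZY h"
  unfolding Hom_surjective_def
proof
  have SC: "S \<in> complexes A" using S by (simp add: gens_def)
  have ZXC: "ZX \<in> complexes A" and ZYC: "ZY \<in> complexes A" using coproduct_obj[OF ZX] coproduct_obj[OF ZY]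
      by simp_all
  have Xi: "X i \<in> complexes A" and Yi: "Y i \<in> complexes A" if "i \<in> I" for i using X Y that by blast+
  show "cmp (K A) S ZX ZY h ` mor (K A) S ZX \<subseteq> mor (K A) S ZY"
    using h(1) SC ZXC ZYC by auto
  show "mor (K A) S ZY \<subseteq> cmp (K A) S ZX ZY h ` mor (K A) S ZX"
  proof
    fix g assume g: "g \<in> mor (K A) S ZY"
    show "g \<in> cmp (K A) S ZX ZY h ` mor (K A) S ZX"
    proof (rule gens_factor[OF I Y ZY S g])
      fix Q a W \<omega> g'
      assume Q: "\<And>i. i \<in> I \<Longrightarrow> Q i \<in> gens" and a: "\<And>i. i \<in> I \<Longrightarrow> a i \<in> mor (K A) (Q i) (Y i)"
        and W: "is_coproduct (K A) I Q W \<omega>" and g': "g' \<in> mor (K A) S W"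
        and fac: "\<And>h. \<lbrakk>h \<in> mor (K A) W ZY; \<And>i. i \<in> I \<Longrightarrow> cmp (K A) (Q i) W ZY h (\<omega> i) = cmp (K A) (Q i) (Y i)
            ZY (\<kappa> i) (a i)\<rbrakk> \<Longrightarrow>
          g = cmp (K A) S W ZY h g'"
      have QC: "Q i \<in> complexes A" if "i \<in> I" for i using Q[OF that] by (simp add: gens_def)
      have WC: "W \<in> complexes A" using coproduct_obj[OF W] by simp
      have \<omega>: "\<omega> i \<in> mor (K A) (Q i) W" and \<iota>: "\<iota> i \<in> mor (K A) (X i) ZX" and \<kappa>: "\<kappa> i \<in> mor (K A) (Y i) ZY"
          if "i \<in> I" for i
        using coproduct_inj[OF W that] coproduct_inj[OF ZX that] coproduct_inj[OF ZY that] .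
      have "\<forall>i. \<exists>b. i \<in> I \<longrightarrow> b \<in> mor (K A) (Q i) (X i) \<and> cmp (K A) (Q i) (X i) (Y i) (f i) b = a i"
      proof
        fix i show "\<exists>b. i \<in> I \<longrightarrow> b \<in> mor (K A) (Q i) (X i) \<and> cmp (K A) (Q i) (X i) (Y i) (f i) b = a i"
        proof (cases "i \<in> I")
          case True
          then have "a i \<in> cmp (K A) (Q i) (X i) (Y i) (f i) ` mor (K A) (Q i) (X i)"
            using surj[OF True Q[OF True]] a[OF True] unfolding Hom_surjective_def by simp
          then show ?thesis by auto
        qed simp
      qed
      from choice[OF this] obtain b where b: "\<And>i. i \<in> I \<Longrightarrow> b i \<in> mor (K A) (Q i) (X i)"
        and fb: "\<And>i. i \<in> I \<Longrightarrow> cmp (K A) (Q i) (X i) (Y i) (f i) (b i) = a i" by blast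
      obtain t where t: "t \<in> mor (K A) W ZX" "\<And>i. i \<in> I \<Longrightarrow> cmp (K A) (Q i) W ZX t (\<omega> i) = cmp (K A) (Q i) (X
          i) ZX (\<iota> i) (b i)"
        by (rule coproduct_ex[OF W, of ZX "\<lambda>i. cmp (K A) (Q i) (X i) ZX (\<iota> i) (b i)"]) (use ZXC b \<iota> QC Xi in
            auto)
      have "g = cmp (K A) S W ZY (cmp (K A) W ZX ZY h t) g'"
      proof (rule fac)
        show "cmp (K A) W ZX ZY h t \<in> mor (K A) W ZY" using h(1) t(1) WC ZXC ZYC by simp
        fix i assume i: "i \<in> I"
        have "cmp (K A) (Q i) W ZY (cmp (K A) W ZX ZY h t) (\<omega> i) = cmp (K A) (Q i) ZX ZY h (cmp (K A) (Q i)
            W ZX t (\<omega> i))"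
          using h(1) t(1) \<omega>[OF i] QC[OF i] WC ZXC ZYC by (simp add: K.cmp_assoc)
        also have "\<dots> = cmp (K A) (Q i) (X i) ZY (cmp (K A) (X i) ZX ZY h (\<iota> i)) (b i)"
          unfolding t(2)[OF i] using h(1) \<iota>[OF i] b[OF i] QC[OF i] Xi[OF i] ZXC ZYC by (simp add:
              K.cmp_assoc)
        also have "\<dots> = cmp (K A) (Q i) (Y i) ZY (\<kappa> i) (cmp (K A) (Q i) (X i) (Y i) (f i) (b i))"
          unfolding h(2)[OF i] using f[OF i] \<kappa>[OF i] b[OF i] QC[OF i] Xi[OF i] Yi[OF i] ZYC by (simp add:
              K.cmp_assoc)
        finally show "cmp (K A) (Q i) W ZY (cmp (K A) W ZX ZY h t) (\<omega> i) = cmp (K A) (Q i) (Y i) ZY (\<kappa> i) (a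
            i)"
          unfolding fb[OF i] .
      qed
      also have "\<dots> = cmp (K A) S ZX ZY h (cmp (K A) S W ZX t g')"
        using h(1) t(1) g' SC WC ZXC ZYC by (simp add: K.cmp_assoc)
      finally show ?thesis using t(1) g' SC WC ZXC by simp
    qed
  qed
qed

text \<open>The map on \<open>W\<close> is rerouted through the coproduct over the indices with
  \<open>a i\<close> nonzero. On the remaining summands zero is the right choice because
  \<open>a i\<close> is zero there. Of \<open>\<alpha>\<close> only its exceeding every countable
  set is used.\<close>

lemma gens_small:
  assumes \<alpha>: "\<And>J :: 'u set. countable J \<Longrightarrow> |J| <o \<alpha>" and S: "S \<in> gens"
  shows "cardinal_small u (K A) \<alpha> S"
  unfolding cardinal_small_def
proof (intro allI impI ballI)
  fix I :: "'u set" and Y ZY \<kappa> f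
  assume "small u I \<and> Y ` I \<subseteq> objs (K A) \<and> is_coproduct (K A) I Y ZY \<kappa>" and f: "f \<in> mor (K A) S ZY"
  then have I: "small u I" and Y: "Y ` I \<subseteq> complexes A" and ZY: "is_coproduct (K A) I Y ZY \<kappa>" by simp_all
  have SC: "S \<in> complexes A" using S by (simp add: gens_def)
  have ZYC: "ZY \<in> complexes A" using coproduct_obj[OF ZY] by simp
  have Yi: "Y i \<in> complexes A" if "i \<in> I" for i using Y that by blast
  have \<kappa>: "\<kappa> i \<in> mor (K A) (Y i) ZY" if "i \<in> I" for i using coproduct_inj[OF ZY that] .
  show "\<exists>J W \<nu>. J \<subseteq> I \<and> |J| <o \<alpha> \<and> is_coproduct (K A) J Y W \<nu> \<and>
     (\<exists>c\<in>mor (K A) W ZY. (\<forall>j\<in>J. cmp (K A) (Y j) W ZY c (\<nu> j) = \<kappa> j) \<and> (\<exists>g\<in>mor (K A) S W. f = cmp (K A) S W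
         ZY c g))"
  proof (rule gens_factor[OF I Y ZY S f])
    fix Q a W \<omega> f'
    assume Q: "\<And>i. i \<in> I \<Longrightarrow> Q i \<in> gens" and a: "\<And>i. i \<in> I \<Longrightarrow> a i \<in> mor (K A) (Q i) (Y i)"
      and W: "is_coproduct (K A) I Q W \<omega>" and f': "f' \<in> mor (K A) S W"
      and cnt: "countable {i \<in> I. a i \<noteq> \<zero>\<^bsub>Hom (K A) (Q i) (Y i)\<^esub>}"
      and fac: "\<And>h. \<lbrakk>h \<in> mor (K A) W ZY; \<And>i. i \<in> I \<Longrightarrow> cmp (K A) (Q i) W ZY h (\<omega> i) = cmp (K A) (Q i) (Y i) ZY
          (\<kappa> i) (a i)\<rbrakk> \<Longrightarrow>
        f = cmp (K A) S W ZY h f'"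
    have QC: "Q i \<in> complexes A" if "i \<in> I" for i using Q[OF that] by (simp add: gens_def)
    have WC: "W \<in> complexes A" using coproduct_obj[OF W] by simp
    have \<omega>: "\<omega> i \<in> mor (K A) (Q i) W" if "i \<in> I" for i using coproduct_inj[OF W that] .
    define J where "J = {i \<in> I. a i \<noteq> \<zero>\<^bsub>Hom (K A) (Q i) (Y i)\<^esub>}"
    have JI: "J \<subseteq> I" by (auto simp: J_def)
    then have YJ: "Y ` J \<subseteq> complexes A" using Y by blast
    obtain L \<nu>0 where L: "L \<in> complexes A" "\<And>n. is_coproduct A J (\<lambda>i. fst (Y i) n) (fst L n) (\<lambda>i. \<nu>0 i n)"
      "\<And>i. i \<in> J \<Longrightarrow> \<nu>0 i \<in> chain_maps A (Y i) L"
      by (rule coproduct_complex_exists[OF small_mono[OF JI I] YJ]) (rule that)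
    define \<nu> where "\<nu> i = hclass (Y i) L (\<nu>0 i)" for i
    have LK: "is_coproduct (K A) J Y L \<nu>" unfolding \<nu>_def by (rule degreewise_coproduct_K[OF YJ L])
    have \<nu>: "\<nu> i \<in> mor (K A) (Y i) L" if "i \<in> J" for i using coproduct_inj[OF LK that] .
    obtain c where c: "c \<in> mor (K A) L ZY" "\<And>i. i \<in> J \<Longrightarrow> cmp (K A) (Y i) L ZY c (\<nu> i) = \<kappa> i"
      by (rule coproduct_ex[OF LK, of ZY \<kappa>]) (use ZYC \<kappa> JI in auto)
    define g0 where "g0 i = (if i \<in> J then cmp (K A) (Q i) (Y i) L (\<nu> i) (a i) else \<zero>\<^bsub>Hom (K A) (Q i) L\<^esub>)"
        for i
    have g0: "g0 i \<in> mor (K A) (Q i) L" if "i \<in> I" for i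
      using that a[OF that] \<nu>[of i] QC[OF that] Yi[OF that] L(1) by (simp add: g0_def)
    obtain t where t: "t \<in> mor (K A) W L" "\<And>i. i \<in> I \<Longrightarrow> cmp (K A) (Q i) W L t (\<omega> i) = g0 i"
      by (rule coproduct_ex[OF W, of L g0]) (use L(1) g0 in auto)
    \<comment> \<open>\<open>K A\<close> is available here only as a category, so composition with
      zero is computed on representatives.\<close>
    have K0: "cmp (K A) X1 X2 X3 k \<zero>\<^bsub>Hom (K A) X1 X2\<^esub> = \<zero>\<^bsub>Hom (K A) X1 X3\<^esub>"
      if o: "X1 \<in> complexes A" "X2 \<in> complexes A" "X3 \<in> complexes A" and k: "k \<in> mor (K A) X2 X3" for X1 X2
          X3 k
    proof -
      obtain k0 where k0: "k = hclass X2 X3 k0" "k0 \<in> chain_maps A X2 X3" using k by (auto simp: mor_K)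
      have "\<zero>\<^bsub>Hom (Ch A) X1 X2\<^esub> \<in> chain_maps A X1 X2" using Ch.zero_mor[of X1 X2] o by simp
      then have "cmp (K A) X1 X2 X3 k \<zero>\<^bsub>Hom (K A) X1 X2\<^esub> = hclass X1 X3 (cmp (Ch A) X1 X2 X3 k0 \<zero>\<^bsub>Hom (Ch A)
          X1 X2\<^esub>)"
        unfolding k0(1) hclass_zero[OF o(1,2)] by (rule cmp_K[OF _ k0(2) o])
      then show ?thesis using k0(2) o by (simp add: hclass_zero del: Ch_simps(3,4,5))
    qed
    have "f = cmp (K A) S W ZY (cmp (K A) W L ZY c t) f'"
    proof (rule fac)
      show "cmp (K A) W L ZY c t \<in> mor (K A) W ZY" using c(1) t(1) WC L(1) ZYC by simp
      fix i assume i: "i \<in> I"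
      have "cmp (K A) (Q i) W ZY (cmp (K A) W L ZY c t) (\<omega> i) = cmp (K A) (Q i) L ZY c (g0 i)"
        using c(1) t(1) t(2)[OF i] \<omega>[OF i] QC[OF i] WC L(1) ZYC by (simp add: K.cmp_assoc)
      also have "\<dots> = cmp (K A) (Q i) (Y i) ZY (\<kappa> i) (a i)"
      proof (cases "i \<in> J")
        case True
        have "cmp (K A) (Q i) L ZY c (g0 i) = cmp (K A) (Q i) (Y i) ZY (cmp (K A) (Y i) L ZY c (\<nu> i)) (a i)"
          using True c(1) \<nu>[OF True] a[OF i] QC[OF i] Yi[OF i] L(1) ZYC by (simp add: g0_def K.cmp_assoc)
        then show ?thesis unfolding c(2)[OF True] .
      next
        case False
        then have "a i = \<zero>\<^bsub>Hom (K A) (Q i) (Y i)\<^esub>" using i by (simp add: J_def)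
        then show ?thesis using False c(1) \<kappa>[OF i] QC[OF i] Yi[OF i] L(1) ZYC by (simp add: g0_def K0)
      qed
      finally show "cmp (K A) (Q i) W ZY (cmp (K A) W L ZY c t) (\<omega> i) = cmp (K A) (Q i) (Y i) ZY (\<kappa> i) (a
          i)" .
    qed
    also have "\<dots> = cmp (K A) S L ZY c (cmp (K A) S W L t f')"
      using c(1) t(1) f' SC WC L(1) ZYC by (simp add: K.cmp_assoc)
    finally have "f = cmp (K A) S L ZY c (cmp (K A) S W L t f')" .
    moreover have "cmp (K A) S W L t f' \<in> mor (K A) S L" using t(1) f' SC WC L(1) by simp
    moreover have "|J| <o \<alpha>" using \<alpha> cnt by (simp add: J_def)
    ultimately show ?thesis using JI LK c by blast
  qed
qed

text \<open>The successor of the cardinal of the naturals lives on another type and is copied along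
  an injection into \<open>'u\<close>. The injection exists because the first uncountable cardinal
  is at most that of \<open>Pow V\<close>. Successors of infinite cardinals are regular.\<close>

lemma aleph1_exists:
  obtains \<alpha> :: "'u rel" where "Cinfinite \<alpha>" "regularCard \<alpha>" "\<alpha> <o |UNIV :: 'u set|"
    "\<And>J :: 'u set. countable J \<Longrightarrow> |J| <o \<alpha>"
proof -
  have nat: "Cinfinite natLeq" by (rule natLeq_Cinfinite)
  have natV: "natLeq \<le>o |V|" using V(1) infinite_iff_natLeq_ordLeq by auto
  have "natLeq <o |Pow V|" using natV card_of_Pow by (rule ordLeq_ordLess_trans)
  then have le: "cardSuc natLeq \<le>o |Pow V|"
    using cardSuc_least[OF natLeq_Card_order card_of_Card_order] by blast
  have lt: "cardSuc natLeq <o |UNIV :: 'u set|" using le V(2) unfolding small_def by (rule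
      ordLeq_ordLess_trans)
  have F: "|Field (cardSuc natLeq)| =o cardSuc natLeq"
    by (rule card_of_Field_ordIso[OF cardSuc_Card_order[OF natLeq_Card_order]])
  have "|Field (cardSuc natLeq)| \<le>o |UNIV :: 'u set|"
    using F ordLess_imp_ordLeq[OF lt] by (rule ordIso_ordLeq_trans)
  then obtain f where f: "inj_on f (Field (cardSuc natLeq))" "f ` Field (cardSuc natLeq) \<subseteq> (UNIV :: 'u set)"
    using card_of_ordLeq[of "Field (cardSuc natLeq)" "UNIV :: 'u set"] by auto
  define \<alpha> where "\<alpha> = |f ` Field (cardSuc natLeq)|"
  have "|Field (cardSuc natLeq)| =o \<alpha>" unfolding \<alpha>_def
    using f(1) by (intro card_of_ordIsoI[of f]) (simp add: bij_betw_def)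
  then have iso: "cardSuc natLeq =o \<alpha>" using F by (meson ordIso_symmetric ordIso_transitive)
  show ?thesis
  proof (rule that)
    show "Cinfinite \<alpha>" using iso Cinfinite_cardSuc[OF nat] by (rule Cinfinite_cong)
    show "regularCard \<alpha>" by (rule regularCard_ordIso[OF iso Cinfinite_cardSuc[OF nat] regularCard_cardSuc[OF
        nat]])
    show "\<alpha> <o |UNIV :: 'u set|" using ordIso_symmetric[OF iso] lt by (rule ordIso_ordLess_trans)
    fix J :: "'u set" assume "countable J"
    then have "|J| \<le>o |UNIV :: nat set|" using card_of_ordLeq[of J "UNIV :: nat set"] by (auto simp:
        countable_def)
    also have "|UNIV :: nat set| =o natLeq" by (rule card_of_nat)
    also have "natLeq <o cardSuc natLeq" by (rule cardSuc_greater[OF natLeq_Card_order])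
    also have "cardSuc natLeq =o \<alpha>" by (rule iso)
    finally show "|J| <o \<alpha>" .
  qed
qed

theorem K_well_generated: "well_generated u (K A)"
proof -
  obtain \<alpha> :: "'u rel" where \<alpha>: "Cinfinite \<alpha>" "regularCard \<alpha>" "\<alpha> <o |UNIV :: 'u set|"
    "\<And>J :: 'u set. countable J \<Longrightarrow> |J| <o \<alpha>"
    by (rule aleph1_exists) (rule that)
  have gens: "gens \<subseteq> objs (K A)" by (auto simp: gens_def)
  show ?thesis
    unfolding well_generated_def
  proof (intro conjI exI)
    show "has_small_coproducts u (K A)" by (rule K_has_small_coproducts)
    show "cinfinite \<alpha>" "Card_order \<alpha>" using \<alpha>(1) by simp_all
    show "regularCard \<alpha>" "\<alpha> <o |UNIV :: 'u set|" by (rule \<alpha>(2,3))+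
    show "gens \<subseteq> objs (K A)" by (rule gens)
    show "small u gens" by (rule small_gens)
    show "shift (K A) ` gens = gens" by (rule shift_gens)
    show "\<forall>X\<in>objs (K A). (\<forall>S\<in>gens. mor (K A) S X = {\<zero>\<^bsub>Hom (K A) S X\<^esub>}) \<longrightarrow> zero_object (K A) X"
      using gens_generate by simp
    show "\<forall>S\<in>gens. cardinal_small u (K A) \<alpha> S" using gens_small[OF \<alpha>(4)] by blast
    show "\<forall>(I :: 'u set) X Y f ZX ZY \<iota> \<kappa> h.
       small u I \<and> X ` I \<subseteq> objs (K A) \<and> Y ` I \<subseteq> objs (K A) \<and> (\<forall>i\<in>I. f i \<in> mor (K A) (X i) (Y i)) \<and>
       is_coproduct (K A) I X ZX \<iota> \<and> is_coproduct (K A) I Y ZY \<kappa> \<and> h \<in> mor (K A) ZX ZY \<and>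
       (\<forall>i\<in>I. cmp (K A) (X i) ZX ZY h (\<iota> i) = cmp (K A) (X i) (Y i) ZY (\<kappa> i) (f i)) \<and>
       (\<forall>i\<in>I. \<forall>S\<in>gens. Hom_surjective (K A) S (X i) (Y i) (f i))
       \<longrightarrow> (\<forall>S\<in>gens. Hom_surjective (K A) S ZX ZY h)"
    proof (intro allI impI ballI, elim conjE)
      fix I :: "'u set" and X Y f ZX ZY \<iota> \<kappa> h S
      assume "S \<in> gens" "small u I" "X ` I \<subseteq> objs (K A)" "Y ` I \<subseteq> objs (K A)"
        "\<forall>i\<in>I. f i \<in> mor (K A) (X i) (Y i)" "is_coproduct (K A) I X ZX \<iota>" "is_coproduct (K A) I Y ZY \<kappa>"
        "h \<in> mor (K A) ZX ZY" "\<forall>i\<in>I. cmp (K A) (X i) ZX ZY h (\<iota> i) = cmp (K A) (X i) (Y i) ZY (\<kappa> i) (f i)"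
        "\<forall>i\<in>I. \<forall>S\<in>gens. Hom_surjective (K A) S (X i) (Y i) (f i)"
      then show "Hom_surjective (K A) S ZX ZY h"
        by (intro gens_perfect[of I X Y f ZX \<iota> ZY \<kappa> h S]) simp_all
    qed
  qed
qed

end

section \<open>Modules\<close>

text \<open>Source and target may live in different types, and no extensionality is asked for. In
  this form direct sums, whose elements are functions, can be treated before they are copied into
  \<open>'u\<close>.\<close>

definition linear :: "('r, 'x) ring_scheme \<Rightarrow> ('r, 'a) module \<Rightarrow> ('r, 'b) module \<Rightarrow> ('a \<Rightarrow> 'b) \<Rightarrow> bool" where
  "linear R M N f \<longleftrightarrow> (\<forall>x\<in>carrier M. f x \<in> carrier N) \<and>
     (\<forall>x\<in>carrier M. \<forall>y\<in>carrier M. f (x \<oplus>\<^bsub>M\<^esub> y) = f x \<oplus>\<^bsub>N\<^esub> f y) \<and>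
     (\<forall>a\<in>carrier R. \<forall>x\<in>carrier M. f (a \<odot>\<^bsub>M\<^esub> x) = a \<odot>\<^bsub>N\<^esub> f x)"

lemma (in left_module) smult_zero:
  assumes "a \<in> carrier R"
  shows "a \<odot>\<^bsub>M\<^esub> \<zero>\<^bsub>M\<^esub> = \<zero>\<^bsub>M\<^esub>"
proof -
  have "a \<odot>\<^bsub>M\<^esub> \<zero>\<^bsub>M\<^esub> \<oplus>\<^bsub>M\<^esub> a \<odot>\<^bsub>M\<^esub> \<zero>\<^bsub>M\<^esub> = a \<odot>\<^bsub>M\<^esub> \<zero>\<^bsub>M\<^esub>"
    using smult_r_distr[of a "\<zero>\<^bsub>M\<^esub>" "\<zero>\<^bsub>M\<^esub>"] assms by simp
  then show ?thesis using assms by simp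
qed

lemma linearI:
  assumes "\<And>x. x \<in> carrier M \<Longrightarrow> f x \<in> carrier N"
    "\<And>x y. \<lbrakk>x \<in> carrier M; y \<in> carrier M\<rbrakk> \<Longrightarrow> f (x \<oplus>\<^bsub>M\<^esub> y) = f x \<oplus>\<^bsub>N\<^esub> f y"
    "\<And>a x. \<lbrakk>a \<in> carrier R; x \<in> carrier M\<rbrakk> \<Longrightarrow> f (a \<odot>\<^bsub>M\<^esub> x) = a \<odot>\<^bsub>N\<^esub> f x"
  shows "linear R M N f"
  using assms by (simp add: linear_def)

lemma linearD:
  assumes "linear R M N f"
  shows "x \<in> carrier M \<Longrightarrow> f x \<in> carrier N"
    "\<lbrakk>x \<in> carrier M; y \<in> carrier M\<rbrakk> \<Longrightarrow> f (x \<oplus>\<^bsub>M\<^esub> y) = f x \<oplus>\<^bsub>N\<^esub> f y"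
    "\<lbrakk>a \<in> carrier R; x \<in> carrier M\<rbrakk> \<Longrightarrow> f (a \<odot>\<^bsub>M\<^esub> x) = a \<odot>\<^bsub>N\<^esub> f x"
  using assms by (simp_all add: linear_def)

lemma linear_cong:
  assumes "left_module R M" "linear R M N f" "\<And>x. x \<in> carrier M \<Longrightarrow> g x = f x"
  shows "linear R M N g"
proof -
  interpret M: left_module R M by (rule assms(1))
  show ?thesis using assms(2,3) by (simp add: linear_def)
qed

lemma linear_maps_iff: "f \<in> linear_maps R M N \<longleftrightarrow> linear R M N f \<and> f \<in> extensional (carrier M)"
  by (auto simp: linear_maps_def linear_def PiE_def Pi_def)

lemma linear_mapsD:
  assumes "f \<in> linear_maps R M N"
  shows "x \<in> carrier M \<Longrightarrow> f x \<in> carrier N"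
    "\<lbrakk>x \<in> carrier M; y \<in> carrier M\<rbrakk> \<Longrightarrow> f (x \<oplus>\<^bsub>M\<^esub> y) = f x \<oplus>\<^bsub>N\<^esub> f y"
    "\<lbrakk>a \<in> carrier R; x \<in> carrier M\<rbrakk> \<Longrightarrow> f (a \<odot>\<^bsub>M\<^esub> x) = a \<odot>\<^bsub>N\<^esub> f x"
    "f \<in> extensional (carrier M)"
  using assms by (simp_all add: linear_maps_iff linear_def)

lemma linear_restrict:
  assumes "left_module R M" "linear R M N f"
  shows "restrict f (carrier M) \<in> linear_maps R M N"
  using linear_cong[OF assms, of "restrict f (carrier M)"] by (simp add: linear_maps_iff)

lemma linear_zero:
  assumes "left_module R M" "left_module R N" "linear R M N f"
  shows "f \<zero>\<^bsub>M\<^esub> = \<zero>\<^bsub>N\<^esub>"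
proof -
  interpret M: left_module R M by (rule assms(1))
  interpret N: left_module R N by (rule assms(2))
  have "f \<zero>\<^bsub>M\<^esub> \<oplus>\<^bsub>N\<^esub> f \<zero>\<^bsub>M\<^esub> = f \<zero>\<^bsub>M\<^esub>" using linearD(2)[OF assms(3), of "\<zero>\<^bsub>M\<^esub>" "\<zero>\<^bsub>M\<^esub>"] by simp
  then show ?thesis using linearD(1)[OF assms(3), of "\<zero>\<^bsub>M\<^esub>"] by simp
qed

lemma linear_compose:
  "linear R L M f \<Longrightarrow> linear R M N g \<Longrightarrow> linear R L N (\<lambda>x. g (f x))"
  by (simp add: linear_def)

lemma linear_maps_eqI:
  assumes "f \<in> linear_maps R M N" "g \<in> linear_maps R M N" "\<And>x. x \<in> carrier M \<Longrightarrow> f x = g x"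
  shows "f = g"
  using assms by (intro extensionalityI[of f "carrier M"]) (auto simp: linear_maps_iff)

text \<open>The module axioms are equations and pass along a surjection compatible with the
  operations. Copies along an injection, quotients and the zero module are all obtained from
  this.\<close>

lemma left_module_image:
  fixes q :: "'a \<Rightarrow> 'b" and M :: "('r, 'a) module" and N :: "('r, 'b) module"
  assumes M: "left_module R M" and onto: "carrier N = q ` carrier M"
    and add: "\<And>x y. \<lbrakk>x \<in> carrier M; y \<in> carrier M\<rbrakk> \<Longrightarrow> q x \<oplus>\<^bsub>N\<^esub> q y = q (x \<oplus>\<^bsub>M\<^esub> y)"
    and smult: "\<And>a x. \<lbrakk>a \<in> carrier R; x \<in> carrier M\<rbrakk> \<Longrightarrow> a \<odot>\<^bsub>N\<^esub> q x = q (a \<odot>\<^bsub>M\<^esub> x)"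
    and zero: "\<zero>\<^bsub>N\<^esub> = q \<zero>\<^bsub>M\<^esub>"
  shows "left_module R N"
proof -
  interpret M: left_module R M by (rule M)
  have grp: "abelian_group N"
  proof (rule abelian_groupI)
    fix x assume "x \<in> carrier N"
    then obtain x' where x': "x' \<in> carrier M" "x = q x'" using onto by blast
    show "\<zero>\<^bsub>N\<^esub> \<oplus>\<^bsub>N\<^esub> x = x" using x' by (simp add: zero add)
    show "\<exists>y\<in>carrier N. y \<oplus>\<^bsub>N\<^esub> x = \<zero>\<^bsub>N\<^esub>"
      by (rule bexI[of _ "q (\<ominus>\<^bsub>M\<^esub> x')"]) (use x' in \<open>auto simp: onto zero add M.l_neg\<close>)
    fix y assume "y \<in> carrier N"
    then obtain y' where y': "y' \<in> carrier M" "y = q y'" using onto by blast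
    show "x \<oplus>\<^bsub>N\<^esub> y \<in> carrier N" using x' y' by (simp add: onto add)
    show "x \<oplus>\<^bsub>N\<^esub> y = y \<oplus>\<^bsub>N\<^esub> x" using x' y' by (simp add: add M.a_comm)
    fix z assume "z \<in> carrier N"
    then obtain z' where z': "z' \<in> carrier M" "z = q z'" using onto by blast
    show "x \<oplus>\<^bsub>N\<^esub> y \<oplus>\<^bsub>N\<^esub> z = x \<oplus>\<^bsub>N\<^esub> (y \<oplus>\<^bsub>N\<^esub> z)" using x' y' z' by (simp add: add M.a_assoc)
  qed (simp add: onto zero)
  show ?thesis
  proof (rule left_module.intro[OF M.R.ring_axioms grp], unfold_locales)
    fix a x assume a: "a \<in> carrier R" and "x \<in> carrier N"
    then obtain x' where x': "x' \<in> carrier M" "x = q x'" using onto by blast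
    show "a \<odot>\<^bsub>N\<^esub> x \<in> carrier N" using a x' by (simp add: onto smult)
    fix b assume b: "b \<in> carrier R"
    show "(a \<oplus>\<^bsub>R\<^esub> b) \<odot>\<^bsub>N\<^esub> x = a \<odot>\<^bsub>N\<^esub> x \<oplus>\<^bsub>N\<^esub> b \<odot>\<^bsub>N\<^esub> x" using a b x' by (simp add: smult add M.smult_l_distr)
    show "(a \<otimes>\<^bsub>R\<^esub> b) \<odot>\<^bsub>N\<^esub> x = a \<odot>\<^bsub>N\<^esub> (b \<odot>\<^bsub>N\<^esub> x)" using a b x' by (simp add: smult M.smult_assoc)
  next
    fix a x y assume a: "a \<in> carrier R" and "x \<in> carrier N" "y \<in> carrier N"
    then obtain x' y' where x': "x' \<in> carrier M" "x = q x'" "y' \<in> carrier M" "y = q y'" using onto by blast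
    show "a \<odot>\<^bsub>N\<^esub> (x \<oplus>\<^bsub>N\<^esub> y) = a \<odot>\<^bsub>N\<^esub> x \<oplus>\<^bsub>N\<^esub> a \<odot>\<^bsub>N\<^esub> y" using a x' by (simp add: smult add M.smult_r_distr)
  next
    fix x assume "x \<in> carrier N"
    then obtain x' where x': "x' \<in> carrier M" "x = q x'" using onto by blast
    show "\<one>\<^bsub>R\<^esub> \<odot>\<^bsub>N\<^esub> x = x" using x' by (simp add: smult)
  qed
qed

definition module_of :: "'a set \<Rightarrow> ('a \<Rightarrow> 'a \<Rightarrow> 'a) \<Rightarrow> 'a \<Rightarrow> ('r \<Rightarrow> 'a \<Rightarrow> 'a) \<Rightarrow> ('r, 'a) module" where
  "module_of S p z m = \<lparr>carrier = S, monoid.mult = undefined, one = undefined, zero = z, add = p, smult =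
      m\<rparr>"

lemma module_of_simps [simp]:
  "carrier (module_of S p z m) = S" "add (module_of S p z m) = p" "zero (module_of S p z m) = z" "smult
      (module_of S p z m) = m"
  by (simp_all add: module_of_def)

text \<open>Objects of \<open>ModCat\<close> have their elements in \<open>'u\<close>; this makes a
  copy there of a module built on another type.\<close>

definition transport :: "('a \<Rightarrow> 'b) \<Rightarrow> ('r, 'a) module \<Rightarrow> ('r, 'b) module" where
  "transport e M = module_of (e ` carrier M)
     (\<lambda>x y. e (inv_into (carrier M) e x \<oplus>\<^bsub>M\<^esub> inv_into (carrier M) e y)) (e \<zero>\<^bsub>M\<^esub>)
     (\<lambda>a x. e (a \<odot>\<^bsub>M\<^esub> inv_into (carrier M) e x))"

lemma transport:
  assumes M: "left_module R M" and e: "inj_on e (carrier M)"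
  shows "left_module R (transport e M)" "linear R M (transport e M) e"
    "linear R (transport e M) M (inv_into (carrier M) e)" "carrier (transport e M) = e ` carrier M"
proof -
  interpret M: left_module R M by (rule M)
  show "left_module R (transport e M)"
    by (rule left_module_image[OF M, of _ e]) (use e in \<open>auto simp: transport_def\<close>)
  show "linear R M (transport e M) e" "linear R (transport e M) M (inv_into (carrier M) e)"
    using e by (auto simp: linear_def transport_def)
qed (simp add: transport_def)

subsection \<open>Direct sums\<close>

definition direct_sum :: "'i set \<Rightarrow> ('i \<Rightarrow> ('r, 'a) module) \<Rightarrow> ('r, 'i \<Rightarrow> 'a) module" where
  "direct_sum I X = module_of {f \<in> (\<Pi>\<^sub>E i\<in>I. carrier (X i)). finite {i\<in>I. f i \<noteq> \<zero>\<^bsub>X i\<^esub>}}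
     (\<lambda>f g. \<lambda>i\<in>I. f i \<oplus>\<^bsub>X i\<^esub> g i) (\<lambda>i\<in>I. \<zero>\<^bsub>X i\<^esub>) (\<lambda>a f. \<lambda>i\<in>I. a \<odot>\<^bsub>X i\<^esub> f i)"

definition single :: "'i set \<Rightarrow> ('i \<Rightarrow> ('r, 'a) module) \<Rightarrow> 'i \<Rightarrow> 'a \<Rightarrow> 'i \<Rightarrow> 'a" where
  "single I X i x = (\<lambda>j\<in>I. if j = i then x else \<zero>\<^bsub>X j\<^esub>)"

locale module_family =
  fixes R :: "('r, 'x) ring_scheme" and I :: "'i set" and X :: "'i \<Rightarrow> ('r, 'a) module"
  assumes R: "ring R" and X: "i \<in> I \<Longrightarrow> left_module R (X i)"
begin

abbreviation DS where "DS \<equiv> direct_sum I X"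

abbreviation supp where "supp f \<equiv> {i\<in>I. f i \<noteq> \<zero>\<^bsub>X i\<^esub>}"

lemma X_simps:
  assumes "i \<in> I"
  shows "\<zero>\<^bsub>X i\<^esub> \<in> carrier (X i)" "\<lbrakk>x \<in> carrier (X i); y \<in> carrier (X i)\<rbrakk> \<Longrightarrow> x \<oplus>\<^bsub>X i\<^esub> y \<in> carrier (X i)"
    "\<lbrakk>a \<in> carrier R; x \<in> carrier (X i)\<rbrakk> \<Longrightarrow> a \<odot>\<^bsub>X i\<^esub> x \<in> carrier (X i)"
    "x \<in> carrier (X i) \<Longrightarrow> \<zero>\<^bsub>X i\<^esub> \<oplus>\<^bsub>X i\<^esub> x = x" "x \<in> carrier (X i) \<Longrightarrow> x \<oplus>\<^bsub>X i\<^esub> \<zero>\<^bsub>X i\<^esub> = x"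
proof -
  interpret left_module R "X i" by (rule X[OF assms])
  show "\<zero>\<^bsub>X i\<^esub> \<in> carrier (X i)" "\<lbrakk>x \<in> carrier (X i); y \<in> carrier (X i)\<rbrakk> \<Longrightarrow> x \<oplus>\<^bsub>X i\<^esub> y \<in> carrier (X i)"
    "\<lbrakk>a \<in> carrier R; x \<in> carrier (X i)\<rbrakk> \<Longrightarrow> a \<odot>\<^bsub>X i\<^esub> x \<in> carrier (X i)"
    "x \<in> carrier (X i) \<Longrightarrow> \<zero>\<^bsub>X i\<^esub> \<oplus>\<^bsub>X i\<^esub> x = x" "x \<in> carrier (X i) \<Longrightarrow> x \<oplus>\<^bsub>X i\<^esub> \<zero>\<^bsub>X i\<^esub> = x"
    by simp_all
qed

lemma DS_iff: "f \<in> carrier DS \<longleftrightarrow> (\<forall>i\<in>I. f i \<in> carrier (X i)) \<and> f \<in> extensional I \<and> finite (supp f)"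
  by (auto simp: direct_sum_def PiE_iff)

lemma DS_ops:
  "f \<oplus>\<^bsub>DS\<^esub> g = (\<lambda>i\<in>I. f i \<oplus>\<^bsub>X i\<^esub> g i)" "\<zero>\<^bsub>DS\<^esub> = (\<lambda>i\<in>I. \<zero>\<^bsub>X i\<^esub>)" "a \<odot>\<^bsub>DS\<^esub> f = (\<lambda>i\<in>I. a \<odot>\<^bsub>X i\<^esub> f i)"
  by (simp_all add: direct_sum_def)

lemma DS_add_closed:
  assumes "f \<in> carrier DS" "g \<in> carrier DS"
  shows "f \<oplus>\<^bsub>DS\<^esub> g \<in> carrier DS"
proof -
  have "supp (f \<oplus>\<^bsub>DS\<^esub> g) \<subseteq> supp f \<union> supp g" by (auto simp: DS_ops X_simps)
  then have "finite (supp (f \<oplus>\<^bsub>DS\<^esub> g))" using assms by (auto simp: DS_iff intro: finite_subset)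
  then show ?thesis using assms by (simp add: DS_iff DS_ops X_simps)
qed

lemma DS_smult_closed:
  assumes "a \<in> carrier R" "f \<in> carrier DS"
  shows "a \<odot>\<^bsub>DS\<^esub> f \<in> carrier DS"
proof -
  have "a \<odot>\<^bsub>X i\<^esub> \<zero>\<^bsub>X i\<^esub> = \<zero>\<^bsub>X i\<^esub>" if "i \<in> I" for i
    using left_module.smult_zero[OF X[OF that] assms(1)] .
  then have "supp (a \<odot>\<^bsub>DS\<^esub> f) \<subseteq> supp f" by (auto simp: DS_ops)
  then have "finite (supp (a \<odot>\<^bsub>DS\<^esub> f))" using assms by (auto simp: DS_iff intro: finite_subset)
  then show ?thesis using assms by (simp add: DS_iff DS_ops X_simps)
qed

lemma DS_module: "left_module R DS"
proof -
  have ext: "f = g" if "f \<in> extensional I" "g \<in> extensional I" "\<And>i. i \<in> I \<Longrightarrow> f i = g i" for f g :: "'i \<Rightarrow> 'a"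
    by (rule extensionalityI[OF that(1,2)]) (rule that(3))
  have grp: "abelian_group DS"
  proof (rule abelian_groupI)
    fix f g h assume f: "f \<in> carrier DS" and g: "g \<in> carrier DS" and h: "h \<in> carrier DS"
    show "f \<oplus>\<^bsub>DS\<^esub> g \<in> carrier DS" using f g by (rule DS_add_closed)
    show "f \<oplus>\<^bsub>DS\<^esub> g \<oplus>\<^bsub>DS\<^esub> h = f \<oplus>\<^bsub>DS\<^esub> (g \<oplus>\<^bsub>DS\<^esub> h)"
    proof (rule ext)
      fix i assume i: "i \<in> I"
      then interpret left_module R "X i" by (rule X)
      show "(f \<oplus>\<^bsub>DS\<^esub> g \<oplus>\<^bsub>DS\<^esub> h) i = (f \<oplus>\<^bsub>DS\<^esub> (g \<oplus>\<^bsub>DS\<^esub> h)) i"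
        using f g h i by (simp add: DS_iff DS_ops M.a_assoc)
    qed (simp_all add: DS_ops)
    show "f \<oplus>\<^bsub>DS\<^esub> g = g \<oplus>\<^bsub>DS\<^esub> f"
    proof (rule ext)
      fix i assume i: "i \<in> I"
      then interpret left_module R "X i" by (rule X)
      show "(f \<oplus>\<^bsub>DS\<^esub> g) i = (g \<oplus>\<^bsub>DS\<^esub> f) i"
        using f g i by (simp add: DS_iff DS_ops M.a_comm)
    qed (simp_all add: DS_ops)
  next
    show "\<zero>\<^bsub>DS\<^esub> \<in> carrier DS" by (simp add: DS_iff DS_ops X_simps)
    fix f assume f: "f \<in> carrier DS"
    show "\<zero>\<^bsub>DS\<^esub> \<oplus>\<^bsub>DS\<^esub> f = f"
      by (rule ext) (use f in \<open>simp_all add: DS_iff DS_ops X_simps\<close>)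
    have neg: "\<ominus>\<^bsub>X i\<^esub> x \<in> carrier (X i)" "\<ominus>\<^bsub>X i\<^esub> x \<oplus>\<^bsub>X i\<^esub> x = \<zero>\<^bsub>X i\<^esub>" "\<ominus>\<^bsub>X i\<^esub> \<zero>\<^bsub>X i\<^esub> = \<zero>\<^bsub>X i\<^esub>"
      if "i \<in> I" "x \<in> carrier (X i)" for i x
    proof -
      interpret left_module R "X i" by (rule X[OF that(1)])
      show "\<ominus>\<^bsub>X i\<^esub> x \<in> carrier (X i)" "\<ominus>\<^bsub>X i\<^esub> x \<oplus>\<^bsub>X i\<^esub> x = \<zero>\<^bsub>X i\<^esub>" using that(2) by (simp_all add: M.l_neg)
      show "\<ominus>\<^bsub>X i\<^esub> \<zero>\<^bsub>X i\<^esub> = \<zero>\<^bsub>X i\<^esub>" by (rule M.minus_equality) simp_all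
    qed
    let ?g = "\<lambda>i\<in>I. \<ominus>\<^bsub>X i\<^esub> f i"
    have "supp ?g \<subseteq> supp f" using neg(3)[OF _ X_simps(1)] by fastforce
    moreover have "finite (supp f)" using f by (simp add: DS_iff)
    ultimately have "finite (supp ?g)" by (rule finite_subset)
    then have "?g \<in> carrier DS" using f neg(1) unfolding DS_iff by simp
    moreover have "?g \<oplus>\<^bsub>DS\<^esub> f = \<zero>\<^bsub>DS\<^esub>"
      by (rule ext) (use f neg in \<open>simp_all add: DS_iff DS_ops\<close>)
    ultimately show "\<exists>g\<in>carrier DS. g \<oplus>\<^bsub>DS\<^esub> f = \<zero>\<^bsub>DS\<^esub>" by blast
  qed
  show ?thesis
  proof (rule left_module.intro[OF R grp], unfold_locales)
    fix a f assume a: "a \<in> carrier R" and f: "f \<in> carrier DS"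
    show "a \<odot>\<^bsub>DS\<^esub> f \<in> carrier DS" using a f by (rule DS_smult_closed)
    fix b assume b: "b \<in> carrier R"
    show "(a \<oplus>\<^bsub>R\<^esub> b) \<odot>\<^bsub>DS\<^esub> f = a \<odot>\<^bsub>DS\<^esub> f \<oplus>\<^bsub>DS\<^esub> b \<odot>\<^bsub>DS\<^esub> f"
      by (rule ext) (use a b f left_module.smult_l_distr[OF X] in \<open>simp_all add: DS_iff DS_ops\<close>)
    show "(a \<otimes>\<^bsub>R\<^esub> b) \<odot>\<^bsub>DS\<^esub> f = a \<odot>\<^bsub>DS\<^esub> (b \<odot>\<^bsub>DS\<^esub> f)"
      by (rule ext) (use a b f left_module.smult_assoc[OF X] in \<open>simp_all add: DS_iff DS_ops\<close>)
  next
    fix a f g assume a: "a \<in> carrier R" and f: "f \<in> carrier DS" and g: "g \<in> carrier DS"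
    show "a \<odot>\<^bsub>DS\<^esub> (f \<oplus>\<^bsub>DS\<^esub> g) = a \<odot>\<^bsub>DS\<^esub> f \<oplus>\<^bsub>DS\<^esub> a \<odot>\<^bsub>DS\<^esub> g"
      by (rule ext) (use a f g left_module.smult_r_distr[OF X] in \<open>simp_all add: DS_iff DS_ops\<close>)
  next
    fix f assume f: "f \<in> carrier DS"
    show "\<one>\<^bsub>R\<^esub> \<odot>\<^bsub>DS\<^esub> f = f"
      by (rule ext) (use f left_module.smult_one[OF X] in \<open>simp_all add: DS_iff DS_ops\<close>)
  qed
qed

lemma single_linear:
  assumes i: "i \<in> I"
  shows "linear R (X i) DS (single I X i)"
proof (rule linearI)
  fix x assume x: "x \<in> carrier (X i)"
  have "supp (single I X i x) \<subseteq> {i}" by (auto simp: single_def)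
  then show "single I X i x \<in> carrier DS" using x by (auto simp: DS_iff single_def X_simps intro:
      finite_subset)
next
  fix x y assume "x \<in> carrier (X i)" "y \<in> carrier (X i)"
  then show "single I X i (x \<oplus>\<^bsub>X i\<^esub> y) = single I X i x \<oplus>\<^bsub>DS\<^esub> single I X i y"
    by (auto simp: single_def DS_ops X_simps restrict_def fun_eq_iff)
next
  fix a x assume a: "a \<in> carrier R"
  show "single I X i (a \<odot>\<^bsub>X i\<^esub> x) = a \<odot>\<^bsub>DS\<^esub> single I X i x"
    using left_module.smult_zero[OF X a] by (auto simp: single_def DS_ops restrict_def fun_eq_iff)
qed

lemma proj_linear: "i \<in> I \<Longrightarrow> linear R DS (X i) (\<lambda>f. f i)"
  by (rule linearI) (simp_all add: DS_iff DS_ops)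

text \<open>Induction on a finite set containing the support, splitting off the component at one
  index as a \<open>single\<close>.\<close>

lemma linear_DS_eqI:
  assumes W: "left_module R W" and h: "linear R DS W h" "linear R DS W h'"
    and eq: "\<And>i x. \<lbrakk>i \<in> I; x \<in> carrier (X i)\<rbrakk> \<Longrightarrow> h (single I X i x) = h' (single I X i x)"
    and f: "f \<in> carrier DS"
  shows "h f = h' f"
proof -
  have "\<forall>f\<in>carrier DS. supp f \<subseteq> S \<longrightarrow> h f = h' f" if "finite S" for S
    using that
  proof (induction S)
    case empty
    show ?case
    proof (intro ballI impI)
      fix f assume f: "f \<in> carrier DS" "supp f \<subseteq> {}"
      then have "f = \<zero>\<^bsub>DS\<^esub>" by (intro extensionalityI[of f I]) (auto simp: DS_iff DS_ops)
      then show "h f = h' f" using linear_zero[OF DS_module W h(1)] linear_zero[OF DS_module W h(2)] by simp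
    qed
  next
    case (insert i S)
    show ?case
    proof (intro ballI impI)
      fix f assume f: "f \<in> carrier DS" and s: "supp f \<subseteq> insert i S"
      show "h f = h' f"
      proof (cases "i \<in> I")
        case False
        then show ?thesis using insert.IH f s by blast
      next
        case True
        define f' where "f' = (\<lambda>j\<in>I. if j = i then \<zero>\<^bsub>X i\<^esub> else f j)"
        have s': "supp f' \<subseteq> supp f" "supp f' \<subseteq> S" using s by (auto simp: f'_def)
        have "finite (supp f')" using f s'(1) by (auto simp: DS_iff intro: finite_subset)
        then have f': "f' \<in> carrier DS" using f True unfolding DS_iff by (simp add: f'_def X_simps)
        have si: "single I X i (f i) \<in> carrier DS" using linearD(1)[OF single_linear[OF True]] f True by
            (simp add: DS_iff)
        have "f = single I X i (f i) \<oplus>\<^bsub>DS\<^esub> f'"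
          by (rule extensionalityI[of f I]) (use f True in \<open>auto simp: DS_iff DS_ops single_def f'_def
              X_simps\<close>)
        moreover have "h f' = h' f'" using insert.IH f' s' by blast
        moreover have "h (single I X i (f i)) = h' (single I X i (f i))" using eq True f by (simp add:
            DS_iff)
        ultimately show ?thesis using linearD(2)[OF h(1) si f'] linearD(2)[OF h(2) si f'] by simp
      qed
    qed
  qed
  then show ?thesis using f by (auto simp: DS_iff)
qed

text \<open>The map sums the values \<open>g i (f i)\<close> over the support of \<open>f\<close>.
  Supports change under the operations, so \<open>h_eq\<close> first allows the sum to range over
  any larger finite index set.\<close>

lemma linear_DS_exists:
  assumes W: "left_module R W" and g: "\<And>i. i \<in> I \<Longrightarrow> linear R (X i) W (g i)"
  obtains h where "linear R DS W h" "\<And>i x. \<lbrakk>i \<in> I; x \<in> carrier (X i)\<rbrakk> \<Longrightarrow> h (single I X i x) = g i x"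
proof -
  interpret W: left_module R W by (rule W)
  have g0: "g i \<zero>\<^bsub>X i\<^esub> = \<zero>\<^bsub>W\<^esub>" if "i \<in> I" for i using linear_zero[OF X W g] that by simp
  define h where "h f = finsum W (\<lambda>i. g i (f i)) (supp f)" for f
  have gf: "g i (f i) \<in> carrier W" if "f \<in> carrier DS" "i \<in> I" for f i
    using that linearD(1)[OF g[OF that(2)]] by (simp add: DS_iff)
  have h_eq: "h f = finsum W (\<lambda>i. g i (f i)) J" if f: "f \<in> carrier DS" and J: "finite J" "J \<subseteq> I" "supp f \<subseteq>
      J" for f J
    unfolding h_def using J g0 gf[OF f] by (intro W.add.finprod_mono_neutral_cong_left) auto
  show ?thesis
  proof (rule that)
    show "linear R DS W h"
    proof (rule linearI)
      fix f assume f: "f \<in> carrier DS"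
      show "h f \<in> carrier W" unfolding h_def using gf[OF f] by (intro W.finsum_closed) auto
      {
        fix g' assume g': "g' \<in> carrier DS"
        let ?J = "supp f \<union> supp g'"
        have J: "finite ?J" "?J \<subseteq> I" using f g' by (auto simp: DS_iff)
        have "supp (f \<oplus>\<^bsub>DS\<^esub> g') \<subseteq> ?J" by (auto simp: DS_ops X_simps)
        then have "h (f \<oplus>\<^bsub>DS\<^esub> g') = finsum W (\<lambda>i. g i ((f \<oplus>\<^bsub>DS\<^esub> g') i)) ?J"
          using h_eq[OF DS_add_closed[OF f g'] J] by simp
        also have "\<dots> = finsum W (\<lambda>i. g i (f i) \<oplus>\<^bsub>W\<^esub> g i (g' i)) ?J"
          using J gf[OF f] gf[OF g'] f g' linearD(2)[OF g] by (intro W.finsum_cong') (auto simp: DS_iff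
              DS_ops)
        also have "\<dots> = finsum W (\<lambda>i. g i (f i)) ?J \<oplus>\<^bsub>W\<^esub> finsum W (\<lambda>i. g i (g' i)) ?J"
          using J gf[OF f] gf[OF g'] by (intro W.finsum_addf) auto
        also have "\<dots> = h f \<oplus>\<^bsub>W\<^esub> h g'"
          using h_eq[OF f J] h_eq[OF g' J] by simp
        finally show "h (f \<oplus>\<^bsub>DS\<^esub> g') = h f \<oplus>\<^bsub>W\<^esub> h g'" .
      }
      fix a assume a: "a \<in> carrier R"
      have sm: "a \<odot>\<^bsub>W\<^esub> finsum W k J = finsum W (\<lambda>i. a \<odot>\<^bsub>W\<^esub> k i) J" if "finite J" "k \<in> J \<rightarrow> carrier W" for k
          and J :: "'i set"
        using that
      proof (induction J)
        case empty
        then show ?case using W.smult_zero[OF a] by simp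
      next
        case (insert j J)
        then show ?case using a by (simp add: W.finsum_insert Pi_iff W.smult_r_distr W.finsum_closed)
      qed
      have J: "finite (supp f)" "supp f \<subseteq> I" using f by (auto simp: DS_iff)
      have "supp (a \<odot>\<^bsub>DS\<^esub> f) \<subseteq> supp f" using left_module.smult_zero[OF X a] by (auto simp: DS_ops)
      then have "h (a \<odot>\<^bsub>DS\<^esub> f) = finsum W (\<lambda>i. g i ((a \<odot>\<^bsub>DS\<^esub> f) i)) (supp f)"
        using h_eq[OF DS_smult_closed[OF a f] J] by simp
      also have "\<dots> = finsum W (\<lambda>i. a \<odot>\<^bsub>W\<^esub> g i (f i)) (supp f)"
        using a gf[OF f] f linearD(3)[OF g] by (intro W.finsum_cong') (auto simp: DS_iff DS_ops)
      also have "\<dots> = a \<odot>\<^bsub>W\<^esub> h f"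
        unfolding h_def using J gf[OF f] by (intro sm[symmetric]) auto
      finally show "h (a \<odot>\<^bsub>DS\<^esub> f) = a \<odot>\<^bsub>W\<^esub> h f" .
    qed
    fix i x assume i: "i \<in> I" and x: "x \<in> carrier (X i)"
    have "h (single I X i x) = finsum W (\<lambda>j. g j (single I X i x j)) {i}"
      by (rule h_eq) (use i x linearD(1)[OF single_linear[OF i]] in \<open>auto simp: single_def\<close>)
    then show "h (single I X i x) = g i x"
      using i x linearD(1)[OF g[OF i] x] by (simp add: W.finsum_insert single_def)
  qed
qed

end

section \<open>The category of modules\<close>

lemma small_image: "small u A \<Longrightarrow> small u (f ` A)"
  unfolding small_def using card_of_image by (rule ordLeq_ordLess_trans)

lemma small_inj_on: "small u B \<Longrightarrow> inj_on f A \<Longrightarrow> f ` A \<subseteq> B \<Longrightarrow> small u A"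
  unfolding small_def using card_of_ordLeq[of A B] ordLeq_ordLess_trans by blast

lemma small_embedding:
  assumes "small (u :: 'u itself) A"
  obtains e :: "'a \<Rightarrow> 'u" where "inj_on e (A :: 'a set)"
proof -
  have "|A| \<le>o |UNIV :: 'u set|" using assms unfolding small_def by (rule ordLess_imp_ordLeq)
  then show ?thesis using that card_of_ordLeq[of A "UNIV :: 'u set"] by auto
qed

lemma small_itself: "small u A \<longleftrightarrow> small TYPE('u) A" for u :: "'u itself"
  by (simp add: small_def)

locale module_universe =
  fixes R :: "('r, 'x) ring_scheme" and u :: "'u itself"
  assumes R: "ring R" and U: "universe_for u R"
begin

sublocale R: ring R by (rule R)

abbreviation M :: "(('r, 'u) module, 'u \<Rightarrow> 'u) category" where
  "M \<equiv> ModCat R"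

lemma infinite_UNIV: "infinite (UNIV :: 'u set)"
proof
  assume "finite (UNIV :: 'u set)"
  moreover have "|Pow (UNIV :: nat set)| \<le>o |UNIV :: 'u set|"
    using U unfolding universe_for_def small_def by (auto intro: ordLess_imp_ordLeq)
  ultimately have "finite (Pow (UNIV :: nat set))" using card_of_ordLeq_finite by blast
  then show False using infinite_UNIV_nat unfolding finite_Pow_iff by (rule notE[rotated])
qed

text \<open>The form in which regularity of the universe is used: it yields closure of small sets
  under small unions and small disjoint unions.\<close>

lemma stable_UNIV: "stable |UNIV :: 'u set|"
  using U infinite_UNIV unfolding universe_for_def
  by (intro regularCard_stable) (simp_all add: Field_card_of card_of_card_order_on)

lemma small_Sigma: "\<lbrakk>small u A; \<And>a. a \<in> A \<Longrightarrow> small u (B a)\<rbrakk> \<Longrightarrow> small u (SIGMA a:A. B a)"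
  unfolding small_def by (rule stable_elim[OF stable_UNIV])

lemma small_nat: "small u (UNIV :: nat set)"
  using U card_of_Pow[of "UNIV :: nat set"] unfolding universe_for_def small_def by (blast intro:
      ordLess_transitive)

lemma small_countable_set: "countable A \<Longrightarrow> small u A"
  unfolding countable_def using small_inj_on[OF small_nat] by blast

lemma small_finite_set: "finite A \<Longrightarrow> small u A"
  by (rule small_countable_set) (rule countable_finite)

lemma small_carrier_R: "small u (carrier R)"
  using U card_of_Pow[of "carrier R"] unfolding universe_for_def small_def by (blast intro:
      ordLess_transitive)

lemma small_UNION: "\<lbrakk>small u A; \<And>a. a \<in> A \<Longrightarrow> small u (B a)\<rbrakk> \<Longrightarrow> small u (\<Union>a\<in>A. B a)"
  unfolding small_def by (rule stable_UNION[OF stable_UNIV])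

text \<open>Finite subsets are the sets of entries of finite lists, and lists of a fixed length are
  iterated pairs.\<close>

lemma small_finite_subsets:
  assumes A: "small u A"
  shows "small u {B. finite B \<and> B \<subseteq> A}"
proof -
  have L: "small u {xs. length xs = n \<and> set xs \<subseteq> A}" for n
  proof (induction n)
    case 0
    have "{xs. length xs = 0 \<and> set xs \<subseteq> A} = {[]}" by auto
    then show ?case by (simp add: small_finite_set)
  next
    case (Suc n)
    have "{xs. length xs = Suc n \<and> set xs \<subseteq> A} = (\<lambda>(x, xs). x # xs) ` (SIGMA x:A. {xs. length xs = n \<and> set
        xs \<subseteq> A})"
      by (force simp: length_Suc_conv)
    then show ?case using small_image[OF small_Sigma[OF A Suc]] by simp
  qed
  have "{B. finite B \<and> B \<subseteq> A} \<subseteq> set ` (\<Union>n. {xs. length xs = n \<and> set xs \<subseteq> A})"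
  proof
    fix B assume B: "B \<in> {B. finite B \<and> B \<subseteq> A}"
    then obtain xs where "set xs = B" using finite_list by blast
    then show "B \<in> set ` (\<Union>n. {xs. length xs = n \<and> set xs \<subseteq> A})" using B by (intro image_eqI[of _ _ xs])
        auto
  qed
  then show ?thesis by (rule small_mono) (intro small_image small_UNION small_nat L)
qed

lemma M_simps [simp]:
  "N \<in> objs M \<longleftrightarrow> left_module R N \<and> small u (carrier N)"
  "carrier (Hom M N L) = linear_maps R N L"
  "add (Hom M N L) = (\<lambda>f g. \<lambda>x\<in>carrier N. f x \<oplus>\<^bsub>L\<^esub> g x)"
  "zero (Hom M N L) = (\<lambda>x\<in>carrier N. \<zero>\<^bsub>L\<^esub>)"
  "cmp M N L P g f = compose (carrier N) g f"
  "idm M N = (\<lambda>x\<in>carrier N. x)"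
  by (simp_all add: ModCat_def small_itself[of u])

lemma compose_linear:
  assumes "left_module R N" "f \<in> linear_maps R N L" "g \<in> linear_maps R L P"
  shows "compose (carrier N) g f \<in> linear_maps R N P"
  using linear_restrict[OF assms(1) linear_compose[of R N L f P g]] assms(2,3) by (simp add: linear_maps_iff
      compose_def restrict_def)

lemma M_group:
  assumes N: "left_module R N" and L: "left_module R L"
  shows "abelian_group (Hom M N L)"
proof -
  interpret N: left_module R N by (rule N)
  interpret L: left_module R L by (rule L)
  have add: "(\<lambda>x\<in>carrier N. f x \<oplus>\<^bsub>L\<^esub> g x) \<in> linear_maps R N L" if "f \<in> linear_maps R N L" "g \<in> linear_maps R
      N L" for f g
    by (rule linear_restrict[OF N])
      (rule linearI, use linear_mapsD[OF that(1)] linear_mapsD[OF that(2)] in \<open>simp_all add: L.a_ac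
          L.smult_r_distr\<close>)
  show ?thesis
  proof (rule abelian_groupI)
    fix f g h assume "f \<in> mor M N L" "g \<in> mor M N L" "h \<in> mor M N L"
    then have f: "f \<in> linear_maps R N L" and g: "g \<in> linear_maps R N L" and h: "h \<in> linear_maps R N L" by
        simp_all
    show "f \<oplus>\<^bsub>Hom M N L\<^esub> g \<in> mor M N L" using add[OF f g] by simp
    show "f \<oplus>\<^bsub>Hom M N L\<^esub> g \<oplus>\<^bsub>Hom M N L\<^esub> h = f \<oplus>\<^bsub>Hom M N L\<^esub> (g \<oplus>\<^bsub>Hom M N L\<^esub> h)"
      using linear_mapsD(1)[OF f] linear_mapsD(1)[OF g] linear_mapsD(1)[OF h] by (auto simp: fun_eq_iff
          restrict_def L.a_assoc)
    show "f \<oplus>\<^bsub>Hom M N L\<^esub> g = g \<oplus>\<^bsub>Hom M N L\<^esub> f"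
      using linear_mapsD(1)[OF f] linear_mapsD(1)[OF g] by (auto simp: fun_eq_iff restrict_def L.a_comm)
  next
    show "\<zero>\<^bsub>Hom M N L\<^esub> \<in> mor M N L"
      unfolding M_simps by (rule linear_restrict[OF N]) (rule linearI, simp_all add: L.smult_zero)
    fix f assume "f \<in> mor M N L"
    then have f: "f \<in> linear_maps R N L" by simp
    show "\<zero>\<^bsub>Hom M N L\<^esub> \<oplus>\<^bsub>Hom M N L\<^esub> f = f"
      using linear_mapsD(1,4)[OF f] by (intro extensionalityI[of _ "carrier N"]) auto
    have neg: "\<ominus>\<^bsub>L\<^esub> (a \<odot>\<^bsub>L\<^esub> x) = a \<odot>\<^bsub>L\<^esub> (\<ominus>\<^bsub>L\<^esub> x)" if "a \<in> carrier R" "x \<in> carrier L" for a x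
      using that L.smult_r_distr[of a "\<ominus>\<^bsub>L\<^esub> x" x] by (intro L.minus_equality) (simp_all add: L.l_neg
          L.smult_zero)
    have m: "(\<lambda>x\<in>carrier N. \<ominus>\<^bsub>L\<^esub> f x) \<in> linear_maps R N L"
      by (rule linear_restrict[OF N]) (rule linearI, use linear_mapsD[OF f] in \<open>simp_all add: L.minus_add
          neg\<close>)
    have eq: "(\<lambda>x\<in>carrier N. \<ominus>\<^bsub>L\<^esub> f x) \<oplus>\<^bsub>Hom M N L\<^esub> f = \<zero>\<^bsub>Hom M N L\<^esub>"
      using linear_mapsD(1)[OF f] by (auto simp: fun_eq_iff restrict_def L.l_neg)
    show "\<exists>g\<in>mor M N L. g \<oplus>\<^bsub>Hom M N L\<^esub> f = \<zero>\<^bsub>Hom M N L\<^esub>"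
      using eq by (intro bexI[of _ "\<lambda>x\<in>carrier N. \<ominus>\<^bsub>L\<^esub> f x"]) (simp_all only: M_simps m)
  qed
qed

lemma M_preadditive: "preadditive M"
proof (intro preadditive.intro categ.intro preadditive_axioms.intro)
  show "abelian_group (Hom M N L)" if "N \<in> objs M" "L \<in> objs M" for N L using that M_group by simp
  show "cmp M N L P g f \<in> mor M N P" if "f \<in> mor M N L" "g \<in> mor M L P" "N \<in> objs M" for N L P f g
    using that by (auto intro: compose_linear)
  show "idm M N \<in> mor M N N" if "N \<in> objs M" for N
  proof -
    interpret N: left_module R N using that by simp
    show ?thesis unfolding M_simps by (rule linear_restrict[OF N.left_module_axioms]) (rule linearI,
        simp_all)
  qed
  show "cmp M W X Z (cmp M X Y Z h g) f = cmp M W Y Z h (cmp M W X Y g f)"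
    if "f \<in> mor M W X" "g \<in> mor M X Y" "h \<in> mor M Y Z" for W X Y Z f g h
    using that linear_mapsD(1)[of f] by (auto simp: compose_def fun_eq_iff restrict_def)
  show "cmp M X Y Y (idm M Y) f = f" "cmp M X X Y f (idm M X) = f" if "f \<in> mor M X Y" for X Y f
    using that linear_mapsD(1,4)[of f R X Y] by (auto simp: compose_def fun_eq_iff restrict_def
        extensional_def)
  fix X Y Z f g g'
  assume f: "f \<in> mor M X Y" and g: "g \<in> mor M Y Z" "g' \<in> mor M Y Z"
  show "cmp M X Y Z (g \<oplus>\<^bsub>Hom M Y Z\<^esub> g') f = cmp M X Y Z g f \<oplus>\<^bsub>Hom M X Z\<^esub> cmp M X Y Z g' f"
    using f linear_mapsD(1)[of f] by (auto simp: compose_def fun_eq_iff restrict_def)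
next
  fix X Y Z f f' g
  assume f: "f \<in> mor M X Y" "f' \<in> mor M X Y" and g: "g \<in> mor M Y Z"
  show "cmp M X Y Z g (f \<oplus>\<^bsub>Hom M X Y\<^esub> f') = cmp M X Y Z g f \<oplus>\<^bsub>Hom M X Z\<^esub> cmp M X Y Z g f'"
    using f g linear_mapsD(1)[of f R X Y] linear_mapsD(1)[of f' R X Y] linear_mapsD(2)[of g R Y Z]
    by (auto simp: compose_def fun_eq_iff restrict_def)
qed

sublocale M: preadditive_cat M
  by (rule preadditive_cat.intro) (rule M_preadditive)

text \<open>The coproduct is the direct sum, which has to be shown small before it can be copied
  into \<open>'u\<close>. The two statements on elements, finite support and separation by the
  projections, become countable supports and joint monicity for complexes.\<close>

lemma M_coproduct:
  assumes I: "small u I" and X: "X ` I \<subseteq> objs M"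
  obtains Z \<iota> where "is_coproduct M I X Z \<iota>"
    "\<And>z. z \<in> carrier Z \<Longrightarrow> finite {i\<in>I. coproj M I X Z \<iota> i z \<noteq> \<zero>\<^bsub>X i\<^esub>}"
    "\<And>z. \<lbrakk>z \<in> carrier Z; \<And>i. i \<in> I \<Longrightarrow> coproj M I X Z \<iota> i z = \<zero>\<^bsub>X i\<^esub>\<rbrakk> \<Longrightarrow> z = \<zero>\<^bsub>Z\<^esub>"
proof -
  have Xi: "left_module R (X i)" "small u (carrier (X i))" if "i \<in> I" for i using X that by auto
  interpret D: module_family R I X by (rule module_family.intro[OF R Xi(1)])
  have "small u (carrier D.DS)"
  proof (rule small_inj_on)
    show "small u {B. finite B \<and> B \<subseteq> (SIGMA i:I. carrier (X i))}"
      by (intro small_finite_subsets small_Sigma I Xi)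
    \<comment> \<open>An element of the direct sum is recovered from the finite graph of its
      restriction to its support.\<close>
    show "inj_on (\<lambda>f. (\<lambda>i. (i, f i)) ` D.supp f) (carrier D.DS)"
    proof (rule inj_onI)
      fix f g assume f: "f \<in> carrier D.DS" and g: "g \<in> carrier D.DS"
        and eq: "(\<lambda>i. (i, f i)) ` D.supp f = (\<lambda>i. (i, g i)) ` D.supp g"
      show "f = g"
      proof (rule extensionalityI[of f I])
        fix i assume i: "i \<in> I"
        have "(i, f i) \<in> (\<lambda>i. (i, g i)) ` D.supp g" if "f i \<noteq> \<zero>\<^bsub>X i\<^esub>"
          unfolding eq[symmetric] using i that by auto
        moreover have "(i, g i) \<in> (\<lambda>i. (i, f i)) ` D.supp f" if "g i \<noteq> \<zero>\<^bsub>X i\<^esub>"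
          unfolding eq using i that by auto
        ultimately show "f i = g i" by (cases "f i = \<zero>\<^bsub>X i\<^esub>"; cases "g i = \<zero>\<^bsub>X i\<^esub>") auto
      qed (use f g in \<open>auto simp: D.DS_iff\<close>)
    qed
    show "(\<lambda>f. (\<lambda>i. (i, f i)) ` D.supp f) ` carrier D.DS \<subseteq> {B. finite B \<and> B \<subseteq> (SIGMA i:I. carrier (X i))}"
      by (auto simp: D.DS_iff)
  qed
  then have sm: "small u (e ` carrier D.DS)" for e :: "_ \<Rightarrow> 'u" by (rule small_image)
  obtain e :: "_ \<Rightarrow> 'u" where e: "inj_on e (carrier D.DS)" using small_embedding[OF \<open>small u (carrier D.DS)\<close>]
      by blast
  define Z where "Z = transport e D.DS"
  define k where "k = inv_into (carrier D.DS) e"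
  note tr = transport[OF D.DS_module e, folded Z_def k_def]
  have ke: "k (e f) = f" if "f \<in> carrier D.DS" for f using e that by (simp add: k_def)
  have ek: "k z \<in> carrier D.DS \<and> e (k z) = z" if "z \<in> carrier Z" for z
    using that tr(4) by (auto simp: k_def f_inv_into_f inv_into_into)
  have Z: "Z \<in> objs M" using tr(1,4) sm by simp
  define \<iota> where "\<iota> i = (\<lambda>x\<in>carrier (X i). e (single I X i x))" for i
  have \<iota>: "\<iota> i \<in> linear_maps R (X i) Z" if "i \<in> I" for i
    unfolding \<iota>_def by (rule linear_restrict[OF Xi(1)[OF that] linear_compose[OF D.single_linear[OF that]
        tr(2)]])
  have single: "single I X i x \<in> carrier D.DS" if "i \<in> I" "x \<in> carrier (X i)" for i x
    using linearD(1)[OF D.single_linear[OF that(1)] that(2)] .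
  have cop: "is_coproduct M I X Z \<iota>"
  proof (rule is_coproductI)
    show "Z \<in> objs M" by (rule Z)
    show "\<iota> i \<in> mor M (X i) Z" if "i \<in> I" for i using \<iota>[OF that] by simp
    fix W assume "W \<in> objs M"
    then have W: "left_module R W" by simp
    {
      fix g assume g: "\<And>i. i \<in> I \<Longrightarrow> g i \<in> mor M (X i) W"
      then have g': "linear R (X i) W (g i)" if "i \<in> I" for i using that by (simp add: linear_maps_iff)
      obtain h where h: "linear R D.DS W h" "\<And>i x. \<lbrakk>i \<in> I; x \<in> carrier (X i)\<rbrakk> \<Longrightarrow> h (single I X i x) = g i x"
        using D.linear_DS_exists[OF W g'] by blast
      have "(\<lambda>z\<in>carrier Z. h (k z)) \<in> linear_maps R Z W"
        by (rule linear_restrict[OF tr(1) linear_compose[OF tr(3) h(1)]])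
      moreover have "compose (carrier (X i)) (\<lambda>z\<in>carrier Z. h (k z)) (\<iota> i) = g i" if i: "i \<in> I" for i
      proof (rule linear_maps_eqI)
        show "compose (carrier (X i)) (\<lambda>z\<in>carrier Z. h (k z)) (\<iota> i) \<in> linear_maps R (X i) W"
          by (rule compose_linear[OF Xi(1)[OF i] \<iota>[OF i]]) fact
        show "g i \<in> linear_maps R (X i) W" using g[OF i] by simp
        fix x assume x: "x \<in> carrier (X i)"
        then show "compose (carrier (X i)) (\<lambda>z\<in>carrier Z. h (k z)) (\<iota> i) x = g i x"
          using single[OF i x] h(2)[OF i x] tr(4) by (simp add: compose_def \<iota>_def ke)
      qed
      ultimately show "\<exists>h. h \<in> mor M Z W \<and> (\<forall>i\<in>I. cmp M (X i) Z W h (\<iota> i) = g i)" by auto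
    next
      fix h h' assume h: "h \<in> mor M Z W" "h' \<in> mor M Z W"
        and eq: "\<And>i. i \<in> I \<Longrightarrow> cmp M (X i) Z W h (\<iota> i) = cmp M (X i) Z W h' (\<iota> i)"
      have lin: "linear R D.DS W (\<lambda>f. h (e f))" "linear R D.DS W (\<lambda>f. h' (e f))"
        using h linear_compose[OF tr(2), of W h] linear_compose[OF tr(2), of W h'] by (simp_all add:
            linear_maps_iff)
      have *: "h (e f) = h' (e f)" if "f \<in> carrier D.DS" for f
      proof (rule D.linear_DS_eqI[OF W lin _ that])
        fix i x assume ix: "i \<in> I" "x \<in> carrier (X i)"
        then show "h (e (single I X i x)) = h' (e (single I X i x))"
          using fun_cong[OF eq[OF ix(1)], of x] by (simp add: compose_def \<iota>_def)
      qed
      show "h = h'"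
        by (rule linear_maps_eqI[of h R Z W]) (use h *[of "k _"] ek in \<open>auto, metis\<close>)
    }
  qed
  \<comment> \<open>The projections are evaluations at an index, read through the copy.\<close>
  have pr: "coproj M I X Z \<iota> i = (\<lambda>z\<in>carrier Z. k z i)" if i: "i \<in> I" for i
  proof (rule M.coproj_unique[OF cop X i])
    show "(\<lambda>z\<in>carrier Z. k z i) \<in> mor M Z (X i)"
      unfolding M_simps by (rule linear_restrict[OF tr(1) linear_compose[OF tr(3) D.proj_linear[OF i]]])
    fix j assume j: "j \<in> I"
    show "cmp M (X j) Z (X i) (\<lambda>z\<in>carrier Z. k z i) (\<iota> j) = (if j = i then idm M (X i) else \<zero>\<^bsub>Hom M (X j) (X
        i)\<^esub>)"
    proof -
      have "\<iota> j x \<in> carrier Z" "k (\<iota> j x) = single I X j x" if "x \<in> carrier (X j)" for x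
        using linear_mapsD(1)[OF \<iota>[OF j] that] single[OF j that] that by (simp_all add: \<iota>_def ke)
      then show ?thesis using i by (auto simp: compose_def fun_eq_iff restrict_def single_def)
    qed
  qed
  show ?thesis
  proof (rule that[OF cop])
    fix z assume z: "z \<in> carrier Z"
    then have kz: "k z \<in> carrier D.DS" using ek by blast
    then show "finite {i\<in>I. coproj M I X Z \<iota> i z \<noteq> \<zero>\<^bsub>X i\<^esub>}"
      using z by (simp add: pr D.DS_iff cong: conj_cong)
    assume "\<And>i. i \<in> I \<Longrightarrow> coproj M I X Z \<iota> i z = \<zero>\<^bsub>X i\<^esub>"
    then have "k z = \<zero>\<^bsub>D.DS\<^esub>"
      using z kz by (intro extensionalityI[of _ I]) (auto simp: pr D.DS_iff D.DS_ops)
    then show "z = \<zero>\<^bsub>Z\<^esub>" using ek[OF z] linear_zero[OF D.DS_module tr(1,2)] by simp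
  qed
qed

end

section \<open>Complexes of modules\<close>

context module_universe
begin

abbreviation C where "C \<equiv> Ch M"

lemma complexM:
  assumes "X \<in> complexes M"
  shows "left_module R (fst X n)" "small u (carrier (fst X n))" "snd X n \<in> linear_maps R (fst X n) (fst X (n
      - 1))"
    "x \<in> carrier (fst X n) \<Longrightarrow> snd X n x \<in> carrier (fst X (n - 1))"
    "x \<in> carrier (fst X n) \<Longrightarrow> snd X (n - 1) (snd X n x) = \<zero>\<^bsub>fst X (n - 2)\<^esub>"
proof -
  show 1: "left_module R (fst X n)" "small u (carrier (fst X n))" "snd X n \<in> linear_maps R (fst X n) (fst X
      (n - 1))"
    using complexesD(1,2)[OF assms, of n] by simp_all
  show "x \<in> carrier (fst X n) \<Longrightarrow> snd X n x \<in> carrier (fst X (n - 1))" by (rule linear_mapsD(1)[OF 1(3)])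
  show "x \<in> carrier (fst X n) \<Longrightarrow> snd X (n - 1) (snd X n x) = \<zero>\<^bsub>fst X (n - 2)\<^esub>"
    using fun_cong[OF complexesD(3)[OF assms, of n], of x] by (simp add: compose_def)
qed

lemma chainM:
  assumes "f \<in> chain_maps M X Y"
  shows "f n \<in> linear_maps R (fst X n) (fst Y n)" "x \<in> carrier (fst X n) \<Longrightarrow> f n x \<in> carrier (fst Y n)"
    "x \<in> carrier (fst X n) \<Longrightarrow> snd Y n (f n x) = f (n - 1) (snd X n x)"
proof -
  show 1: "f n \<in> linear_maps R (fst X n) (fst Y n)" using chain_maps_mor[OF assms, of n] by simp
  show "x \<in> carrier (fst X n) \<Longrightarrow> f n x \<in> carrier (fst Y n)" by (rule linear_mapsD(1)[OF 1])
  show "x \<in> carrier (fst X n) \<Longrightarrow> snd Y n (f n x) = f (n - 1) (snd X n x)"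
    using fun_cong[OF chain_maps_comm[OF assms, of n], of x] by (simp add: compose_def)
qed

lemma complexM_I:
  assumes "\<And>n. left_module R (X n)" "\<And>n. small u (carrier (X n))" "\<And>n. d n \<in> linear_maps R (X n) (X (n -
      1))"
    "\<And>n x. x \<in> carrier (X n) \<Longrightarrow> d (n - 1) (d n x) = \<zero>\<^bsub>X (n - 2)\<^esub>"
  shows "(X, d) \<in> complexes M"
  unfolding complexes_iff using assms by (simp add: compose_def cong: restrict_cong)

lemma chainM_I:
  assumes "\<And>n. f n \<in> linear_maps R (fst X n) (fst Y n)" "\<And>n x. x \<in> carrier (fst X n) \<Longrightarrow> snd Y n (f n x) = f
      (n - 1) (snd X n x)"
  shows "f \<in> chain_maps M X Y"
  unfolding chain_maps_iff using assms by (simp add: compose_def cong: restrict_cong)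

text \<open>In each degree the projections of the coproduct of complexes are those of the coproduct
  of modules, so the statements on elements carry over.\<close>

lemma Ch_coproduct:
  assumes I: "small u I" and X: "X ` I \<subseteq> complexes M"
  obtains Z \<iota> where "is_coproduct C I X Z \<iota>" "jointly_monic C I X Z \<iota>"
    "\<And>n z. z \<in> carrier (fst Z n) \<Longrightarrow> finite {i\<in>I. coproj C I X Z \<iota> i n z \<noteq> \<zero>\<^bsub>fst (X i) n\<^esub>}"
proof -
  define P where "P n Z \<iota> \<longleftrightarrow> is_coproduct M I (\<lambda>i. fst (X i) n) Z \<iota> \<and>
      (\<forall>z\<in>carrier Z. finite {i\<in>I. coproj M I (\<lambda>i. fst (X i) n) Z \<iota> i z \<noteq> \<zero>\<^bsub>fst (X i) n\<^esub>}) \<and>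
      (\<forall>z\<in>carrier Z. (\<forall>i\<in>I. coproj M I (\<lambda>i. fst (X i) n) Z \<iota> i z = \<zero>\<^bsub>fst (X i) n\<^esub>) \<longrightarrow> z = \<zero>\<^bsub>Z\<^esub>)" for n Z \<iota>
  have Xn: "(\<lambda>i. fst (X i) n) ` I \<subseteq> objs M" for n using X complexesD(1)[of _ M n] by blast
  have "\<exists>Z \<iota>. P n Z \<iota>" for n
    by (rule M_coproduct[OF I Xn[of n]]) (unfold P_def, blast)
  then have "\<forall>n. \<exists>Z \<iota>. P n Z \<iota>" by blast
  then obtain Z0 \<iota>0 where P: "\<And>n. P n (Z0 n) (\<iota>0 n)" by metis
  obtain d where ZC: "(Z0, d) \<in> complexes M" and \<iota>: "\<And>i. i \<in> I \<Longrightarrow> (\<lambda>n. \<iota>0 n i) \<in> chain_maps M (X i) (Z0, d)"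
    by (rule M.degreewise_coproduct_complex[OF X, of Z0 "\<lambda>i n. \<iota>0 n i"]) (use P in \<open>auto simp: P_def\<close>)
  define Z where "Z = (Z0, d)"
  define \<iota>1 where "\<iota>1 i n = \<iota>0 n i" for i n
  have ZC: "Z \<in> complexes M" and \<iota>: "\<And>i. i \<in> I \<Longrightarrow> \<iota>1 i \<in> chain_maps M (X i) Z"
    using ZC \<iota> by (simp_all add: Z_def \<iota>1_def[abs_def])
  have dw: "is_coproduct M I (\<lambda>i. fst (X i) n) (fst Z n) (\<lambda>i. \<iota>1 i n)"
    and fin: "\<And>z. z \<in> carrier (fst Z n) \<Longrightarrow> finite {i\<in>I. coproj M I (\<lambda>i. fst (X i) n) (fst Z n) (\<lambda>i. \<iota>1 i n) i
        z \<noteq> \<zero>\<^bsub>fst (X i) n\<^esub>}"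
    and mon: "\<And>z. \<lbrakk>z \<in> carrier (fst Z n); \<And>i. i \<in> I \<Longrightarrow> coproj M I (\<lambda>i. fst (X i) n) (fst Z n) (\<lambda>i. \<iota>1 i n) i
        z = \<zero>\<^bsub>fst (X i) n\<^esub>\<rbrakk> \<Longrightarrow> z = \<zero>\<^bsub>fst Z n\<^esub>"
    for n using P[of n] by (auto simp: P_def Z_def \<iota>1_def)
  have cop: "is_coproduct C I X Z \<iota>1" by (rule M.degreewise_coproduct_Ch[OF X ZC dw \<iota>])
  have XC: "X ` I \<subseteq> objs C" using X by simp
  have pr: "coproj M I (\<lambda>i. fst (X i) n) (fst Z n) (\<lambda>i. \<iota>1 i n) i = coproj C I X Z \<iota>1 i n" if i: "i \<in> I" for
      i n
  proof (rule M.coproj_unique[OF dw Xn i])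
    have p: "coproj C I X Z \<iota>1 i \<in> chain_maps M Z (X i)" using M.Ch.coproj_mor[OF cop XC i] by simp
    then show "coproj C I X Z \<iota>1 i n \<in> mor M (fst Z n) (fst (X i) n)" by (rule chain_maps_mor)
    show "cmp M (fst (X j) n) (fst Z n) (fst (X i) n) (coproj C I X Z \<iota>1 i n) (\<iota>1 j n) =
      (if j = i then idm M (fst (X i) n) else \<zero>\<^bsub>Hom M (fst (X j) n) (fst (X i) n)\<^esub>)" if j: "j \<in> I" for j
      using fun_cong[OF M.Ch.coproj_inj[OF cop XC i j], of n] by (simp split: if_splits del: M_simps)
  qed
  show ?thesis
  proof (rule that[OF cop])
    show "finite {i\<in>I. coproj C I X Z \<iota>1 i n z \<noteq> \<zero>\<^bsub>fst (X i) n\<^esub>}" if "z \<in> carrier (fst Z n)" for n z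
      using fin[OF that] by (simp add: pr cong: conj_cong)
    show "jointly_monic C I X Z \<iota>1"
      unfolding jointly_monic_def
    proof (intro ballI impI)
      fix A f assume "A \<in> objs C" and "f \<in> mor C A Z" and 0: "\<forall>i\<in>I. cmp C A Z (X i) (coproj C I X Z \<iota>1 i) f
          = \<zero>\<^bsub>Hom C A (X i)\<^esub>"
      then have A: "A \<in> complexes M" and f: "f \<in> chain_maps M A Z" by simp_all
      have "f n x = \<zero>\<^bsub>fst Z n\<^esub>" if x: "x \<in> carrier (fst A n)" for n x
      proof (rule mon[OF chainM(2)[OF f x]])
        fix i assume i: "i \<in> I"
        show "coproj M I (\<lambda>i. fst (X i) n) (fst Z n) (\<lambda>i. \<iota>1 i n) i (f n x) = \<zero>\<^bsub>fst (X i) n\<^esub>"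
          using fun_cong[OF fun_cong[OF bspec[OF 0 i], of n], of x] x by (simp add: pr[OF i] compose_def)
      qed
      then have "f n = (\<lambda>x\<in>carrier (fst A n). \<zero>\<^bsub>fst Z n\<^esub>)" for n
        using linear_mapsD(4)[OF chainM(1)[OF f, of n]] by (intro extensionalityI[of _ "carrier (fst A n)"])
            auto
      then show "f = \<zero>\<^bsub>Hom C A Z\<^esub>" by (simp add: fun_eq_iff)
    qed
  qed
qed

subsection \<open>Epimorphisms of complexes\<close>

text \<open>Cosets would be sets of elements of \<open>'u\<close>; to keep the carrier inside
  \<open>'u\<close>, a chosen element represents each coset. The last conclusion says when two
  elements are identified, without reference to that choice.\<close>

lemma cokernel_exists:
  assumes X: "left_module R X" and Y: "left_module R Y" and sm: "small u (carrier Y)" and f: "f \<in>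
      linear_maps R X Y"
  obtains Q q where "left_module R Q" "small u (carrier Q)" "q \<in> linear_maps R Y Q" "q ` carrier Y = carrier
      Q"
    "\<And>y z. \<lbrakk>y \<in> carrier Y; z \<in> carrier Y\<rbrakk> \<Longrightarrow> q y = q z \<longleftrightarrow> (\<exists>x\<in>carrier X. y = z \<oplus>\<^bsub>Y\<^esub> f x)"
proof -
  interpret X: left_module R X by (rule X)
  interpret Y: left_module R Y by (rule Y)
  note f = linear_mapsD[OF f]
  define E where "E y z \<longleftrightarrow> (\<exists>x\<in>carrier X. y = z \<oplus>\<^bsub>Y\<^esub> f x)" for y z
  have f0: "f \<zero>\<^bsub>X\<^esub> = \<zero>\<^bsub>Y\<^esub>" using linear_zero[OF X Y] assms(4) by (simp add: linear_maps_iff)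
  have refl: "E y y" if "y \<in> carrier Y" for y
    unfolding E_def using that f0 by (intro bexI[of _ "\<zero>\<^bsub>X\<^esub>"]) simp_all
  have sym: "E z y" if "E y z" "z \<in> carrier Y" for y z
  proof -
    obtain x where x: "x \<in> carrier X" "y = z \<oplus>\<^bsub>Y\<^esub> f x" using \<open>E y z\<close> by (auto simp: E_def)
    have "f x \<oplus>\<^bsub>Y\<^esub> f (\<ominus>\<^bsub>X\<^esub> x) = \<zero>\<^bsub>Y\<^esub>" using f(2)[of x "\<ominus>\<^bsub>X\<^esub> x"] x(1) f0 by (simp add: X.M.r_neg)
    then show ?thesis
      unfolding E_def using x that f(1) by (intro bexI[of _ "\<ominus>\<^bsub>X\<^esub> x"]) (simp_all add: Y.M.a_assoc)
  qed
  have trans: "E y w" if "E y z" "E z w" "w \<in> carrier Y" for y z w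
  proof -
    obtain x where x: "x \<in> carrier X" "y = z \<oplus>\<^bsub>Y\<^esub> f x" using \<open>E y z\<close> unfolding E_def by blast
    obtain x' where x': "x' \<in> carrier X" "z = w \<oplus>\<^bsub>Y\<^esub> f x'" using \<open>E z w\<close> unfolding E_def by blast
    from x x' show ?thesis
      unfolding E_def using that(3) f(1,2) by (intro bexI[of _ "x' \<oplus>\<^bsub>X\<^esub> x"]) (simp_all add: Y.M.a_assoc)
  qed
  have addE: "E (y \<oplus>\<^bsub>Y\<^esub> z) (y' \<oplus>\<^bsub>Y\<^esub> z')" if "E y y'" "E z z'" "y' \<in> carrier Y" "z' \<in> carrier Y" for y z y'
      z'
  proof -
    obtain x where x: "x \<in> carrier X" "y = y' \<oplus>\<^bsub>Y\<^esub> f x" using \<open>E y y'\<close> unfolding E_def by blast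
    obtain x' where x': "x' \<in> carrier X" "z = z' \<oplus>\<^bsub>Y\<^esub> f x'" using \<open>E z z'\<close> unfolding E_def by blast
    from x x' show ?thesis
      unfolding E_def using that(3,4) f(1,2) by (intro bexI[of _ "x \<oplus>\<^bsub>X\<^esub> x'"]) (simp_all add: Y.M.a_ac)
  qed
  have smultE: "E (a \<odot>\<^bsub>Y\<^esub> y) (a \<odot>\<^bsub>Y\<^esub> z)" if "a \<in> carrier R" "E y z" "z \<in> carrier Y" for a y z
  proof -
    obtain x where x: "x \<in> carrier X" "y = z \<oplus>\<^bsub>Y\<^esub> f x" using \<open>E y z\<close> unfolding E_def by blast
    then show ?thesis
      unfolding E_def using that(1,3) f(1,3) by (intro bexI[of _ "a \<odot>\<^bsub>X\<^esub> x"]) (simp_all add: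
          Y.smult_r_distr)
  qed
  define rep where "rep y = (SOME z. z \<in> carrier Y \<and> E z y)" for y
  have rep: "rep y \<in> carrier Y" "E (rep y) y" if "y \<in> carrier Y" for y
    using someI[of "\<lambda>z. z \<in> carrier Y \<and> E z y" y] refl[OF that] that by (auto simp: rep_def)
  have rep_eq: "rep y = rep z \<longleftrightarrow> E y z" if y: "y \<in> carrier Y" and z: "z \<in> carrier Y" for y z
  proof
    assume "rep y = rep z"
    then show "E y z" using rep[OF y] rep[OF z] sym trans y z by metis
  next
    assume "E y z"
    then have "(w \<in> carrier Y \<and> E w y) \<longleftrightarrow> (w \<in> carrier Y \<and> E w z)" for w
      using trans sym y z by blast
    then show "rep y = rep z" by (simp add: rep_def)
  qed
  define Q where "Q = module_of (rep ` carrier Y) (\<lambda>x y. rep (x \<oplus>\<^bsub>Y\<^esub> y)) (rep \<zero>\<^bsub>Y\<^esub>) (\<lambda>a x. rep (a \<odot>\<^bsub>Y\<^esub> x))"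
  have add: "rep (rep x \<oplus>\<^bsub>Y\<^esub> rep y) = rep (x \<oplus>\<^bsub>Y\<^esub> y)" if "x \<in> carrier Y" "y \<in> carrier Y" for x y
    using that rep by (subst rep_eq) (auto intro: addE)
  have smult: "rep (a \<odot>\<^bsub>Y\<^esub> rep x) = rep (a \<odot>\<^bsub>Y\<^esub> x)" if "a \<in> carrier R" "x \<in> carrier Y" for a x
    using that rep by (subst rep_eq) (auto intro: smultE)
  have Q: "left_module R Q"
    by (rule left_module_image[OF Y, of _ rep]) (simp_all add: Q_def add smult)
  show ?thesis
  proof (rule that[OF Q])
    show "small u (carrier Q)" using small_image[OF sm] by (simp add: Q_def)
    show "restrict rep (carrier Y) \<in> linear_maps R Y Q"
      by (rule linear_restrict[OF Y]) (rule linearI, simp_all add: Q_def add smult)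
    show "restrict rep (carrier Y) ` carrier Y = carrier Q" by (simp add: Q_def)
    show "restrict rep (carrier Y) y = restrict rep (carrier Y) z \<longleftrightarrow> (\<exists>x\<in>carrier X. y = z \<oplus>\<^bsub>Y\<^esub> f x)"
      if "y \<in> carrier Y" "z \<in> carrier Y" for y z
      using that rep_eq[OF that] by (simp add: E_def)
  qed
qed

text \<open>
  The cokernel projection and zero agree after composition with the epimorphism, so the projection vanishes.
\<close>

lemma epi_surjective:
  assumes X: "X \<in> complexes M" and Y: "Y \<in> complexes M" and e: "epi C X Y e" and y: "y \<in> carrier (fst Y n)"
  shows "\<exists>x\<in>carrier (fst X n). e n x = y"
proof -
  have ec: "e \<in> chain_maps M X Y" using e by (simp add: epi_def)
  define P where "P n Q q \<longleftrightarrow> left_module R Q \<and> small u (carrier Q) \<and> q \<in> linear_maps R (fst Y n) Q \<and> q `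
      carrier (fst Y n) = carrier Q \<and>
    (\<forall>y\<in>carrier (fst Y n). \<forall>z\<in>carrier (fst Y n). q y = q z \<longleftrightarrow> (\<exists>x\<in>carrier (fst X n). y = z \<oplus>\<^bsub>fst Y n\<^esub> e n
        x))" for n Q q
  have "\<exists>Q q. P n Q q" for n
    by (rule cokernel_exists[OF complexM(1)[OF X, of n] complexM(1,2)[OF Y, of n] chainM(1)[OF ec, of n]])
        (unfold P_def, blast)
  then have "\<forall>n. \<exists>Q q. P n Q q" by blast
  then obtain Q q where P: "\<And>n. P n (Q n) (q n)" by metis
  then have Q: "\<And>n. left_module R (Q n)" "\<And>n. small u (carrier (Q n))" and q: "\<And>n. q n \<in> linear_maps R (fst
      Y n) (Q n)"
    and onto: "\<And>n. q n ` carrier (fst Y n) = carrier (Q n)"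
    and q_eq: "\<And>n y z. \<lbrakk>y \<in> carrier (fst Y n); z \<in> carrier (fst Y n)\<rbrakk> \<Longrightarrow> q n y = q n z \<longleftrightarrow> (\<exists>x\<in>carrier (fst X
        n). y = z \<oplus>\<^bsub>fst Y n\<^esub> e n x)"
    by (simp_all add: P_def)
  note q = q linear_mapsD[OF q]
  define d where "d n = (\<lambda>w\<in>carrier (Q n). q (n - 1) (snd Y n (SOME y. y \<in> carrier (fst Y n) \<and> q n y = w)))"
      for n
  \<comment> \<open>The differential does not depend on the preimage. Two preimages differ by some
    \<open>e n x\<close>, whose boundary is the image of the boundary of \<open>x\<close> under
    \<open>e (n - 1)\<close> and is therefore killed by \<open>q (n - 1)\<close>.\<close>
  have dq: "d n (q n y) = q (n - 1) (snd Y n y)" if y: "y \<in> carrier (fst Y n)" for n y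
  proof -
    interpret Yn: left_module R "fst Y (n - 1)" by (rule complexM(1)[OF Y])
    define z where "z = (SOME z. z \<in> carrier (fst Y n) \<and> q n z = q n y)"
    have z: "z \<in> carrier (fst Y n)" "q n z = q n y"
      using someI[of "\<lambda>z. z \<in> carrier (fst Y n) \<and> q n z = q n y" y] y by (auto simp: z_def)
    then obtain x where x: "x \<in> carrier (fst X n)" "z = y \<oplus>\<^bsub>fst Y n\<^esub> e n x" using q_eq[OF z(1) y] by blast
    have "snd Y n z = snd Y n y \<oplus>\<^bsub>fst Y (n - 1)\<^esub> e (n - 1) (snd X n x)"
      using x y chainM(2,3)[OF ec x(1)] linear_mapsD(2)[OF complexM(3)[OF Y, of n], of y "e n x"] by simp
    then have "q (n - 1) (snd Y n z) = q (n - 1) (snd Y n y)"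
      using q_eq[OF complexM(4)[OF Y z(1)] complexM(4)[OF Y y]] complexM(4)[OF X x(1)] by blast
    then show ?thesis using q(2)[OF y] by (simp add: d_def z_def)
  qed
  have QC: "(Q, d) \<in> complexes M"
  proof (rule complexM_I[OF Q])
    fix n
    have m: "\<exists>y\<in>carrier (fst Y n). w = q n y" if "w \<in> carrier (Q n)" for w using that onto[of n] by blast
    have "linear R (Q n) (Q (n - 1)) (d n)"
    proof (rule linearI)
      fix w assume "w \<in> carrier (Q n)"
      then obtain y where y: "y \<in> carrier (fst Y n)" "w = q n y" using m by blast
      then show "d n w \<in> carrier (Q (n - 1))" using q(2)[OF complexM(4)[OF Y y(1)]] by (simp add: dq)
      {
        fix v assume "v \<in> carrier (Q n)"
        then obtain z where z: "z \<in> carrier (fst Y n)" "v = q n z" using m by blast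
        interpret Yn: left_module R "fst Y n" by (rule complexM(1)[OF Y])
        show "d n (w \<oplus>\<^bsub>Q n\<^esub> v) = d n w \<oplus>\<^bsub>Q (n - 1)\<^esub> d n v"
          using y z q(3)[OF y(1) z(1)] q(3)[OF complexM(4)[OF Y y(1)] complexM(4)[OF Y z(1)]]
            linear_mapsD(2)[OF complexM(3)[OF Y] y(1) z(1)] dq[of "y \<oplus>\<^bsub>fst Y n\<^esub> z" n] by (simp add: dq)
      }
      fix a assume a: "a \<in> carrier R"
      interpret Yn: left_module R "fst Y n" by (rule complexM(1)[OF Y])
      show "d n (a \<odot>\<^bsub>Q n\<^esub> w) = a \<odot>\<^bsub>Q (n - 1)\<^esub> d n w"
        using y a q(4)[OF a y(1)] q(4)[OF a complexM(4)[OF Y y(1)]]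
            linear_mapsD(3)[OF complexM(3)[OF Y] a y(1)] dq[of "a \<odot>\<^bsub>fst Y n\<^esub> y" n] by (simp add: dq)
    qed
    then show "d n \<in> linear_maps R (Q n) (Q (n - 1))" by (simp add: linear_maps_iff d_def)
    fix w assume "w \<in> carrier (Q n)"
    then obtain y where y: "y \<in> carrier (fst Y n)" "w = q n y" using m by blast
    have "d (n - 1) (d n w) = q (n - 2) (snd Y (n - 1) (snd Y n y))"
      using dq[OF complexM(4)[OF Y y(1)]] y by (simp add: dq)
    also have "\<dots> = q (n - 2) \<zero>\<^bsub>fst Y (n - 2)\<^esub>" using complexM(5)[OF Y y(1)] by simp
    also have "\<dots> = \<zero>\<^bsub>Q (n - 2)\<^esub>"
      using linear_zero[OF complexM(1)[OF Y] Q(1)] q(1)[of "n - 2"] by (simp add: linear_maps_iff)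
    finally show "d (n - 1) (d n w) = \<zero>\<^bsub>Q (n - 2)\<^esub>" .
  qed
  have qc: "q \<in> chain_maps M Y (Q, d)" by (rule chainM_I) (simp_all add: q(1) dq)
  have zc: "\<zero>\<^bsub>Hom C Y (Q, d)\<^esub> \<in> chain_maps M Y (Q, d)" using M.Ch.zero_mor[of Y "(Q, d)"] Y QC by simp
  have q0: "q n \<zero>\<^bsub>fst Y n\<^esub> = \<zero>\<^bsub>Q n\<^esub>" for n
    using linear_zero[OF complexM(1)[OF Y] Q(1)] q(1)[of n] by (simp add: linear_maps_iff)
  have "cmp C X Y (Q, d) q e = cmp C X Y (Q, d) \<zero>\<^bsub>Hom C Y (Q, d)\<^esub> e"
  proof
    fix n
    interpret Yn: left_module R "fst Y n" by (rule complexM(1)[OF Y])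
    have "q n (e n x) = \<zero>\<^bsub>Q n\<^esub>" if x: "x \<in> carrier (fst X n)" for x
    proof -
      have "\<exists>x'\<in>carrier (fst X n). e n x = \<zero>\<^bsub>fst Y n\<^esub> \<oplus>\<^bsub>fst Y n\<^esub> e n x'"
        using x chainM(2)[OF ec x] by (intro bexI[of _ x]) simp_all
      then show ?thesis using q_eq[OF chainM(2)[OF ec x] Yn.M.zero_closed] q0[of n] by simp
    qed
    then show "cmp C X Y (Q, d) q e n = cmp C X Y (Q, d) \<zero>\<^bsub>Hom C Y (Q, d)\<^esub> e n"
      using chainM(2)[OF ec] by (auto simp: compose_def fun_eq_iff restrict_def)
  qed
  then have "q = \<zero>\<^bsub>Hom C Y (Q, d)\<^esub>"
    using e QC qc zc unfolding epi_def by (metis Ch_simps(1,2))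
  then have "q n y = q n \<zero>\<^bsub>fst Y n\<^esub>" using y q0[of n] by (simp add: fun_eq_iff)
  interpret Yn: left_module R "fst Y n" by (rule complexM(1)[OF Y])
  obtain x where "x \<in> carrier (fst X n)" "y = \<zero>\<^bsub>fst Y n\<^esub> \<oplus>\<^bsub>fst Y n\<^esub> e n x"
    using q_eq[OF y Yn.M.zero_closed] \<open>q n y = q n \<zero>\<^bsub>fst Y n\<^esub>\<close> by blast
  then show ?thesis using chainM(2)[OF ec] by auto
qed

end

section \<open>Disk complexes\<close>

lemma Prj_simps [simp]:
  "objs (Prj C) = {P. projective C P}" "Hom (Prj C) = Hom C" "cmp (Prj C) = cmp C" "idm (Prj C) = idm C"
  by (simp_all add: Prj_def)

lemma projective_obj [simp]: "projective C P \<Longrightarrow> P \<in> objs C"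
  by (simp add: projective_def)

lemma coproj_Prj [simp]: "coproj (Prj C) I X Z \<iota> = coproj C I X Z \<iota>"
  by (rule ext) (simp add: coproj_def)

context preadditive_cat
begin

lemma Prj_preadditive: "preadditive (Prj A)"
  by (intro preadditive.intro categ.intro preadditive_axioms.intro)
    (simp_all add: cmp_assoc Hom_group cmp_add_left cmp_add_right)

text \<open>Lifts are found on the summands and glued.\<close>

lemma coproduct_projective:
  assumes Z: "is_coproduct A I X Z \<iota>" and X: "\<And>i. i \<in> I \<Longrightarrow> projective A (X i)"
  shows "projective A Z"
  unfolding projective_def
proof (intro conjI ballI allI impI)
  show ZA: "Z \<in> objs A" by (rule coproduct_obj[OF Z])
  have Xi: "X i \<in> objs A" if "i \<in> I" for i using X[OF that] by simp
  have \<iota>: "\<iota> i \<in> mor A (X i) Z" if "i \<in> I" for i by (rule coproduct_inj[OF Z that])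
  fix W Y e f assume W: "W \<in> objs A" and Y: "Y \<in> objs A" and e: "epi A W Y e" and f: "f \<in> mor A Z Y"
  have em: "e \<in> mor A W Y" using e by (simp add: epi_def)
  have "\<exists>g. g \<in> mor A (X i) W \<and> cmp A (X i) W Y e g = cmp A (X i) Z Y f (\<iota> i)" if i: "i \<in> I" for i
    using X[OF i] W Y e f \<iota>[OF i] Xi[OF i] ZA unfolding projective_def by (meson cmp_closed)
  then have "\<forall>i. \<exists>g. i \<in> I \<longrightarrow> g \<in> mor A (X i) W \<and> cmp A (X i) W Y e g = cmp A (X i) Z Y f (\<iota> i)" by blast
  from choice[OF this] obtain g where g: "\<And>i. i \<in> I \<Longrightarrow> g i \<in> mor A (X i) W"
    "\<And>i. i \<in> I \<Longrightarrow> cmp A (X i) W Y e (g i) = cmp A (X i) Z Y f (\<iota> i)" by blast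
  obtain h where h: "h \<in> mor A Z W" "\<And>i. i \<in> I \<Longrightarrow> cmp A (X i) Z W h (\<iota> i) = g i"
    using coproduct_ex[OF Z W, of g] g(1) by blast
  have "cmp A Z W Y e h = f"
  proof (rule coproduct_ext[OF Z Y])
    show "X ` I \<subseteq> objs A" using Xi by blast
    show "cmp A (X i) Z Y (cmp A Z W Y e h) (\<iota> i) = cmp A (X i) Z Y f (\<iota> i)" if "i \<in> I" for i
      using that h g em \<iota> Xi ZA W Y by (simp add: cmp_assoc)
  qed (use em h f ZA W Y in auto)
  then show "\<exists>g\<in>mor A Z W. cmp A Z W Y e g = f" using h(1) by blast
qed

text \<open>A full subcategory containing the coproduct of its objects inherits the universal
  property.\<close>

lemma coproduct_Prj:
  assumes Z: "is_coproduct A I X Z \<iota>" and X: "\<And>i. i \<in> I \<Longrightarrow> projective A (X i)"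
  shows "is_coproduct (Prj A) I X Z \<iota>"
  using Z coproduct_projective[OF Z X] unfolding is_coproduct_def by simp

end

context module_universe
begin

section \<open>The ring as a module inside the universe\<close>

definition emb :: "'r \<Rightarrow> 'u" where
  "emb = (SOME e. inj_on e (carrier R))"

lemma emb: "inj_on emb (carrier R)"
proof -
  obtain e :: "'r \<Rightarrow> 'u" where "inj_on e (carrier R)" by (rule small_embedding[OF small_carrier_R])
  then show ?thesis unfolding emb_def by (rule someI[of "\<lambda>e. inj_on e (carrier R)"])
qed

definition RR :: "('r, 'r) module" where
  "RR = module_of (carrier R) (add R) \<zero>\<^bsub>R\<^esub> (monoid.mult R)"

lemma RR: "left_module R RR"
proof -
  have "abelian_group RR"
  proof (rule abelian_groupI)
    fix x assume "x \<in> carrier RR"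
    then show "\<exists>y\<in>carrier RR. y \<oplus>\<^bsub>RR\<^esub> x = \<zero>\<^bsub>RR\<^esub>"
      by (intro bexI[of _ "\<ominus>\<^bsub>R\<^esub> x"]) (simp_all add: RR_def R.l_neg)
  qed (simp_all add: RR_def R.a_ac)
  then show ?thesis
    by (intro left_module.intro left_module_axioms.intro R) (simp_all add: RR_def R.l_distr R.r_distr
        R.m_assoc)
qed

text \<open>The free module of rank one, on a copy of the ring in \<open>'u\<close>; its basis
  element is \<open>un\<close>.\<close>

definition RU :: "('r, 'u) module" where
  "RU = transport emb RR"

definition un :: 'u where
  "un = emb \<one>\<^bsub>R\<^esub>"

text \<open>The linear map out of the free module of rank one that sends \<open>un\<close> to
  \<open>x\<close>.\<close>

definition scale :: "('r, 'u) module \<Rightarrow> 'u \<Rightarrow> 'u \<Rightarrow> 'u" where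
  "scale N x = (\<lambda>w\<in>carrier RU. inv_into (carrier R) emb w \<odot>\<^bsub>N\<^esub> x)"

lemma RR_carrier: "carrier RR = carrier R"
  by (simp add: RR_def)

lemma RU: "left_module R RU" "carrier RU = emb ` carrier R" "small u (carrier RU)" "un \<in> carrier RU"
  "w \<in> carrier RU \<Longrightarrow> \<exists>a\<in>carrier R. w = a \<odot>\<^bsub>RU\<^esub> un"
proof -
  have e: "inj_on emb (carrier RR)" using emb by (simp add: RR_carrier)
  note tr = transport[OF RR e, folded RU_def]
  show "left_module R RU" and c: "carrier RU = emb ` carrier R" using tr by (simp_all add: RR_carrier)
  show "small u (carrier RU)" unfolding c by (rule small_image[OF small_carrier_R])
  show "un \<in> carrier RU" by (simp add: c un_def)
  assume "w \<in> carrier RU"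
  then obtain a where a: "a \<in> carrier R" "w = emb a" using c by blast
  have "emb (a \<odot>\<^bsub>RR\<^esub> \<one>\<^bsub>R\<^esub>) = a \<odot>\<^bsub>RU\<^esub> emb \<one>\<^bsub>R\<^esub>" using linearD(3)[OF tr(2) a(1), of "\<one>\<^bsub>R\<^esub>"] by (simp add:
      RR_carrier)
  then show "\<exists>a\<in>carrier R. w = a \<odot>\<^bsub>RU\<^esub> un" using a by (intro bexI[of _ a]) (simp_all add: RR_def un_def)
qed

lemma scale:
  assumes N: "left_module R N" and x: "x \<in> carrier N"
  shows "scale N x \<in> linear_maps R RU N" "scale N x un = x"
proof -
  interpret N: left_module R N by (rule N)
  have e: "inj_on emb (carrier RR)" using emb by (simp add: RR_carrier)
  note tr = transport[OF RR e, folded RU_def]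
  have "linear R RR N (\<lambda>r. r \<odot>\<^bsub>N\<^esub> x)"
    by (rule linearI) (use x in \<open>simp_all add: RR_def N.smult_l_distr N.smult_assoc\<close>)
  then show "scale N x \<in> linear_maps R RU N"
    using linear_restrict[OF tr(1) linear_compose[OF tr(3)], of N "\<lambda>r. r \<odot>\<^bsub>N\<^esub> x"] by (simp add: scale_def
        RR_carrier)
  show "scale N x un = x" using x emb by (simp add: scale_def RU(2) un_def)
qed

lemma linear_RU_eqI:
  assumes "f \<in> linear_maps R RU N" "g \<in> linear_maps R RU N" "f un = g un"
  shows "f = g"
proof (rule linear_maps_eqI[OF assms(1,2)])
  fix w assume "w \<in> carrier RU"
  then obtain a where "a \<in> carrier R" "w = a \<odot>\<^bsub>RU\<^esub> un" using RU(5) by blast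
  then show "f w = g w" using linear_mapsD(3)[OF assms(1)] linear_mapsD(3)[OF assms(2)] RU(4) assms(3) by
      simp
qed

text \<open>A zero module whose element is the zero of \<open>RU\<close>, so that the zero of a disk
  is the same element in every degree.\<close>

definition ZU :: "('r, 'u) module" where
  "ZU = module_of {\<zero>\<^bsub>RU\<^esub>} (add RU) \<zero>\<^bsub>RU\<^esub> (smult RU)"

lemma ZU: "left_module R ZU" "carrier ZU = {\<zero>\<^bsub>RU\<^esub>}" "\<zero>\<^bsub>ZU\<^esub> = \<zero>\<^bsub>RU\<^esub>"
proof -
  interpret RU: left_module R RU by (rule RU)
  show "left_module R ZU"
    by (rule left_module_image[OF RU(1), of _ "\<lambda>_. \<zero>\<^bsub>RU\<^esub>"]) (use RU(4) in \<open>auto simp: ZU_def RU.smult_zero\<close>)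
qed (simp_all add: ZU_def)

text \<open>The complex \<open>R = R\<close> concentrated in degrees \<open>k\<close> and \<open>k - 1\<close>; it represents \<open>X \<mapsto> X\<^sub>k\<close>.\<close>

definition disk :: "int \<Rightarrow> (('r, 'u) module, 'u \<Rightarrow> 'u) complex" where
  "disk k = (\<lambda>n. if n = k \<or> n = k - 1 then RU else ZU,
     \<lambda>n. if n = k then (\<lambda>x\<in>carrier RU. x) else (\<lambda>x\<in>carrier (if n = k - 1 then RU else ZU). \<zero>\<^bsub>RU\<^esub>))"

lemma disk_simps [simp]:
  "fst (disk k) k = RU" "fst (disk k) (k - 1) = RU" "snd (disk k) k = (\<lambda>x\<in>carrier RU. x)"
  by (simp_all add: disk_def)

lemma disk_zero: "\<zero>\<^bsub>fst (disk k) n\<^esub> = \<zero>\<^bsub>RU\<^esub>" "n \<noteq> k \<Longrightarrow> x \<in> carrier (fst (disk k) n) \<Longrightarrow> snd (disk k) n x =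
    \<zero>\<^bsub>RU\<^esub>"
  "n \<noteq> k \<Longrightarrow> n \<noteq> k - 1 \<Longrightarrow> carrier (fst (disk k) n) = {\<zero>\<^bsub>RU\<^esub>}"
  using ZU by (auto simp: disk_def)

lemma disk_module: "left_module R (fst (disk k) n)" "small u (carrier (fst (disk k) n))"
  using RU ZU by (auto simp: disk_def small_finite_set)

lemma linear_maps_zero:
  assumes "left_module R N" "left_module R L"
  shows "(\<lambda>x\<in>carrier N. \<zero>\<^bsub>L\<^esub>) \<in> linear_maps R N L"
proof -
  interpret N: left_module R N by fact
  interpret L: left_module R L by fact
  show ?thesis by (rule linear_restrict[OF assms(1)]) (rule linearI, simp_all add: L.smult_zero)
qed

lemma disk_complex: "disk k \<in> complexes M"
proof -
  interpret RU: left_module R RU by (rule RU)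
  have d: "snd (disk k) n \<in> linear_maps R (fst (disk k) n) (fst (disk k) (n - 1))" for n
  proof (cases "n = k")
    case True
    have "(\<lambda>x\<in>carrier RU. x) \<in> linear_maps R RU RU"
      by (rule linear_restrict[OF RU(1)]) (rule linearI, simp_all)
    then show ?thesis using True by simp
  next
    case False
    then have "snd (disk k) n = (\<lambda>x\<in>carrier (fst (disk k) n). \<zero>\<^bsub>fst (disk k) (n - 1)\<^esub>)"
      unfolding disk_zero(1) by (simp add: disk_def)
    then show ?thesis using linear_maps_zero[OF disk_module(1) disk_module(1)] by simp
  qed
  have "(fst (disk k), snd (disk k)) \<in> complexes M"
  proof (rule complexM_I)
    show "left_module R (fst (disk k) n)" "small u (carrier (fst (disk k) n))"
      "snd (disk k) n \<in> linear_maps R (fst (disk k) n) (fst (disk k) (n - 1))" for n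
      by (rule disk_module d)+
    fix n x assume x: "x \<in> carrier (fst (disk k) n)"
    show "snd (disk k) (n - 1) (snd (disk k) n x) = \<zero>\<^bsub>fst (disk k) (n - 2)\<^esub>"
    proof (cases "n = k")
      case True
      then show ?thesis using linear_mapsD(1)[OF d x] by (simp add: disk_zero)
    next
      case False
      then have "snd (disk k) n x = \<zero>\<^bsub>fst (disk k) (n - 1)\<^esub>" using x by (simp add: disk_zero)
      then show ?thesis
        using linear_zero[OF disk_module(1) disk_module(1), of k "n - 1" k "n - 1 - 1" "snd (disk k) (n -
            1)"] d[of "n - 1"] by (simp add: linear_maps_iff)
    qed
  qed
  then show ?thesis by simp
qed

text \<open>The element \<open>un\<close> generates degree \<open>k\<close>. One degree lower the
  map is determined as well because the differential is the identity, and elsewhere the disk is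
  zero.\<close>

lemma disk_eqI:
  assumes X: "X \<in> complexes M" and f: "f \<in> chain_maps M (disk k) X" and g: "g \<in> chain_maps M (disk k) X" and
      eq: "f k un = g k un"
  shows "f = g"
proof
  fix n
  have un: "un \<in> carrier (fst (disk k) k)" using RU(4) by simp
  consider "n = k" | "n = k - 1" | "n \<noteq> k" "n \<noteq> k - 1" by blast
  then show "f n = g n"
  proof cases
    case 1
    then show ?thesis using linear_RU_eqI[of "f k" "fst X k" "g k"] chainM(1)[OF f, of k] chainM(1)[OF g, of
        k] eq by simp
  next
    case 2
    have "f (k - 1) un = g (k - 1) un"
      using chainM(3)[OF f un] chainM(3)[OF g un] eq RU(4) by simp
    then show ?thesis using 2 linear_RU_eqI[of "f (k - 1)" "fst X (k - 1)" "g (k - 1)"] chainM(1)[OF f, of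
        "k - 1"] chainM(1)[OF g, of "k - 1"] by simp
  next
    case 3
    have "f n \<zero>\<^bsub>RU\<^esub> = \<zero>\<^bsub>fst X n\<^esub>" "g n \<zero>\<^bsub>RU\<^esub> = \<zero>\<^bsub>fst X n\<^esub>"
      using linear_zero[OF disk_module(1) complexM(1)[OF X, of n], of k n "f n"] linear_zero[OF
          disk_module(1) complexM(1)[OF X, of n], of k n "g n"]
        chainM(1)[OF f, of n] chainM(1)[OF g, of n] by (simp_all add: linear_maps_iff disk_zero)
    then show ?thesis
      by (intro linear_maps_eqI[OF chainM(1)[OF f, of n] chainM(1)[OF g, of n]]) (simp add: disk_zero(3)[OF
          3])
  qed
qed

text \<open>The existence half of representability: \<open>un\<close> may go to any
  \<open>x\<close>, and in degree \<open>k - 1\<close> it must then go to the boundary of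
  \<open>x\<close>.\<close>

lemma disk_map_exists:
  assumes X: "X \<in> complexes M" and x: "x \<in> carrier (fst X k)"
  obtains f where "f \<in> chain_maps M (disk k) X" "f k un = x"
proof -
  define f where "f n = (if n = k then scale (fst X k) x else if n = k - 1 then scale (fst X (k - 1)) (snd X
      k x)
      else (\<lambda>x\<in>carrier (fst (disk k) n). \<zero>\<^bsub>fst X n\<^esub>))" for n
  have s1: "scale (fst X k) x \<in> linear_maps R RU (fst X k)" "scale (fst X k) x un = x"
    by (rule scale[OF complexM(1)[OF X] x])+
  have s2: "scale (fst X (k - 1)) (snd X k x) \<in> linear_maps R RU (fst X (k - 1))" "scale (fst X (k - 1))
      (snd X k x) un = snd X k x"
    by (rule scale[OF complexM(1)[OF X] complexM(4)[OF X x]])+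
  have lin: "f n \<in> linear_maps R (fst (disk k) n) (fst X n)" for n
    using s1(1) s2(1) linear_maps_zero[OF disk_module(1) complexM(1)[OF X]] by (simp add: f_def)
  have lz: "h \<zero>\<^bsub>N\<^esub> = \<zero>\<^bsub>L\<^esub>" if "h \<in> linear_maps R N L" "left_module R N" "left_module R L" for h N L
    using linear_zero[OF that(2,3)] that(1) by (simp add: linear_maps_iff)
  have "f \<in> chain_maps M (disk k) X"
  proof (rule chainM_I[OF lin])
    fix n w assume w: "w \<in> carrier (fst (disk k) n)"
    have comp: "compose (carrier (fst (disk k) n)) (snd X n) (f n) \<in> linear_maps R (fst (disk k) n) (fst X
        (n - 1))"
      by (rule compose_linear[OF disk_module(1) lin complexM(3)[OF X]])
    show "snd X n (f n w) = f (n - 1) (snd (disk k) n w)"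
    proof (cases "n = k")
      case True
      have "compose (carrier RU) (snd X k) (f k) = f (k - 1)"
      proof (rule linear_RU_eqI)
        show "compose (carrier RU) (snd X k) (f k) \<in> linear_maps R RU (fst X (k - 1))" using comp True by
            simp
        show "f (k - 1) \<in> linear_maps R RU (fst X (k - 1))" using lin[of "k - 1"] by simp
        show "compose (carrier RU) (snd X k) (f k) un = f (k - 1) un" using RU(4) s1(2) s2(2) by (simp add:
            compose_def f_def)
      qed
      from fun_cong[OF this, of w] show ?thesis using w True by (simp add: compose_def)
    next
      case False
      have rhs: "f (n - 1) (snd (disk k) n w) = \<zero>\<^bsub>fst X (n - 1)\<^esub>"
        using lz[OF lin[of "n - 1"] disk_module(1) complexM(1)[OF X]] disk_zero False w by simp
      show ?thesis
      \<comment> \<open>In the lower degree of the disk, \<open>un\<close> has been sent to a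
        boundary, and the boundary of that is zero.\<close>
      proof (cases "n = k - 1")
        case True
        have "compose (carrier RU) (snd X n) (f n) = (\<lambda>x\<in>carrier RU. \<zero>\<^bsub>fst X (n - 1)\<^esub>)"
        proof (rule linear_RU_eqI)
          show "compose (carrier RU) (snd X n) (f n) \<in> linear_maps R RU (fst X (n - 1))" using comp True by
              simp
          show "(\<lambda>x\<in>carrier RU. \<zero>\<^bsub>fst X (n - 1)\<^esub>) \<in> linear_maps R RU (fst X (n - 1))"
            by (rule linear_maps_zero[OF RU(1) complexM(1)[OF X]])
          show "compose (carrier RU) (snd X n) (f n) un = (\<lambda>x\<in>carrier RU. \<zero>\<^bsub>fst X (n - 1)\<^esub>) un"
            using RU(4) s2(2) True complexM(5)[OF X x] by (simp add: compose_def f_def)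
        qed
        from fun_cong[OF this, of w] show ?thesis using w True rhs by (simp add: compose_def)
      next
        case 2: False
        have "w = \<zero>\<^bsub>fst (disk k) n\<^esub>" using w disk_zero(1,3) False 2 by simp
        then have "f n w = \<zero>\<^bsub>fst X n\<^esub>" using lz[OF lin disk_module(1) complexM(1)[OF X]] by simp
        then show ?thesis using lz[OF complexM(3)[OF X] complexM(1)[OF X] complexM(1)[OF X]] rhs by simp
      qed
    qed
  qed
  moreover have "f k un = x" using s1(2) by (simp add: f_def)
  ultimately show ?thesis using that by blast
qed

text \<open>By representability, lifting a map from the disk along \<open>e\<close> means lifting a
  single element of degree \<open>k\<close>, and epimorphisms are surjective in every
  degree.\<close>

lemma disk_projective: "projective C (disk k)"
  unfolding projective_def
proof (intro conjI ballI allI impI)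
  show "disk k \<in> objs C" using disk_complex by simp
  fix X Y e f assume "X \<in> objs C" "Y \<in> objs C" and e: "epi C X Y e" and "f \<in> mor C (disk k) Y"
  then have X: "X \<in> complexes M" and Y: "Y \<in> complexes M" and f: "f \<in> chain_maps M (disk k) Y" by simp_all
  have ec: "e \<in> chain_maps M X Y" using e by (simp add: epi_def)
  have "f k un \<in> carrier (fst Y k)" using chainM(2)[OF f, of un k] RU(4) by simp
  then obtain x where x: "x \<in> carrier (fst X k)" "e k x = f k un" using epi_surjective[OF X Y e] by blast
  obtain g where g: "g \<in> chain_maps M (disk k) X" "g k un = x" using disk_map_exists[OF X x(1)] by blast
  have "cmp C (disk k) X Y e g = f"
  proof (rule disk_eqI[OF Y _ f])
    show "cmp C (disk k) X Y e g \<in> chain_maps M (disk k) Y" using M.Ch.cmp_closed[of g "disk k" X e Y] g ec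
        X Y disk_complex by simp
    show "cmp C (disk k) X Y e g k un = f k un" using g x RU(4) by (simp add: compose_def)
  qed
  then show "\<exists>g\<in>mor C (disk k) X. cmp C (disk k) X Y e g = f" using g by auto
qed

definition disks where "disks = range disk"

text \<open>A map from a disk is zero if it kills \<open>un\<close>. The support is therefore
  contained in that of one element of \<open>Z\<close> in degree \<open>k\<close>, which is even
  finite.\<close>

lemma disks_countable_supports:
  assumes Z: "is_coproduct C I X Z \<iota>" and X: "X ` I \<subseteq> complexes M"
    and fin: "\<And>n z. z \<in> carrier (fst Z n) \<Longrightarrow> finite {i\<in>I. coproj C I X Z \<iota> i n z \<noteq> \<zero>\<^bsub>fst (X i) n\<^esub>}"
  shows "countable_supports C disks I X Z \<iota>"
  unfolding countable_supports_def
proof (intro ballI)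
  fix g f assume "g \<in> disks" and "f \<in> mor C g Z"
  then obtain k where k: "g = disk k" and f: "f \<in> chain_maps M (disk k) Z" by (auto simp: disks_def)
  have XC: "X ` I \<subseteq> objs C" using X by simp
  have ZC: "Z \<in> complexes M" using coproduct_obj[OF Z] by simp
  have z: "f k un \<in> carrier (fst Z k)" using chainM(2)[OF f, of un k] RU(4) by simp
  have "{i\<in>I. cmp C (disk k) Z (X i) (coproj C I X Z \<iota> i) f \<noteq> \<zero>\<^bsub>Hom C (disk k) (X i)\<^esub>} \<subseteq>
      {i\<in>I. coproj C I X Z \<iota> i k (f k un) \<noteq> \<zero>\<^bsub>fst (X i) k\<^esub>}"
  proof (rule subsetI, rule CollectI, rule conjI)
    fix i assume i': "i \<in> {i\<in>I. cmp C (disk k) Z (X i) (coproj C I X Z \<iota> i) f \<noteq> \<zero>\<^bsub>Hom C (disk k) (X i)\<^esub>}"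
    then show i: "i \<in> I" by simp
    then have Xi: "X i \<in> complexes M" using X by blast
    have p: "coproj C I X Z \<iota> i \<in> mor C Z (X i)" by (rule M.Ch.coproj_mor[OF Z XC i])
    show "coproj C I X Z \<iota> i k (f k un) \<noteq> \<zero>\<^bsub>fst (X i) k\<^esub>"
    proof
      assume 0: "coproj C I X Z \<iota> i k (f k un) = \<zero>\<^bsub>fst (X i) k\<^esub>"
      have "cmp C (disk k) Z (X i) (coproj C I X Z \<iota> i) f = \<zero>\<^bsub>Hom C (disk k) (X i)\<^esub>"
      proof (rule disk_eqI[OF Xi])
        show "cmp C (disk k) Z (X i) (coproj C I X Z \<iota> i) f \<in> chain_maps M (disk k) (X i)"
          using M.Ch.cmp_closed[of f "disk k" Z "coproj C I X Z \<iota> i" "X i"] p f disk_complex ZC Xi by simp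
        show "\<zero>\<^bsub>Hom C (disk k) (X i)\<^esub> \<in> chain_maps M (disk k) (X i)" using M.Ch.zero_mor[of "disk k" "X i"]
            disk_complex Xi by simp
        show "cmp C (disk k) Z (X i) (coproj C I X Z \<iota> i) f k un = \<zero>\<^bsub>Hom C (disk k) (X i)\<^esub> k un"
          using 0 RU(4) by (simp add: compose_def)
      qed
      then show False using i' by simp
    qed
  qed
  then show "countable {i\<in>I. cmp C g Z (X i) (coproj C I X Z \<iota> i) f \<noteq> \<zero>\<^bsub>Hom C g (X i)\<^esub>}"
    unfolding k using fin[OF z] by (meson countable_finite finite_subset)
qed

text \<open>One disk is taken for every element of \<open>X\<close> in every degree. Their coproduct
  maps onto \<open>X\<close>, and this epimorphism splits since \<open>X\<close> is
  projective.\<close>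

lemma projective_retract:
  assumes X: "projective C X"
  obtains I :: "'u set" and \<gamma> Z \<iota> i p where "small u I" "\<gamma> ` I \<subseteq> disks" "is_coproduct C I \<gamma> Z \<iota>"
    "i \<in> mor C X Z" "p \<in> mor C Z X" "cmp C X Z X p i = idm C X"
proof -
  have XC: "X \<in> complexes M" using projective_obj[OF X] by simp
  define T where "T = (SIGMA k:(UNIV :: int set). carrier (fst X k))"
  have "small u T" unfolding T_def
    by (intro small_Sigma small_countable_set complexM(2)[OF XC]) simp
  \<comment> \<open>Index sets have to lie in \<open>'u\<close>, so the pairs of a degree and an
    element are renamed by \<open>e\<close>.\<close>
  then obtain e :: "int \<times> 'u \<Rightarrow> 'u" where e: "inj_on e T" by (rule small_embedding)
  define I where "I = e ` T"
  define \<gamma> where "\<gamma> b = disk (fst (inv_into T e b))" for b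
  have I: "small u I" unfolding I_def by (rule small_image) fact
  have \<gamma>: "\<gamma> ` I \<subseteq> disks" by (auto simp: \<gamma>_def disks_def)
  have \<gamma>C: "\<gamma> ` I \<subseteq> complexes M" using disk_complex by (auto simp: \<gamma>_def)
  obtain Z \<iota> where Z: "is_coproduct C I \<gamma> Z \<iota>" by (rule Ch_coproduct[OF I \<gamma>C])
  have ZC: "Z \<in> complexes M" using coproduct_obj[OF Z] by simp
  have "\<exists>f. f \<in> chain_maps M (\<gamma> b) X \<and> f (fst (inv_into T e b)) un = snd (inv_into T e b)" if "b \<in> I" for b
  proof -
    have "inv_into T e b \<in> T" using that by (simp add: I_def inv_into_into)
    then have "snd (inv_into T e b) \<in> carrier (fst X (fst (inv_into T e b)))" by (auto simp: T_def)
    then show ?thesis using disk_map_exists[OF XC] unfolding \<gamma>_def by metis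
  qed
  then have "\<forall>b. \<exists>f. b \<in> I \<longrightarrow> f \<in> chain_maps M (\<gamma> b) X \<and> f (fst (inv_into T e b)) un = snd (inv_into T e b)"
      by blast
  from choice[OF this] obtain \<theta> where \<theta>: "\<And>b. b \<in> I \<Longrightarrow> \<theta> b \<in> chain_maps M (\<gamma> b) X"
    "\<And>b. b \<in> I \<Longrightarrow> \<theta> b (fst (inv_into T e b)) un = snd (inv_into T e b)" by blast
  obtain p where p: "p \<in> mor C Z X" "\<And>b. b \<in> I \<Longrightarrow> cmp C (\<gamma> b) Z X p (\<iota> b) = \<theta> b"
    by (rule coproduct_ex[OF Z, of X \<theta>]) (use \<theta> XC in auto)
  \<comment> \<open>Maps that agree after \<open>p\<close> agree on every element \<open>x\<close>
    of \<open>X\<close>, because \<open>x\<close> is the value at \<open>un\<close> of the map from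
    its own disk.\<close>
  have epi: "epi C Z X p"
    unfolding epi_def
  proof (intro conjI ballI impI)
    fix W g h assume "W \<in> objs C" "g \<in> mor C X W" "h \<in> mor C X W" and eq: "cmp C Z X W g p = cmp C Z X W h
        p"
    then have W: "W \<in> complexes M" and g: "g \<in> chain_maps M X W" and h: "h \<in> chain_maps M X W" by simp_all
    show "g = h"
    proof
      fix k
      show "g k = h k"
      proof (rule linear_maps_eqI[OF chainM(1)[OF g] chainM(1)[OF h]])
        fix x assume x: "x \<in> carrier (fst X k)"
        then have kx: "(k, x) \<in> T" by (simp add: T_def)
        define b where "b = e (k, x)"
        have b: "b \<in> I" using kx by (simp add: b_def I_def)
        have inv: "inv_into T e b = (k, x)" using kx e by (simp add: b_def)
        have \<gamma>b: "\<gamma> b = disk k" by (simp add: \<gamma>_def inv)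
        have \<theta>b: "\<theta> b k un = x" using \<theta>(2)[OF b] by (simp add: inv)
        have \<iota>b: "\<iota> b \<in> mor C (\<gamma> b) Z" by (rule coproduct_inj[OF Z b])
        have "cmp C (\<gamma> b) X W g (\<theta> b) = cmp C (\<gamma> b) X W h (\<theta> b)"
          unfolding p(2)[OF b, symmetric]
          using M.Ch.cmp_assoc[OF \<iota>b p(1), of g W] M.Ch.cmp_assoc[OF \<iota>b p(1), of h W] eq g h \<gamma>C b ZC XC W by
              (auto simp del: Ch_simps(5))
        from fun_cong[OF fun_cong[OF this, of k], of un] show "g k x = h k x"
          using RU(4) \<theta>b by (simp add: \<gamma>b compose_def)
      qed
    qed
  qed (rule p)
  have "idm C X \<in> mor C X X" using M.Ch.idm_closed[of X] XC by simp
  then obtain i where "i \<in> mor C X Z" "cmp C X Z X p i = idm C X"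
    using X epi ZC XC unfolding projective_def by (metis Ch_simps(1))
  then show ?thesis using that I \<gamma> Z p(1) by blast
qed

section \<open>Projective complexes as a countably generated category\<close>

text \<open>A subset of a disjoint union is a pair of subsets, so the bound follows from the two
  power sets that a universe makes small.\<close>

lemma small_Pow_Plus: "small u (Pow (carrier R <+> (UNIV :: nat set)))"
proof (rule small_inj_on)
  show "small u (SIGMA A:Pow (carrier R). Pow (UNIV :: nat set))"
    using U by (intro small_Sigma) (auto simp: universe_for_def small_itself[of u])
  show "inj_on (\<lambda>A. (Inl -` A, Inr -` A)) (Pow (carrier R <+> (UNIV :: nat set)))"
  proof (rule inj_onI)
    fix A B :: "('r + nat) set" assume eq: "(Inl -` A, Inr -` A) = (Inl -` B, Inr -` B)"
    have "x \<in> A \<longleftrightarrow> x \<in> B" for x using eq by (cases x) auto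
    then show "A = B" by blast
  qed
  show "(\<lambda>A. (Inl -` A, Inr -` A)) ` Pow (carrier R <+> (UNIV :: nat set)) \<subseteq> (SIGMA A:Pow (carrier R). Pow
      (UNIV :: nat set))"
    by auto
qed

text \<open>\<open>V\<close> is a copy of the ring together with the naturals: the naturals make it
  infinite and bound the number of disks, the ring bounds the maps between two disks.\<close>

lemma Prj_countably_generated: "\<exists>V :: 'u set. countably_generated (Prj C) u disks V"
proof -
  let ?W = "carrier R <+> (UNIV :: nat set)"
  have "inj_on (\<lambda>x. {x}) ?W" "(\<lambda>x. {x}) ` ?W \<subseteq> Pow ?W" by auto
  then have "small u ?W" by (rule small_inj_on[OF small_Pow_Plus])
  then obtain e :: "'r + nat \<Rightarrow> 'u" where e: "inj_on e ?W" by (rule small_embedding)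
  define V where "V = e ` ?W"
  have W: "|carrier R| \<le>o |V|" "|UNIV :: nat set| \<le>o |V|"
  proof -
    have "inj_on (e \<circ> Inl) (carrier R)" "(e \<circ> Inl) ` carrier R \<subseteq> V"
      using e by (auto simp: V_def inj_on_def)
    then show "|carrier R| \<le>o |V|" by (intro card_of_ordLeq[THEN iffD1] exI conjI)
    have "inj_on (e \<circ> Inr) (UNIV :: nat set)" "(e \<circ> Inr) ` (UNIV :: nat set) \<subseteq> V"
      using e by (auto simp: V_def inj_on_def)
    then show "|UNIV :: nat set| \<le>o |V|" by (intro card_of_ordLeq[THEN iffD1] exI conjI)
  qed
  have "countably_generated (Prj C) u disks V"
  proof (intro countably_generated.intro preadditive_cat.intro countably_generated_axioms.intro)
    show "preadditive (Prj C)" by (rule preadditive_cat.Prj_preadditive) (rule preadditive_cat.intro[OF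
        M.Ch_preadditive])
    show "disks \<subseteq> objs (Prj C)" using disk_projective by (auto simp: disks_def)
    have ChC: "preadditive_cat C" by (rule preadditive_cat.intro[OF M.Ch_preadditive])
    {
      fix I :: "'u set" and X assume I: "small u I" and X: "X ` I \<subseteq> objs (Prj C)"
      then have Xi: "projective C (X i)" if "i \<in> I" for i using that by auto
      then have "X i \<in> complexes M" if "i \<in> I" for i using projective_obj[OF Xi[OF that]] by simp
      then have XC: "X ` I \<subseteq> complexes M" by blast
      obtain Z \<iota> where Z: "is_coproduct C I X Z \<iota>" "jointly_monic C I X Z \<iota>"
        "\<And>n z. z \<in> carrier (fst Z n) \<Longrightarrow> finite {i\<in>I. coproj C I X Z \<iota> i n z \<noteq> \<zero>\<^bsub>fst (X i) n\<^esub>}"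
        by (rule Ch_coproduct[OF I XC]) (rule that)
      have "is_coproduct (Prj C) I X Z \<iota>" by (rule preadditive_cat.coproduct_Prj[OF ChC Z(1) Xi])
      moreover have "jointly_monic (Prj C) I X Z \<iota>" using Z(2) unfolding jointly_monic_def by (simp del:
          Ch_simps)
      moreover have "countable_supports (Prj C) disks I X Z \<iota>"
        using disks_countable_supports[OF Z(1) XC Z(3)] unfolding countable_supports_def by (simp del:
            Ch_simps)
      ultimately show "\<exists>Z \<iota>. is_coproduct (Prj C) I X Z \<iota> \<and> jointly_monic (Prj C) I X Z \<iota> \<and>
          countable_supports (Prj C) disks I X Z \<iota>"
        by blast
    }
    {
      fix X assume "X \<in> objs (Prj C)"
      then have X: "projective C X" by simp
      show "\<exists>(I :: 'u set) \<gamma> Z \<iota> i p. small u I \<and> \<gamma> ` I \<subseteq> disks \<and> is_coproduct (Prj C) I \<gamma> Z \<iota> \<and>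
        i \<in> mor (Prj C) X Z \<and> p \<in> mor (Prj C) Z X \<and> cmp (Prj C) X Z X p i = idm (Prj C) X"
      proof (rule projective_retract[OF X])
        fix I :: "'u set" and \<gamma> Z \<iota> i p
        assume a: "small u I" "\<gamma> ` I \<subseteq> disks" "is_coproduct C I \<gamma> Z \<iota>" "i \<in> mor C X Z" "p \<in> mor C Z X" "cmp
            C X Z X p i = idm C X"
        have "is_coproduct (Prj C) I \<gamma> Z \<iota>"
          by (rule preadditive_cat.coproduct_Prj[OF ChC a(3)]) (use a(2) disk_projective in \<open>auto simp:
              disks_def\<close>)
        then show ?thesis using a(1,2,4-6) unfolding Prj_simps by blast
      qed
    }
    show "infinite V" using W(2) card_of_ordLeq_infinite[OF W(2)] by simp
    show "small u (Pow V)"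
    proof -
      have "image e ` Pow ?W = Pow V" by (rule image_Pow_surj) (simp add: V_def)
      then show ?thesis using small_image[OF small_Pow_Plus, of "image e"] by simp
    qed
    show "|disks| \<le>o |V|"
    proof -
      have "countable disks" by (simp add: disks_def)
      then have "|disks| \<le>o |UNIV :: nat set|" using card_of_ordLeq[of disks "UNIV :: nat set"] by (auto
          simp: countable_def)
      then show ?thesis using W(2) by (rule ordLeq_transitive)
    qed
    fix g h assume "g \<in> disks" "h \<in> disks"
    then obtain k j where kj: "g = disk k" "h = disk j" by (auto simp: disks_def)
    \<comment> \<open>A map between disks is determined by the image of \<open>un\<close>, which
      lies in the copy of the ring or is zero.\<close>
    have "inj_on (\<lambda>f. f k un) (chain_maps M (disk k) (disk j))"
      by (rule inj_onI) (rule disk_eqI[OF disk_complex])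
    moreover have "(\<lambda>f. f k un) ` chain_maps M (disk k) (disk j) \<subseteq> emb ` carrier R"
    proof (rule image_subsetI)
      interpret RU: left_module R RU by (rule RU)
      fix f assume f: "f \<in> chain_maps M (disk k) (disk j)"
      have "f k un \<in> carrier (fst (disk j) k)" using chainM(2)[OF f, of un k] RU(4) by simp
      moreover have "carrier (fst (disk j) k) \<subseteq> carrier RU" using ZU(2) by (simp add: disk_def)
      ultimately show "f k un \<in> emb ` carrier R" using RU(2) by blast
    qed
    ultimately have "|chain_maps M (disk k) (disk j)| \<le>o |emb ` carrier R|"
      using card_of_ordLeq[of "chain_maps M (disk k) (disk j)" "emb ` carrier R"] by auto
    also have "|emb ` carrier R| \<le>o |carrier R|" by (rule card_of_image)
    also have "|carrier R| \<le>o |V|" by (rule W(1))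
    finally show "|mor (Prj C) g h| \<le>o |V|" by (simp add: kj)
  qed
  then show ?thesis by blast
qed

end

theorem corollary3p9:
  fixes R :: "('r, 'x) ring_scheme"
  assumes "ring R"
    and "universe_for TYPE('u) R"
  shows "well_generated TYPE('u) (K (Prj (Ch (ModCat R :: (('r, 'u) module, 'u \<Rightarrow> 'u) category))))"
proof -
  interpret module_universe R "TYPE('u)" by (rule module_universe.intro[OF assms])
  obtain V :: "'u set" where "countably_generated (Prj C) TYPE('u) disks V" using Prj_countably_generated by
      blast
  then show ?thesis by (rule countably_generated.K_well_generated)
qed

end
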